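(* Let $\Delta$ be an irreducible ADE root system of rank $n$ with root lattice $M_\Delta$, let $k=|G_\Delta|$ be the order of the corresponding finite subgroup of $\mathrm{SU}(2)$, let $\zeta\in M_\Delta\otimes\mathbb{Q}$ be the dual vector of the longest root, and let $$\theta_\Delta(\tau)=\sum_{m\in M_\Delta}q^{\frac k2\left(m+\frac1k\zeta\,\middle|\,m+\frac1k\zeta\right)},\qquad q=e^{2\pi i\tau}.$$ If $\Delta$ is of type $A_n$, then $$\theta_{A_n}(\tau)=\frac{\eta^{n+1}((n+1)\tau)}{\eta(\tau)}.$$ If $\Delta$ is of type $D_n$ or $E_n$, then $$\theta_\Delta(\tau)=\frac{\eta^2(2\tau)\,\eta^{n+2}(4E\tau)}{\eta(\tau)\,\eta(2E\tau)\,\eta(2F\tau)\,\eta(2V\tau)},$$ where $(E,F,V)=(n-2,2,n-2)$ for $\Delta=D_n$, $(6,4,4)$ for $\Delta=E_6$, $(12,8,6)$ for $\Delta=E_7$, and $(30,20,12)$ for $\Delta=E_8$.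
   Context: $\eta(\tau)=q^{1/24}\prod_{n\ge1}(1-q^n)$ is the Dedekind eta function, $\tau$ in the upper half-plane. The root lattice $M_\Delta$ is identified with $\mathbb{Z}^n$ via simple positive roots $\alpha_1,\dots,\alpha_n$; $(u|v)=u^{t}C_\Delta v$ is the Weyl invariant bilinear form given by the Cartan matrix $C_\Delta$ (so $(\alpha_i|\alpha_i)=2$). The longest root is $d=\sum_i d_i\alpha_i=(d_1,\dots,d_n)$, and $\zeta=C_\Delta^{-1}d$, i.e. $\zeta$ is determined by $(\zeta|\alpha_i)=d_i$ for all $i$. The group $G_\Delta\subset\mathrm{SU}(2)$ corresponding to $\Delta$ is cyclic of order $n+1$ for $A_n$, binary dihedral of order $4(n-2)$ for $D_n$ ($n\ge4$), and binary tetrahedral, octahedral, icosahedral of order $24,48,120$ for $E_6,E_7,E_8$; thus $k=|G_\Delta|=1+\sum_i d_i^2$. *)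

theory Defs
  imports "HOL-Analysis.Analysis" "HOL-Algebra.Generated_Groups"
begin

section \<open>The Dedekind eta function\<close>

definition dedekind_eta :: "complex \<Rightarrow> complex" where
  "dedekind_eta \<tau> =
     exp (2 * of_real pi * \<i> * \<tau> / 24) * (\<Prod>n. 1 - exp (2 * of_real pi * \<i> * \<tau>) ^ (n + 1))"

section \<open>ADE root systems\<close>

text \<open>The irreducible ADE root systems are \<open>An n\<close> for \<open>n \<ge> 1\<close>, \<open>Dn n\<close> for \<open>n \<ge> 4\<close> and
  \<open>E6\<close>, \<open>E7\<close>, \<open>E8\<close>; \<open>is_ade\<close> imposes the restriction on \<open>n\<close>.\<close>

datatype ade = An nat | Dn nat | E6 | E7 | E8

fun is_ade :: "ade \<Rightarrow> bool" where
  "is_ade (An n) \<longleftrightarrow> n \<ge> 1"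
| "is_ade (Dn n) \<longleftrightarrow> n \<ge> 4"
| "is_ade _ \<longleftrightarrow> True"

fun ade_rank :: "ade \<Rightarrow> nat" where
  "ade_rank (An n) = n"
| "ade_rank (Dn n) = n"
| "ade_rank E6 = 6"
| "ade_rank E7 = 7"
| "ade_rank E8 = 8"

text \<open>Edges of the Dynkin diagram on the nodes \<open>1, \<dots>, ade_rank \<Delta>\<close>, in Bourbaki's numbering;
  each edge is listed once.\<close>

fun dynkin_edges :: "ade \<Rightarrow> (nat \<times> nat) set" where
  "dynkin_edges (An n) = {(i, i + 1) |i. 1 \<le> i \<and> i < n}"
| "dynkin_edges (Dn n) = {(i, i + 1) |i. 1 \<le> i \<and> i < n - 1} \<union> {(n - 2, n)}"
| "dynkin_edges E6 = {(1,3), (3,4), (4,5), (5,6), (2,4)}"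
| "dynkin_edges E7 = {(1,3), (3,4), (4,5), (5,6), (6,7), (2,4)}"
| "dynkin_edges E8 = {(1,3), (3,4), (4,5), (5,6), (6,7), (7,8), (2,4)}"

definition cartan :: "ade \<Rightarrow> nat \<Rightarrow> nat \<Rightarrow> int" where
  "cartan \<Delta> i j =
     (if i = j then 2
      else if (i, j) \<in> dynkin_edges \<Delta> \<or> (j, i) \<in> dynkin_edges \<Delta> then -1
      else 0)"

text \<open>A vector with coordinates \<open>v 1, \<dots>, v (ade_rank \<Delta>)\<close> in the basis of simple roots is a function
  on \<open>nat\<close> that vanishes elsewhere, so that distinct functions are distinct vectors. Integral
  vectors form the root lattice, rational vectors its tensor product with the rationals.\<close>

definition vectors :: "ade \<Rightarrow> (nat \<Rightarrow> 'a::zero) set" where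
  "vectors \<Delta> = {v. \<forall>i. i \<notin> {1..ade_rank \<Delta>} \<longrightarrow> v i = 0}"

abbreviation root_lattice :: "ade \<Rightarrow> (nat \<Rightarrow> int) set" where
  "root_lattice \<Delta> \<equiv> vectors \<Delta>"

definition form :: "ade \<Rightarrow> (nat \<Rightarrow> 'a) \<Rightarrow> (nat \<Rightarrow> 'a) \<Rightarrow> 'a::comm_ring_1" where
  "form \<Delta> u v = (\<Sum>i=1..ade_rank \<Delta>. \<Sum>j=1..ade_rank \<Delta>. u i * of_int (cartan \<Delta> i j) * v j)"

definition simple_root :: "nat \<Rightarrow> nat \<Rightarrow> 'a::zero_neq_one" where
  "simple_root i = (\<lambda>j. if j = i then 1 else 0)"

text \<open>The root system is the orbit of the simple roots under the Weyl group. As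
  \<open>(\<alpha>\<^sub>i|\<alpha>\<^sub>i) = 2\<close>, the reflection in \<open>\<alpha>\<^sub>i\<close> is \<open>v \<mapsto> v - (v|\<alpha>\<^sub>i) \<alpha>\<^sub>i\<close>.\<close>

inductive_set roots :: "ade \<Rightarrow> (nat \<Rightarrow> int) set" for \<Delta> :: ade where
  simple: "i \<in> {1..ade_rank \<Delta>} \<Longrightarrow> simple_root i \<in> roots \<Delta>"
| reflect: "v \<in> roots \<Delta> \<Longrightarrow> i \<in> {1..ade_rank \<Delta>} \<Longrightarrow>
    (\<lambda>j. v j - form \<Delta> v (simple_root i) * simple_root i j) \<in> roots \<Delta>"

text \<open>The longest (that is, highest) root: its difference with any root is a nonnegative combination
  of simple roots.\<close>

definition longest_root :: "ade \<Rightarrow> nat \<Rightarrow> int" where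
  "longest_root \<Delta> = (THE d. d \<in> roots \<Delta> \<and> (\<forall>v\<in>roots \<Delta>. \<forall>i. v i \<le> d i))"

definition dual_longest_root :: "ade \<Rightarrow> nat \<Rightarrow> rat" where
  "dual_longest_root \<Delta> = (THE \<zeta>. \<zeta> \<in> vectors \<Delta> \<and>
     (\<forall>i\<in>{1..ade_rank \<Delta>}. form \<Delta> \<zeta> (simple_root i) = of_int (longest_root \<Delta> i)))"

section \<open>Finite subgroups of SU(2)\<close>

definition SU2 :: "(complex^2^2) monoid" where
  "SU2 = \<lparr>carrier = {A. A ** (\<chi> i j. cnj (A $ j $ i)) = mat 1 \<and> det A = 1},
          mult = (**), one = mat 1\<rparr>"

text \<open>The unit quaternion \<open>a + b i + c j + d k\<close> corresponds to
  \<open>su2 (a + b \<i>) (c + d \<i>)\<close>.\<close>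

definition su2 :: "complex \<Rightarrow> complex \<Rightarrow> complex^2^2" where
  "su2 \<alpha> \<beta> = vector [vector [\<alpha>, \<beta>], vector [- cnj \<beta>, cnj \<alpha>]]"

text \<open>The standard copies of the cyclic, binary dihedral, binary tetrahedral, binary octahedral and
  binary icosahedral groups. In quaternions the last three are generated by
  \<open>i, (1+i+j+k)/2\<close>, by \<open>(1+i)/\<surd>2, (1+i+j+k)/2\<close> and by
  \<open>(1+i+j+k)/2, (\<phi> + \<phi>\<^sup>-\<^sup>1 i + j)/2\<close>, where \<open>\<phi>\<close> is the golden ratio and
  \<open>\<phi>\<^sup>-\<^sup>1 = (\<surd>5 - 1)/2\<close>.\<close>

fun SU2_generators :: "ade \<Rightarrow> (complex^2^2) set" where
  "SU2_generators (An n) = {su2 (cis (2 * pi / real (n + 1))) 0}"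
| "SU2_generators (Dn n) = {su2 (cis (pi / real (n - 2))) 0, su2 0 1}"
| "SU2_generators E6 = {su2 \<i> 0, su2 ((1 + \<i>) / 2) ((1 + \<i>) / 2)}"
| "SU2_generators E7 = {su2 (cis (pi / 4)) 0, su2 ((1 + \<i>) / 2) ((1 + \<i>) / 2)}"
| "SU2_generators E8 = {su2 ((1 + \<i>) / 2) ((1 + \<i>) / 2),
     su2 (Complex ((sqrt 5 + 1) / 4) ((sqrt 5 - 1) / 4)) (1 / 2)}"

definition SU2_subgroup :: "ade \<Rightarrow> (complex^2^2) set" where
  "SU2_subgroup \<Delta> = generate SU2 (SU2_generators \<Delta>)"

section \<open>The shifted theta function\<close>

definition theta_exponent :: "ade \<Rightarrow> (nat \<Rightarrow> int) \<Rightarrow> rat" where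
  "theta_exponent \<Delta> m =
     (let k = of_nat (card (SU2_subgroup \<Delta>));
          w = (\<lambda>i. of_int (m i) + 1 / k * dual_longest_root \<Delta> i)
      in k / 2 * form \<Delta> w w)"

text \<open>For rational \<open>r\<close>, \<open>q\<^sup>r\<close> means \<open>exp (2 \<pi> \<i> r \<tau>)\<close>.\<close>

definition theta :: "ade \<Rightarrow> complex \<Rightarrow> complex" where
  "theta \<Delta> \<tau> =
     (\<Sum>\<^sub>\<infinity>m\<in>root_lattice \<Delta>. exp (2 * of_real pi * \<i> * of_rat (theta_exponent \<Delta> m) * \<tau>))"

end

(*
The branches of the Dynkin diagram of type D or E at its trivalent node are diagrams of type
A_{p-1}, A_{q-1}, A_{r-1}. An element of the Weyl group carries zeta / k to a vector x with
(x | alpha) = 1 / p for every simple root alpha on the branch of type A_{p-1}, and likewise for q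
and r; so theta may be computed with x in place of zeta / k. Split a lattice vector into its
coefficient j at the trivalent node and its projections to the branches. For fixed j, the sum over
each branch is the theta function of a coset of A_{p-1} shifted by rho / p. All of these cosets give
eta(p tau)^p / eta(tau), up to rescaling tau and a power of q, because the product of p Jacobi triple products with
equally spaced arguments is again a triple product. The remaining sum over j of q^(2 j^2 + j) is
eta(2 tau)^2 / eta(tau), the case p = 2.
*)
theory Submission
  imports Defs "HOL-Library.Real_Mod" "HOL-Computational_Algebra.Primes"
begin

text \<open>For a shift x the exponent is k/2 (m|m) + k (x|m) plus a constant. Encoding each branch
  by successive differences turns (m|m) into a combination of squares, and the branches interact
  only through j, which is the sum of the differences along each of them. Hence a branch contributes
  the coefficient of z^j in a product of triple products, a constant times one power of q. The
  powers of q from the three branches and the term of j itself combine to an exponent with quadratic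
  part (k/p + k/q + k/r - k)/2 j^2. The relation 1/p + 1/q + 1/r = 1 + 4/k makes this 2 j^2 in every
  type, and (x|alpha) = 3/k - 1 at the trivalent node makes the linear part j. With k = 4E, k/p =
  2E, k/q = 2F, k/r = 2V the relation is Euler's formula V - E + F = 2 for the polyhedron (a
  dihedron for D_n) behind the group. The Weyl group element is never handled as such: it appears as
  an explicit bijection from the root lattice onto the encoded vectors, and the two exponents are
  compared directly. The longest root and the order k, being defined abstractly, are determined for
  each type.\<close>

section \<open>Jacobi's triple product\<close>

text \<open>\<open>qpow c r\<close> is \<open>q\<^sup>r\<close> for \<open>q = exp c\<close>, the logarithm \<open>c\<close> of \<open>q\<close> being part of the data.\<close>

definition qpow :: "complex \<Rightarrow> real \<Rightarrow> complex" where
  "qpow c r = exp (c * of_real r)"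

lemma qpow_0 [simp]: "qpow c 0 = 1"
  by (simp add: qpow_def)

lemma qpow_nonzero [simp]: "qpow c r \<noteq> 0"
  by (simp add: qpow_def)

lemma qpow_add: "qpow c (a + b) = qpow c a * qpow c b"
  by (simp add: qpow_def exp_add ring_distribs)

lemma qpow_minus: "qpow c (- a) = inverse (qpow c a)"
  by (simp add: qpow_def exp_minus)

lemma qpow_diff: "qpow c (a - b) = qpow c a / qpow c b"
  by (simp add: qpow_def exp_diff ring_distribs)

lemma qpow_power: "qpow c a ^ n = qpow c (of_nat n * a)"
  by (simp add: qpow_def mult_ac flip: exp_of_nat_mult)

lemma exp_power: "exp c ^ n = qpow c (of_nat n)"
  by (simp add: qpow_def mult_ac flip: exp_of_nat_mult)

lemma qpow_powi: "qpow c a powi j = qpow c (of_int j * a)"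
  unfolding qpow_def exp_power_int by (simp add: mult_ac)

lemma qpow_scale: "qpow (c * of_real s) r = qpow c (s * r)"
  by (simp add: qpow_def mult_ac)

lemma norm_qpow: "norm (qpow c r) = exp (Re c * r)"
  by (simp add: qpow_def)

lemma qpow_Re: "qpow (of_real (Re c)) r = of_real (norm (qpow c r))"
  unfolding norm_qpow qpow_def exp_of_real by (simp flip: of_real_mult exp_of_real)

lemma qpow_sum: "finite A \<Longrightarrow> qpow c (\<Sum>i\<in>A. f i) = (\<Prod>i\<in>A. qpow c (f i))"
  by (induction A rule: finite_induct) (auto simp: qpow_add)

section \<open>Dominated convergence and Gaussian sums over the integers\<close>

lemma infsum_dominated_convergence:
  fixes f :: "nat \<Rightarrow> 'a \<Rightarrow> 'b :: {banach, second_countable_topology}"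
  assumes lim: "\<And>x. x \<in> A \<Longrightarrow> (\<lambda>n. f n x) \<longlonglongrightarrow> h x"
    and bound: "\<And>n x. x \<in> A \<Longrightarrow> norm (f n x) \<le> g x"
    and g: "g summable_on A"
  shows "(\<lambda>n. infsum (f n) A) \<longlonglongrightarrow> infsum h A"
proof -
  have "(\<lambda>x. norm (g x)) summable_on A"
    using g summable_on_iff_abs_summable_on_real by blast
  hence "Infinite_Set_Sum.abs_summable_on g A"
    by (rule abs_summable_equivalent[THEN iffD1])
  hence gi: "integrable (count_space A) g"
    by (simp add: abs_summable_on_def)
  have h: "norm (h x) \<le> g x" if "x \<in> A" for x
    by (rule tendsto_upperbound[OF tendsto_norm[OF lim[OF that]]])
       (auto intro!: always_eventually bound that)
  have abs: "(\<lambda>x. norm (F x)) summable_on A" if "\<And>x. x \<in> A \<Longrightarrow> norm (F x) \<le> g x" for F :: "'a \<Rightarrow> 'b"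
    using Infinite_Sum.abs_summable_on_comparison_test'[OF g that] by simp
  have eq: "infsum F A = (\<integral>x. F x \<partial>count_space A)" if "\<And>x. x \<in> A \<Longrightarrow> norm (F x) \<le> g x"
    for F :: "'a \<Rightarrow> 'b"
    using infsetsum_infsum[OF abs_summable_equivalent[THEN iffD1, OF abs[OF that]]]
    by (simp add: infsetsum_def)
  have "(\<lambda>n. \<integral>x. f n x \<partial>count_space A) \<longlonglongrightarrow> (\<integral>x. h x \<partial>count_space A)"
    by (rule integral_dominated_convergence[OF _ _ gi]) (auto intro!: AE_I2 lim bound)
  thus ?thesis
    by (simp add: eq bound h)
qed

lemma abs_summable_on_prod_PiE':
  fixes f :: "'a \<Rightarrow> 'b \<Rightarrow> 'c :: {real_normed_field,banach,second_countable_topology}"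
  assumes "finite A" "\<And>x. x \<in> A \<Longrightarrow> countable (B x)"
    and "\<And>x. x \<in> A \<Longrightarrow> (\<lambda>y. norm (f x y)) summable_on B x"
  shows "(\<lambda>g. norm (\<Prod>x\<in>A. f x (g x))) summable_on PiE A B"
proof (rule abs_summable_equivalent[THEN iffD2])
  show "Infinite_Set_Sum.abs_summable_on (\<lambda>g. \<Prod>x\<in>A. f x (g x)) (PiE A B)"
  proof (rule Infinite_Set_Sum.abs_summable_on_prod_PiE)
    fix x assume "x \<in> A"
    thus "Infinite_Set_Sum.abs_summable_on (f x) (B x)"
      using assms(3) by (intro abs_summable_equivalent[THEN iffD1])
  qed (use assms in auto)
qed

lemma summable_on_intI:
  fixes f :: "int \<Rightarrow> real"
  assumes "(\<lambda>n. f (int n)) summable_on UNIV" "(\<lambda>n. f (- int n)) summable_on UNIV"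
  shows "f summable_on UNIV"
proof -
  have "f summable_on range int"
    using assms(1) by (subst summable_on_reindex) (auto simp: o_def)
  moreover have "f summable_on range (\<lambda>n. - int n)"
    using assms(2) by (subst summable_on_reindex) (auto simp: o_def inj_on_def)
  moreover have "(UNIV :: int set) = range int \<union> range (\<lambda>n. - int n)"
    by (auto intro: int_cases2)
  ultimately show ?thesis
    using summable_on_union[of f "range int" "range (\<lambda>n. - int n)"] by simp
qed

lemma summable_exp_neg_abs: "(\<lambda>j::int. exp (- \<bar>of_int j\<bar>) :: real) summable_on UNIV"
proof -
  have "(\<lambda>n. exp (- 1 :: real) ^ n) summable_on UNIV"
    by (rule summable_nonneg_imp_summable_on) (auto intro!: summable_geometric)
  thus ?thesis
    by (intro summable_on_intI) (auto simp flip: exp_of_nat_mult)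
qed

lemma summable_gaussian:
  fixes \<delta> \<mu> :: real
  assumes "\<delta> > 0"
  shows "(\<lambda>j::int. exp (- \<delta> * (of_int j)^2 / 2 + \<mu> * of_int j)) summable_on UNIV"
proof (rule summable_on_comparison_test)
  \<comment> \<open>Completing the square with linear coefficient |\<mu>| + 1 instead of |\<mu>|
    leaves a factor exp (-|j|) to spare, so that the majorant is geometric.\<close>
  define a where "a = \<bar>\<mu>\<bar> + 1"
  define C where "C = a\<^sup>2 / (2 * \<delta>)"
  show "(\<lambda>j::int. exp C * exp (- \<bar>of_int j\<bar>)) summable_on UNIV"
    by (intro summable_on_cmult_right summable_exp_neg_abs)
  fix j :: int
  define x where "x = \<bar>real_of_int j\<bar>"
  have "0 \<le> (\<delta> * x - a)\<^sup>2 / (2 * \<delta>)"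
    using assms by simp
  also have "(\<delta> * x - a)\<^sup>2 / (2 * \<delta>) = \<delta> * x\<^sup>2 / 2 - a * x + C"
    unfolding C_def using assms by (simp add: power2_eq_square divide_simps) algebra
  finally have "- \<delta> * x\<^sup>2 / 2 + \<bar>\<mu>\<bar> * x \<le> C - x"
    unfolding a_def distrib_right by linarith
  moreover have "\<mu> * of_int j \<le> \<bar>\<mu>\<bar> * x"
    unfolding x_def abs_mult[symmetric] by simp
  moreover have "(of_int j)\<^sup>2 = x\<^sup>2"
    by (simp add: x_def)
  ultimately have "- \<delta> * (of_int j)\<^sup>2 / 2 + \<mu> * of_int j \<le> C - x"
    by (simp only:)
  thus "exp (- \<delta> * (of_int j)^2 / 2 + \<mu> * of_int j) \<le> exp C * exp (- \<bar>of_int j\<bar>)"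
    by (simp only: x_def exp_add[symmetric] exp_le_cancel_iff diff_conv_add_uminus)
qed auto

lemma summable_qpow_gaussian:
  assumes "Re c < 0" "z \<noteq> 0"
  shows "(\<lambda>j::int. norm (z powi j * qpow c ((of_int j)\<^sup>2 / 2))) summable_on UNIV"
proof -
  have "norm (z powi j * qpow c ((of_int j)\<^sup>2 / 2))
      = exp (- (- Re c) * (of_int j)^2 / 2 + ln (norm z) * of_int j)" for j
  proof -
    have "norm z powi j = exp (ln (norm z)) powi j"
      using assms by simp
    also have "\<dots> = exp (ln (norm z) * of_int j)"
      by (metis exp_power_int mult.commute)
    finally have *: "norm z powi j = exp (ln (norm z) * of_int j)" .
    show ?thesis
      unfolding norm_mult norm_power_int norm_qpow exp_add * by (simp add: mult_ac)
  qed
  thus ?thesis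
    using summable_gaussian[of "- Re c" "ln (norm z)"] assms by simp
qed

section \<open>Euler products and Gaussian binomial coefficients\<close>

definition euler_prod :: "complex \<Rightarrow> complex" where
  "euler_prod x = (\<Prod>n. 1 - x ^ (n + 1))"

lemma convergent_euler_prod:
  assumes "norm (x :: complex) < 1"
  shows "convergent_prod (\<lambda>n. 1 - x ^ (n + 1))"
proof (rule abs_convergent_prod_imp_convergent_prod, rule summable_imp_abs_convergent_prod)
  have "summable (\<lambda>i. norm x * norm x ^ i)"
    using assms by (intro summable_mult summable_geometric) auto
  thus "summable (\<lambda>i. norm (1 - x ^ (i + 1) - 1))"
    by (simp add: norm_power norm_mult)
qed

lemma power_neq_1:
  assumes "norm (x :: complex) < 1"
  shows "x ^ Suc n \<noteq> 1"
proof
  assume "x ^ Suc n = 1"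
  hence "norm x ^ Suc n = 1" by (metis norm_one norm_power)
  moreover have "norm x ^ Suc n \<le> norm x ^ 1"
    using assms by (intro power_decreasing) auto
  ultimately show False using assms by simp
qed

lemma euler_prod_nonzero:
  assumes "norm x < 1"
  shows "euler_prod x \<noteq> 0"
  unfolding euler_prod_def using convergent_euler_prod[OF assms] power_neq_1[OF assms]
  by (intro prodinf_nonzero) auto

definition qfac :: "complex \<Rightarrow> nat \<Rightarrow> complex" where
  "qfac x N = (\<Prod>n<N. 1 - x ^ (n + 1))"

lemma qfac_0 [simp]: "qfac x 0 = 1"
  by (simp add: qfac_def)

lemma qfac_Suc: "qfac x (Suc n) = qfac x n * (1 - x ^ Suc n)"
  by (simp add: qfac_def)

lemma qfac_nonzero: "norm x < 1 \<Longrightarrow> qfac x N \<noteq> 0"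
  using power_neq_1[of x] by (auto simp: qfac_def)

lemma qfac_LIMSEQ:
  assumes "norm x < 1"
  shows "qfac x \<longlonglongrightarrow> euler_prod x"
proof -
  have "(\<lambda>n. qfac x (Suc n)) \<longlonglongrightarrow> euler_prod x"
    using convergent_prod_LIMSEQ[OF convergent_euler_prod[OF assms]]
    by (simp add: qfac_def euler_prod_def lessThan_Suc_atMost)
  thus ?thesis by (rule LIMSEQ_imp_Suc)
qed

text \<open>The Gaussian binomial coefficient. The quotient form makes its limit visible; the value
  0 for \<open>k > M\<close> lets the Pascal rule include the case \<open>k = M\<close>.\<close>

definition qbin :: "complex \<Rightarrow> nat \<Rightarrow> nat \<Rightarrow> complex" where
  "qbin x M k = (if k \<le> M then qfac x M / (qfac x k * qfac x (M - k)) else 0)"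

text \<open>After cancelling common factors this is (1 - XY) / ((1 - X)(1 - Y)) = 1 / (1 - X) + Y /
  (1 - Y) with X = x^(k+1) and Y = x^(M-k).\<close>

lemma qbin_Pascal:
  assumes x: "norm x < 1" and "k \<le> M"
  shows "qbin x (Suc M) (Suc k) = qbin x M (Suc k) + x ^ (M - k) * qbin x M k"
proof (cases "k = M")
  case True
  thus ?thesis using qfac_nonzero[OF x] by (simp add: qbin_def)
next
  case False
  with assms obtain d where d: "M = Suc (k + d)"
    by (metis add_Suc_right le_neq_implies_less less_imp_Suc_add)
  define X where "X = x ^ Suc k"
  define Y where "Y = x ^ Suc d"
  have nz: "X \<noteq> 1" "Y \<noteq> 1"
    using power_neq_1[OF x] unfolding X_def Y_def by blast+
  have e: "Suc M - Suc k = Suc d" "M - Suc k = d" "M - k = Suc d"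
    using d by auto
  have XY: "x ^ Suc M = X * Y"
    by (simp add: d X_def Y_def power_add)
  have "qbin x (Suc M) (Suc k) = qfac x M / (qfac x k * qfac x d) *
          ((1 - X * Y) / ((1 - X) * (1 - Y)))"
    using d unfolding qbin_def e qfac_Suc XY X_def[symmetric] Y_def[symmetric] by simp
  also have "(1 - X * Y) / ((1 - X) * (1 - Y)) = 1 / (1 - X) + Y * (1 / (1 - Y))"
    using nz by (simp add: divide_simps) (simp add: algebra_simps)
  also have "qfac x M / (qfac x k * qfac x d) * \<dots> =
      qbin x M (Suc k) + x ^ (M - k) * qbin x M k"
    using d unfolding qbin_def e qfac_Suc X_def[symmetric] Y_def[symmetric] distrib_left
    by (simp add: mult_ac)
  finally show ?thesis .
qed

lemma qbin_0: "norm x < 1 \<Longrightarrow> qbin x M 0 = 1"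
  using qfac_nonzero by (simp add: qbin_def)

text \<open>Cauchy's q-binomial theorem. In the induction the new factor 1 + w x^M matches the
  Pascal rule, because x^(M-k) from that rule and x^k from the step of the triangular exponent
  multiply to x^M.\<close>

lemma qbinomial:
  assumes x: "norm x < 1"
  shows "(\<Prod>l<M. 1 + w * x ^ l) = (\<Sum>k\<le>M. qbin x M k * x ^ (k choose 2) * w ^ k)"
proof (induction M)
  case 0
  thus ?case by (simp add: qbin_0[OF x] binomial_eq_0)
next
  case (Suc M)
  define a where "a k = qbin x M k * x ^ (k choose 2) * w ^ k" for k
  define b where "b k = qbin x (Suc M) k * x ^ (k choose 2) * w ^ k" for k
  have step: "b (Suc k) = a (Suc k) + w * x ^ M * a k" if "k \<le> M" for k
  proof -
    have ch: "x ^ (Suc k choose 2) = x ^ (k choose 2) * x ^ k"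
      by (simp add: numeral_2_eq_2 power_add)
    define X where "X = x ^ (M - k)"
    have M: "x ^ M = X * x ^ k"
      using that by (metis X_def le_add_diff_inverse2 power_add)
    have Q: "qbin x (Suc M) (Suc k) = qbin x M (Suc k) + X * qbin x M k"
      unfolding X_def by (rule qbin_Pascal[OF x that])
    have "qbin x (Suc M) (Suc k) * x ^ (Suc k choose 2) * w ^ Suc k =
        qbin x M (Suc k) * x ^ (Suc k choose 2) * w ^ Suc k +
        w * x ^ M * (qbin x M k * x ^ (k choose 2) * w ^ k)"
      unfolding Q unfolding M unfolding power_Suc unfolding ch by (simp add: algebra_simps)
    thus ?thesis
      by (simp only: a_def b_def)
  qed
  have "(\<Sum>k\<le>M. b (Suc k)) = (\<Sum>k\<le>M. a (Suc k)) + w * x ^ M * (\<Sum>k\<le>M. a k)"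
    by (simp add: step sum.distrib sum_distrib_left)
  moreover have "(\<Sum>k\<le>M. a k) = b 0 + (\<Sum>k\<le>M. a (Suc k))"
  proof -
    have "(\<Sum>k\<le>M. a k) = (\<Sum>k\<le>Suc M. a k)"
      by (simp add: a_def qbin_def)
    also have "\<dots> = b 0 + (\<Sum>k\<le>M. a (Suc k))"
      unfolding sum.atMost_Suc_shift by (simp add: a_def b_def qbin_0[OF x])
    finally show ?thesis .
  qed
  ultimately have "(\<Sum>k\<le>Suc M. b k) = (\<Sum>k\<le>M. a k) + w * x ^ M * (\<Sum>k\<le>M. a k)"
    unfolding sum.atMost_Suc_shift[of b] by (simp only: add.assoc)
  hence "(\<Sum>k\<le>Suc M. b k) = (1 + w * x ^ M) * (\<Sum>k\<le>M. a k)"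
    by (simp only: distrib_right mult_1)
  thus ?case
    using Suc.IH by (simp only: a_def b_def prod.lessThan_Suc mult.commute)
qed

section \<open>The finite triple product and its limit\<close>

lemma prod_lessThan_add:
  "(\<Prod>l<m + n. f l) = (\<Prod>l<m. f l) * (\<Prod>l<n. f (m + l))"
  for f :: "nat \<Rightarrow> 'a :: comm_monoid_mult"
  by (induction n) (simp_all add: mult.assoc)

lemma real_choose_two: "real (k choose 2) = real k * (real k - 1) / 2"
  by (induction k) (simp_all add: numeral_2_eq_2 field_simps)

lemma prod_qpow_half_odd: "(\<Prod>l<N. qpow c (- (real l + 1 / 2))) = qpow c (- (real N)\<^sup>2 / 2)"
proof (induction N)
  case (Suc N)
  have "- (real (Suc N))\<^sup>2 / 2 = - (real N)\<^sup>2 / 2 + - (real N + 1 / 2)"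
    by (simp add: power2_eq_square field_simps)
  thus ?case
    using Suc.IH by (simp only: prod.lessThan_Suc qpow_add)
qed auto

text \<open>The two families of factors of the triple product that depend on z, truncated. The third
  family, \<open>euler_prod\<close>, appears only in the limit.\<close>

definition jacobi_prod :: "complex \<Rightarrow> complex \<Rightarrow> nat \<Rightarrow> complex" where
  "jacobi_prod c z N =
     (\<Prod>l<N. (1 + z * qpow c (real l + 1 / 2)) * (1 + qpow c (real l + 1 / 2) / z))"

text \<open>The 2N factors are split in the middle. In the first half the order is reversed and z
  q^(-(l + 1/2)) is taken out of each factor, which leaves a factor in 1/z; the extracted monomials
  multiply to the prefactor.\<close>

lemma jacobi_prod_eq_shifted:
  assumes "z \<noteq> 0"
  shows "(\<Prod>l<2 * N. 1 + z * qpow c (1 / 2 - real N) * exp c ^ l) =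
           z ^ N * qpow c (- (real N)\<^sup>2 / 2) * jacobi_prod c z N"
proof -
  define a where "a l = 1 + z * qpow c (1 / 2 - real N) * exp c ^ l" for l
  have a: "a l = 1 + z * qpow c (real l + 1 / 2 - real N)" for l
    by (simp add: a_def exp_power mult.assoc flip: qpow_add) (simp add: algebra_simps)
  have "(\<Prod>l<2 * N. a l) = (\<Prod>l<N. a l) * (\<Prod>l<N. a (N + l))"
    by (simp add: mult_2 prod_lessThan_add)
  also have "(\<Prod>l<N. a l) = (\<Prod>l<N. a (N - Suc l))"
    by (rule prod.nat_diff_reindex [symmetric])
  also have "\<dots> = (\<Prod>l<N. z * qpow c (- (real l + 1 / 2)) * (1 + qpow c (real l + 1 / 2) / z))"
  proof (rule prod.cong)
    fix l assume "l \<in> {..<N}"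
    hence "real (N - Suc l) + 1 / 2 - real N = - (real l + 1 / 2)"
      by (simp add: of_nat_diff)
    thus "a (N - Suc l) = z * qpow c (- (real l + 1 / 2)) * (1 + qpow c (real l + 1 / 2) / z)"
      unfolding a using assms by (simp only: qpow_minus) (simp add: field_simps)
  qed auto
  also have "\<dots> = z ^ N * qpow c (- (real N)\<^sup>2 / 2) * (\<Prod>l<N. 1 + qpow c (real l + 1 / 2) / z)"
    by (simp only: prod.distrib prod_constant card_lessThan prod_qpow_half_odd)
  also have "(\<Prod>l<N. a (N + l)) = (\<Prod>l<N. 1 + z * qpow c (real l + 1 / 2))"
    by (rule prod.cong) (simp_all add: a)
  finally show ?thesis
    by (simp add: a_def jacobi_prod_def prod.distrib mult_ac)
qed

text \<open>The substitution k = N + j centres the q-binomial expansion: k(k-1)/2 + k(1/2 - N) =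
  (j^2 - N^2)/2, and the part that depends on N alone is the prefactor \<open>K\<close>.\<close>

lemma jacobi_prod_eq_sum:
  assumes c: "Re c < 0" and z: "z \<noteq> 0"
  shows "jacobi_prod c z N = (\<Sum>j\<in>{- int N..int N}.
           qbin (exp c) (2 * N) (nat (int N + j)) * (z powi j * qpow c ((of_int j)\<^sup>2 / 2)))"
proof -
  define K where "K = z ^ N * qpow c (- (real N)\<^sup>2 / 2)"
  have K: "K \<noteq> 0" using z by (simp add: K_def)
  have "K * jacobi_prod c z N =
      (\<Sum>k\<le>2 * N. qbin (exp c) (2 * N) k * exp c ^ (k choose 2) * (z * qpow c (1 / 2 - real N)) ^ k)"
    unfolding K_def jacobi_prod_eq_shifted[OF z, symmetric]
    by (rule qbinomial) (use c in auto)
  also have "\<dots> = (\<Sum>j\<in>{- int N..int N}. K *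
           (qbin (exp c) (2 * N) (nat (int N + j)) * (z powi j * qpow c ((of_int j)\<^sup>2 / 2))))"
  proof (rule sum.reindex_bij_witness[where i = "\<lambda>j. nat (int N + j)" and j = "\<lambda>k. int k - int N"])
    fix k assume "k \<in> {..2 * N}"
    define j where "j = int k - int N"
    have k: "real k = real N + of_int j" "int k = int N + j" "k = nat (int N + j)"
      by (auto simp: j_def)
    have "exp c ^ (k choose 2) * (z * qpow c (1 / 2 - real N)) ^ k =
        z ^ k * qpow c (real (k choose 2) + real k * (1 / 2 - real N))"
      by (simp add: exp_power qpow_add power_mult_distrib qpow_power)
    also have "real (k choose 2) = real k * (real k - 1) / 2"
      by (rule real_choose_two)
    also have "real k * (real k - 1) / 2 + real k * (1 / 2 - real N) =
        - (real N)\<^sup>2 / 2 + (of_int j)\<^sup>2 / 2"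
      unfolding k(1) by (simp add: power2_eq_square field_simps)
    also have "z ^ k = z ^ N * z powi j"
      using z by (metis k(2) power_int_add power_int_of_nat)
    finally have "exp c ^ (k choose 2) * (z * qpow c (1 / 2 - real N)) ^ k =
        K * (z powi j * qpow c ((of_int j)\<^sup>2 / 2))"
      by (simp only: K_def qpow_add mult_ac)
    thus "K * (qbin (exp c) (2 * N) (nat (int N + (int k - int N))) *
            (z powi (int k - int N) * qpow c ((real_of_int (int k - int N))\<^sup>2 / 2))) =
          qbin (exp c) (2 * N) k * exp c ^ (k choose 2) * (z * qpow c (1 / 2 - real N)) ^ k"
      by (simp add: j_def mult_ac)
  qed auto
  finally show ?thesis
    using K by (simp flip: sum_distrib_left)
qed

text \<open>Both \<open>qfac x n\<close> and its inverse converge as n grows, hence are bounded. A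
  bound uniform in \<open>M\<close> and \<open>k\<close> is what the majorant for dominated
  convergence needs.\<close>

lemma qbin_bounded:
  assumes x: "norm x < 1"
  obtains B where "\<And>M k. norm (qbin x M k) \<le> B"
proof -
  have "Bseq (qfac x)"
    using qfac_LIMSEQ[OF x] by (blast intro: convergent_imp_Bseq convergentI)
  then obtain B1 where B1: "B1 > 0" "\<And>n. norm (qfac x n) \<le> B1"
    by (auto simp: Bseq_def)
  have "Bseq (\<lambda>n. inverse (qfac x n))"
    using tendsto_inverse[OF qfac_LIMSEQ[OF x] euler_prod_nonzero[OF x]]
    by (blast intro: convergent_imp_Bseq convergentI)
  then obtain B2 where B2: "B2 > 0" "\<And>n. norm (inverse (qfac x n)) \<le> B2"
    by (auto simp: Bseq_def)
  have "norm (qbin x M k) \<le> B1 * (B2 * B2)" for M k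
  proof (cases "k \<le> M")
    case True
    have "qbin x M k = qfac x M * (inverse (qfac x k) * inverse (qfac x (M - k)))"
      using True by (simp add: qbin_def field_simps)
    hence "norm (qbin x M k) =
        norm (qfac x M) * (norm (inverse (qfac x k)) * norm (inverse (qfac x (M - k))))"
      by (simp only: norm_mult)
    also have "\<dots> \<le> B1 * (B2 * B2)"
      using B1 B2 by (intro mult_mono mult_nonneg_nonneg) auto
    finally show ?thesis .
  qed (use B1 B2 in \<open>simp add: qbin_def\<close>)
  thus thesis by (rule that)
qed

definition jtheta :: "complex \<Rightarrow> complex \<Rightarrow> complex" where
  "jtheta c z = (\<Sum>\<^sub>\<infinity>j::int. z powi j * qpow c ((of_int j)\<^sup>2 / 2))"

text \<open>The finite triple product is a \<open>q\<close>-binomial expansion in disguise, and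
  \<open>[2N choose N + j]\<^sub>q \<rightarrow> 1 / euler_prod q\<close>.\<close>

theorem jacobi_prod_LIMSEQ:
  assumes c: "Re c < 0" and z: "z \<noteq> 0"
  shows "jacobi_prod c z \<longlonglongrightarrow> jtheta c z / euler_prod (exp c)"
proof -
  define x where "x = exp c"
  have x: "norm x < 1" using c by (simp add: x_def)
  define t where "t j = z powi j * qpow c ((of_int j)\<^sup>2 / 2)" for j :: int
  have t: "(\<lambda>j. norm (t j)) summable_on UNIV"
    unfolding t_def by (rule summable_qpow_gaussian[OF c z])
  obtain B where B: "\<And>M k. norm (qbin x M k) \<le> B" using qbin_bounded[OF x] by blast
  have B0: "B \<ge> 0" using B[of 0 0] norm_ge_zero order.trans by blast
  \<comment> \<open>Extension by 0 puts the sums for all \<open>N\<close> on one index set, as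
    dominated convergence requires.\<close>
  define f where "f N j = (if j \<in> {- int N..int N} then qbin x (2 * N) (nat (int N + j)) * t j else 0)"
    for N j
  have "(\<lambda>N. infsum (f N) UNIV) \<longlonglongrightarrow> (\<Sum>\<^sub>\<infinity>j. 1 / euler_prod x * t j)"
  proof (rule infsum_dominated_convergence)
    show "(\<lambda>j. B * norm (t j)) summable_on UNIV"
      by (rule summable_on_cmult_right[OF t])
    show "norm (f N j) \<le> B * norm (t j)" for N j
      using B[of "2 * N" "nat (int N + j)"] B0 by (auto simp: f_def norm_mult intro: mult_right_mono)
    fix j :: int
    have 1: "filterlim (\<lambda>N. nat (int N + j)) at_top sequentially"
      unfolding filterlim_at_top
    proof
      fix Z show "\<forall>\<^sub>F N in sequentially. Z \<le> nat (int N + j)"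
        using eventually_ge_at_top[of "nat (int Z - j)"] by eventually_elim linarith
    qed
    have 2: "filterlim (\<lambda>N. nat (int N - j)) at_top sequentially"
      unfolding filterlim_at_top
    proof
      fix Z show "\<forall>\<^sub>F N in sequentially. Z \<le> nat (int N - j)"
        using eventually_ge_at_top[of "nat (int Z + j)"] by eventually_elim linarith
    qed
    have 3: "filterlim (\<lambda>N. 2 * N :: nat) at_top sequentially"
      by (rule filterlim_subseq) (auto simp: strict_mono_def)
    note lim = filterlim_compose[OF qfac_LIMSEQ[OF x]]
    have "(\<lambda>N. qfac x (2 * N) / (qfac x (nat (int N + j)) * qfac x (nat (int N - j))) * t j)
        \<longlonglongrightarrow> euler_prod x / (euler_prod x * euler_prod x) * t j"
      by (intro tendsto_intros lim 1 2 3) (simp add: euler_prod_nonzero[OF x])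
    moreover have "\<forall>\<^sub>F N in sequentially.
        qfac x (2 * N) / (qfac x (nat (int N + j)) * qfac x (nat (int N - j))) * t j = f N j"
      using eventually_ge_at_top[of "nat \<bar>j\<bar>"]
    proof eventually_elim
      case (elim N)
      hence "j \<in> {- int N..int N}" "nat (int N + j) \<le> 2 * N"
          "2 * N - nat (int N + j) = nat (int N - j)"
        by (auto simp: nat_le_iff)
      thus ?case by (simp add: f_def qbin_def)
    qed
    ultimately have "(\<lambda>N. f N j) \<longlonglongrightarrow> euler_prod x / (euler_prod x * euler_prod x) * t j"
      by (rule Lim_transform_eventually)
    thus "(\<lambda>N. f N j) \<longlonglongrightarrow> 1 / euler_prod x * t j"
      by (simp add: euler_prod_nonzero[OF x])
  qed
  moreover have "infsum (f N) UNIV = jacobi_prod c z N" for N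
  proof -
    have "infsum (f N) UNIV = infsum (f N) {- int N..int N}"
      by (rule infsum_cong_neutral) (auto simp: f_def)
    thus ?thesis
      by (simp add: jacobi_prod_eq_sum[OF c z] f_def x_def t_def)
  qed
  moreover have "(\<Sum>\<^sub>\<infinity>j. 1 / euler_prod x * t j) = jtheta c z / euler_prod x"
    unfolding infsum_cmult_right' by (simp add: jtheta_def t_def[abs_def])
  ultimately show ?thesis
    by (simp add: x_def)
qed

section \<open>Theta functions of type A and of star-shaped diagrams\<close>

lemma qpow_scale_nat: "qpow (c * of_nat n) r = qpow c (real n * r)"
  using qpow_scale[of c "real n" r] by simp

lemma prod_lessThan_mult:
  "(\<Prod>i<t. \<Prod>l<N. f (i + t * l)) = (\<Prod>n<t * N. f n)"
  for f :: "nat \<Rightarrow> 'a :: comm_monoid_mult"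
proof -
  have "(\<Prod>l<N. \<Prod>i<t. f (i + t * l)) = (\<Prod>n<t * N. f n)"
  proof (induction N)
    case (Suc N)
    show ?case
      unfolding mult_Suc_right add.commute[of t] prod_lessThan_add prod.lessThan_Suc Suc.IH
      by (simp add: add.commute)
  qed auto
  thus ?thesis by (subst prod.swap)
qed

text \<open>For i < t and l < N the number i + t l runs once through 0, ..., t N - 1, so t products
  of step t interleave into one of step 1; for the factors in 1/z the index i is first reversed to t
  - 1 - i. The resulting offsets t/2 and 1 - t/2 differ from 1/2 by (t-1)/2 and -(t-1)/2, and both
  deviations are absorbed into z.\<close>

lemma prod_jacobi_prod:
  assumes z: "z \<noteq> 0" and t: "t > 0"
  shows "(\<Prod>i<t. jacobi_prod (c * of_real (real t)) (z * qpow c (real i)) N) =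
           jacobi_prod c (z * qpow c ((real t - 1) / 2)) (t * N)"
proof -
  define A where "A n = 1 + z * qpow c (real n + real t / 2)" for n
  define B where "B n = 1 + qpow c (real n + 1 - real t / 2) / z" for n
  have A: "1 + z * qpow c (real i) * qpow (c * of_real (real t)) (real l + 1 / 2) = A (i + t * l)"
    for i l
    unfolding qpow_scale mult.assoc qpow_add[symmetric] A_def
    by (simp add: ring_distribs algebra_simps)
  have B: "1 + qpow (c * of_real (real t)) (real l + 1 / 2) / (z * qpow c (real i)) =
      B ((t - Suc i) + t * l)" if "i < t" for i l
  proof -
    have "real t * (real l + 1 / 2) - real i = real ((t - Suc i) + t * l) + 1 - real t / 2"
      using that by (simp add: of_nat_diff field_simps)
    hence "qpow c (real t * (real l + 1 / 2)) / qpow c (real i) =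
        qpow c (real ((t - Suc i) + t * l) + 1 - real t / 2)"
      by (simp only: flip: qpow_diff)
    thus ?thesis
      unfolding qpow_scale B_def by (metis divide_divide_eq_left mult.commute)
  qed
  have "(\<Prod>i<t. jacobi_prod (c * of_real (real t)) (z * qpow c (real i)) N) =
      (\<Prod>i<t. \<Prod>l<N. A (i + t * l)) * (\<Prod>i<t. \<Prod>l<N. B ((t - Suc i) + t * l))"
    unfolding jacobi_prod_def prod.distrib A
    by (intro arg_cong2[where f = "(*)"] prod.cong refl B) simp
  also have "(\<Prod>i<t. \<Prod>l<N. B ((t - Suc i) + t * l)) = (\<Prod>i<t. \<Prod>l<N. B (i + t * l))"
    by (rule prod.nat_diff_reindex)
  also have "(\<Prod>i<t. \<Prod>l<N. A (i + t * l)) * \<dots> = (\<Prod>n<t * N. A n * B n)"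
    by (simp only: prod_lessThan_mult prod.distrib)
  also have "\<dots> = jacobi_prod c (z * qpow c ((real t - 1) / 2)) (t * N)"
    unfolding jacobi_prod_def
  proof (intro prod.cong refl arg_cong2[where f = "(*)"])
    fix n
    have e: "real n + real t / 2 = (real t - 1) / 2 + (real n + 1 / 2)"
        "real n + 1 - real t / 2 = (real n + 1 / 2) - (real t - 1) / 2"
      by (simp_all add: field_simps)
    show "A n = 1 + z * qpow c ((real t - 1) / 2) * qpow c (real n + 1 / 2)"
      by (simp only: A_def e qpow_add mult.assoc)
    show "B n = 1 + qpow c (real n + 1 / 2) / (z * qpow c ((real t - 1) / 2))"
      by (simp only: B_def e qpow_diff divide_divide_eq_left mult.commute)
  qed
  finally show ?thesis .
qed

text \<open>The limit of the finite identity; its right-hand side is followed along the subsequence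
  \<open>t * N\<close> of partial products.\<close>

lemma prod_jtheta:
  assumes c: "Re c < 0" and z: "z \<noteq> 0" and t: "t > 0"
  shows "(\<Prod>i<t. jtheta (c * of_real (real t)) (z * qpow c (real i))) =
           euler_prod (exp (c * of_real (real t))) ^ t / euler_prod (exp c) *
           jtheta c (z * qpow c ((real t - 1) / 2))"
proof -
  define ct where "ct = c * of_real (real t)"
  have ct: "Re ct < 0" using c t by (simp add: ct_def mult_neg_pos)
  have "(\<lambda>N. jacobi_prod c (z * qpow c ((real t - 1) / 2)) (t * N))
      \<longlonglongrightarrow> (\<Prod>i<t. jtheta ct (z * qpow c (real i)) / euler_prod (exp ct))"
    unfolding prod_jacobi_prod[OF z t, symmetric] ct_def[symmetric]
    by (intro tendsto_prod jacobi_prod_LIMSEQ ct) (use z in auto)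
  moreover have "(\<lambda>N. jacobi_prod c (z * qpow c ((real t - 1) / 2)) (t * N))
      \<longlonglongrightarrow> jtheta c (z * qpow c ((real t - 1) / 2)) / euler_prod (exp c)"
    by (rule filterlim_compose[OF jacobi_prod_LIMSEQ[OF c]])
       (use z t in \<open>auto intro!: filterlim_subseq simp: strict_mono_def\<close>)
  ultimately have "(\<Prod>i<t. jtheta ct (z * qpow c (real i)) / euler_prod (exp ct)) =
      jtheta c (z * qpow c ((real t - 1) / 2)) / euler_prod (exp c)"
    by (rule LIMSEQ_unique)
  moreover have "euler_prod (exp ct) \<noteq> 0"
    by (rule euler_prod_nonzero) (use ct in auto)
  ultimately show ?thesis
    unfolding ct_def[symmetric] prod_dividef prod_constant card_lessThan
    by (simp add: nonzero_divide_eq_eq mult_ac)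
qed


section \<open>Comparison of Laurent coefficients and the theta functions of type A\<close>

lemma sum_roots_of_unity:
  assumes N: "N > 0"
  shows "(\<Sum>r<N. cis (2 * pi * real r / real N) powi m) = (if int N dvd m then of_nat N else 0)"
proof -
  define w where "w = cis (2 * pi * of_int m / real N)"
  have eq: "cis (2 * pi * real r / real N) powi m = w ^ r" for r
    unfolding w_def cis_power_int Complex.DeMoivre by (simp add: mult_ac)
  have wN: "w ^ N = 1"
    using N cis_multiple_2pi[of "of_int m"] unfolding w_def Complex.DeMoivre by (simp add: mult_ac)
  show ?thesis
  proof (cases "int N dvd m")
    case True
    then obtain n where "m = int N * n" by (elim dvdE)
    hence "w = 1"
      using N cis_multiple_2pi[of "of_int n"] by (simp add: w_def mult_ac)
    thus ?thesis using True by (simp add: eq)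
  next
    case False
    have "w \<noteq> 1"
    proof
      assume "w = 1"
      then obtain n :: int where "2 * pi * of_int m / real N = of_int n * (2 * pi)"
        by (auto simp: w_def cis_eq_1_iff)
      hence "real_of_int m = real_of_int (n * int N)"
        using N by (simp add: field_simps)
      hence "m = n * int N" by linarith
      with False show False by simp
    qed
    thus ?thesis using False by (simp add: eq sum_gp_strict wN)
  qed
qed

lemma has_sum_finite_sum:
  fixes f :: "'a \<Rightarrow> 'b \<Rightarrow> 'c :: topological_comm_monoid_add"
  assumes "finite R" "\<And>r. r \<in> R \<Longrightarrow> (f r has_sum S r) A"
  shows "((\<lambda>x. \<Sum>r\<in>R. f r x) has_sum (\<Sum>r\<in>R. S r)) A"
  using assms by (induction R rule: finite_induct) (auto intro: has_sum_add)

text \<open>Averaging against the \<open>N\<close>-th roots of unity isolates the coefficients congruent to \<open>k\<close>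
  modulo \<open>N\<close>; then \<open>N\<close> tends to infinity.\<close>

lemma Laurent_coeffs_eq_0:
  fixes d :: "int \<Rightarrow> complex"
  assumes d: "(\<lambda>j. norm (d j)) summable_on UNIV"
    and z: "\<And>z. norm z = 1 \<Longrightarrow> (\<Sum>\<^sub>\<infinity>j. z powi j * d j) = 0"
  shows "d k = 0"
proof -
  define f where "f n j = (if int (Suc n) dvd (j - k) then d j else 0)" for n j
  have "(\<lambda>n. infsum (f n) UNIV) \<longlonglongrightarrow> infsum (\<lambda>j. if j = k then d j else 0) UNIV"
  proof (rule infsum_dominated_convergence[OF _ _ d])
    show "norm (f n j) \<le> norm (d j)" for n j by (simp add: f_def)
    fix j
    have "\<forall>\<^sub>F n in sequentially. (if j = k then d j else 0) = f n j"
      using eventually_gt_at_top[of "nat \<bar>j - k\<bar>"]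
    proof eventually_elim
      case (elim n)
      hence "int (Suc n) dvd (j - k) \<longleftrightarrow> j = k"
        using zdvd_imp_le[of "int (Suc n)" "\<bar>j - k\<bar>"] by fastforce
      thus ?case by (simp add: f_def)
    qed
    thus "(\<lambda>n. f n j) \<longlonglongrightarrow> (if j = k then d j else 0)"
      by (rule Lim_transform_eventually[OF tendsto_const])
  qed
  moreover have "infsum (f n) UNIV = 0" for n
  proof -
    define N where "N = Suc n"
    define w where "w r = cis (2 * pi * real r / real N)" for r
    have "((\<lambda>j. w r powi (- k) * (w r powi j * d j)) has_sum w r powi (- k) * 0) UNIV" for r
    proof (rule has_sum_cmult_right)
      have "(\<lambda>j. norm (w r powi j * d j)) summable_on UNIV"
        using d by (simp add: w_def norm_mult norm_power_int)
      hence "(\<lambda>j. w r powi j * d j) summable_on UNIV"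
        by (rule abs_summable_summable)
      thus "((\<lambda>j. w r powi j * d j) has_sum 0) UNIV"
        using z[of "w r"] by (simp add: has_sum_iff w_def)
    qed
    hence "((\<lambda>j. \<Sum>r<N. w r powi (- k) * (w r powi j * d j)) has_sum
        (\<Sum>r<N. w r powi (- k) * 0)) UNIV"
      by (intro has_sum_finite_sum) auto
    moreover have "(\<Sum>r<N. w r powi (- k) * (w r powi j * d j)) = of_nat N * f n j" for j
    proof -
      have "w r powi (- k) * (w r powi j * d j) = w r powi (j - k) * d j" for r
        using power_int_add[of "w r" "- k" j] by (simp add: w_def)
      hence "(\<Sum>r<N. w r powi (- k) * (w r powi j * d j)) = (\<Sum>r<N. w r powi (j - k)) * d j"
        by (simp only: sum_distrib_right)
      also have "(\<Sum>r<N. w r powi (j - k)) = (if int N dvd j - k then of_nat N else 0)"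
        unfolding w_def by (rule sum_roots_of_unity) (simp add: N_def)
      finally show ?thesis by (simp add: f_def N_def)
    qed
    ultimately have "infsum (\<lambda>j. of_nat N * f n j) UNIV = 0"
      by (simp add: has_sum_iff)
    thus ?thesis
      unfolding infsum_cmult_right' N_def by (simp del: of_nat_Suc)
  qed
  moreover have "infsum (\<lambda>j. if j = k then d j else 0) UNIV = d k"
  proof -
    have "infsum (\<lambda>j. if j = k then d j else 0) UNIV = infsum d {k}"
      by (rule infsum_cong_neutral) auto
    thus ?thesis by simp
  qed
  ultimately show ?thesis
    by (simp add: LIMSEQ_const_iff)
qed

text \<open>Extensional functions, so that these sets, for all \<open>j\<close> together, partition
  the \<open>PiE\<close> over which a product of sums expands.\<close>

definition int_tuples :: "nat \<Rightarrow> int \<Rightarrow> (nat \<Rightarrow> int) set" where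
  "int_tuples t j = {f \<in> {..<t} \<rightarrow>\<^sub>E UNIV. (\<Sum>i<t. f i) = j}"

text \<open>If f_i = u_i - u_(i+1) with u_t = 0, the linear part telescopes to u_1 + ... + u_(t-1).
  It is thus the cross term produced by a shift by rho / t in type A_(t-1).\<close>

definition core_exponent :: "nat \<Rightarrow> (nat \<Rightarrow> int) \<Rightarrow> real" where
  "core_exponent t f =
     real t / 2 * (\<Sum>i<t. (of_int (f i))\<^sup>2) + (\<Sum>i<t. real i * of_int (f i))"

definition core_factor :: "complex \<Rightarrow> nat \<Rightarrow> complex" where
  "core_factor c t = euler_prod (exp (c * of_real (real t))) ^ t / euler_prod (exp c)"

text \<open>For \<open>j = 0\<close> this is the generating function of \<open>t\<close>-cores. It follows by comparing the coefficients
  of \<open>z\<^sup>j\<close> in \<open>prod_jtheta\<close>.\<close>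

lemma core_sum:
  assumes c: "Re c < 0" and t: "t > 0"
  shows "(\<lambda>f. norm (qpow c (core_exponent t f))) summable_on int_tuples t j"
    and "((\<lambda>f. qpow c (core_exponent t f)) has_sum
           core_factor c t * qpow c ((of_int j)\<^sup>2 / 2 + (real t - 1) / 2 * of_int j)) (int_tuples t j)"
proof -
  define ct where "ct = c * of_real (real t)"
  have ct: "Re ct < 0" using c t by (simp add: ct_def mult_neg_pos)
  define T where "T = ({..<t} \<rightarrow>\<^sub>E (UNIV :: int set))"
  define a where "a f = qpow c (core_exponent t f)" for f
  define g where "g z i m = (z * qpow c (real i)) powi m * qpow ct ((of_int m)\<^sup>2 / 2)"
    for z :: complex and i :: nat and m :: int
  have g_eq: "(\<Prod>i<t. g z i (f i)) = z powi (\<Sum>i<t. f i) * a f" if "z \<noteq> 0" for z f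
  proof -
    have "g z i m = z powi m * qpow c (real t / 2 * (of_int m)\<^sup>2 + real i * of_int m)" for i m
      by (simp add: g_def ct_def qpow_scale_nat power_int_mult_distrib qpow_powi qpow_add mult_ac)
    moreover have "(\<Prod>i<t. z powi f i) = z powi (\<Sum>i<t. f i)"
      by (induction t) (auto simp: power_int_add that)
    ultimately show ?thesis
      by (simp add: a_def prod.distrib core_exponent_def sum_distrib_left flip: qpow_sum sum.distrib)
  qed
  have g_abs: "(\<lambda>f. norm (\<Prod>i<t. g z i (f i))) summable_on T" if "z \<noteq> 0" for z
    unfolding T_def g_def
    by (rule abs_summable_on_prod_PiE') (use ct that in \<open>auto intro!: summable_qpow_gaussian\<close>)
  have a_abs: "(\<lambda>f. norm (a f)) summable_on T"
    using g_abs[of 1] by (simp add: g_eq)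
  have sub: "int_tuples t j \<subseteq> T" for j by (auto simp: int_tuples_def T_def)
  have abs: "(\<lambda>f. norm (a f)) summable_on int_tuples t j" for j
    by (rule summable_on_subset[OF a_abs sub])
  thus "(\<lambda>f. norm (qpow c (core_exponent t f))) summable_on int_tuples t j"
    by (simp add: a_def)

  define A where "A j = infsum a (int_tuples t j)" for j
  define r where "r j = core_factor c t * qpow c ((of_int j)\<^sup>2 / 2 + (real t - 1) / 2 * of_int j)"
    for j :: int
  \<comment> \<open>Grouping the tuples by their sum rewrites the product of the theta series as a
    Laurent series in z with coefficients \<open>A j\<close>. By \<open>prod_jtheta\<close> its
    values on the unit circle are those of the series with coefficients \<open>r j\<close>.\<close>
  have bij: "bij_betw (\<lambda>f. (\<Sum>i<t. f i, f)) T (Sigma UNIV (int_tuples t))"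
    by (rule bij_betwI[of _ _ _ snd]) (auto simp: T_def int_tuples_def)
  have a_Sigma: "(\<lambda>(j, f). norm (a f)) summable_on Sigma UNIV (int_tuples t)"
    using a_abs summable_on_reindex_bij_betw[OF bij, of "\<lambda>(j, f). norm (a f)"] by simp
  have A_abs: "(\<lambda>j. norm (A j)) summable_on UNIV"
  proof (rule Infinite_Sum.abs_summable_on_comparison_test')
    show "(\<lambda>j. infsum (\<lambda>f. norm (a f)) (int_tuples t j)) summable_on UNIV"
      using summable_on_Sigma_banach[OF a_Sigma] .
    show "norm (A j) \<le> infsum (\<lambda>f. norm (a f)) (int_tuples t j)" for j
      unfolding A_def by (rule norm_infsum_bound[OF abs])
  qed
  have r_eq: "z powi j * r j = core_factor c t * ((z * qpow c ((real t - 1) / 2)) powi j *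
      qpow c ((of_int j)\<^sup>2 / 2))" for z j
    by (simp add: r_def qpow_add power_int_mult_distrib qpow_powi mult_ac)
  have r_abs: "(\<lambda>j. norm (z powi j * r j)) summable_on UNIV" if "z \<noteq> 0" for z
    unfolding r_eq norm_mult[of "core_factor c t"]
    by (intro summable_on_cmult_right summable_qpow_gaussian c) (use that in auto)
  have r_abs1: "(\<lambda>j. norm (r j)) summable_on UNIV"
    using r_abs[of 1] by simp
  have "A j - r j = 0" for j
  proof (rule Laurent_coeffs_eq_0)
    show "(\<lambda>j. norm (A j - r j)) summable_on UNIV"
      by (rule Infinite_Sum.abs_summable_on_comparison_test'[OF summable_on_add[OF A_abs r_abs1]])
         (rule norm_triangle_ineq4)
    fix z :: complex assume z1: "norm z = 1"
    hence z: "z \<noteq> 0" by auto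
    have "infsum (\<lambda>f. \<Prod>i<t. g z i (f i)) T = (\<Prod>i<t. infsum (g z i) UNIV)"
      unfolding T_def
    proof (rule infsum_prod_PiE_abs)
      show "(\<lambda>m. norm (g z i m)) summable_on UNIV" for i
        unfolding g_def using ct z by (intro summable_qpow_gaussian) auto
    qed auto
    also have "\<dots> = (\<Prod>i<t. jtheta ct (z * qpow c (real i)))"
      by (simp add: jtheta_def g_def[abs_def])
    also have "\<dots> = core_factor c t * jtheta c (z * qpow c ((real t - 1) / 2))"
      unfolding ct_def core_factor_def by (rule prod_jtheta[OF c z t])
    also have "\<dots> = (\<Sum>\<^sub>\<infinity>j. z powi j * r j)"
      by (simp add: jtheta_def r_eq infsum_cmult_right')
    also have "infsum (\<lambda>f. \<Prod>i<t. g z i (f i)) T =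
        infsum (\<lambda>(j, f). z powi j * a f) (Sigma UNIV (int_tuples t))"
      unfolding g_eq[OF z]
      using infsum_reindex_bij_betw[OF bij, of "\<lambda>(j, f). z powi j * a f"] by simp
    also have "\<dots> = (\<Sum>\<^sub>\<infinity>j. \<Sum>\<^sub>\<infinity>f\<in>int_tuples t j. z powi j * a f)"
    proof (rule infsum_Sigma'_banach[symmetric], rule abs_summable_summable)
      show "(\<lambda>p. norm (case p of (j, f) \<Rightarrow> z powi j * a f)) summable_on Sigma UNIV (int_tuples t)"
        using a_Sigma z1 by (simp add: case_prod_unfold norm_mult norm_power_int)
    qed
    also have "\<dots> = (\<Sum>\<^sub>\<infinity>j. z powi j * A j)"
      by (simp add: infsum_cmult_right' A_def)
    finally have eq: "(\<Sum>\<^sub>\<infinity>j. z powi j * A j) = (\<Sum>\<^sub>\<infinity>j. z powi j * r j)" .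
    have "(\<lambda>j. z powi j * A j) summable_on UNIV"
      by (rule abs_summable_summable) (use A_abs z1 in \<open>simp add: norm_mult norm_power_int\<close>)
    moreover have "(\<lambda>j. - (z powi j * r j)) summable_on UNIV"
      by (rule summable_on_uminus[THEN iffD2], rule abs_summable_summable, rule r_abs[OF z])
    ultimately have "(\<Sum>\<^sub>\<infinity>j. z powi j * A j + - (z powi j * r j)) =
        (\<Sum>\<^sub>\<infinity>j. z powi j * A j) + (\<Sum>\<^sub>\<infinity>j. - (z powi j * r j))"
      by (rule infsum_add)
    thus "(\<Sum>\<^sub>\<infinity>j. z powi j * (A j - r j)) = 0"
      by (simp add: eq infsum_uminus right_diff_distrib)
  qed
  hence "A j = r j" for j by simp
  moreover have "(a has_sum A j) (int_tuples t j)"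
    unfolding A_def by (rule has_sum_infsum) (rule abs_summable_summable[OF abs])
  ultimately show "((\<lambda>f. qpow c (core_exponent t f)) has_sum
      core_factor c t * qpow c ((of_int j)\<^sup>2 / 2 + (real t - 1) / 2 * of_int j)) (int_tuples t j)"
    by (simp add: a_def[abs_def] r_def)
qed

section \<open>Summation over star-shaped diagrams\<close>

lemma has_sum_times:
  fixes f :: "'a \<Rightarrow> complex" and g :: "'b \<Rightarrow> complex"
  assumes f: "(\<lambda>x. norm (f x)) summable_on A" "(f has_sum a) A"
    and g: "(\<lambda>x. norm (g x)) summable_on B" "(g has_sum b) B"
  shows "(\<lambda>z. norm (f (fst z) * g (snd z))) summable_on A \<times> B"
    and "((\<lambda>z. f (fst z) * g (snd z)) has_sum a * b) (A \<times> B)"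
proof -
  show *: "(\<lambda>z. norm (f (fst z) * g (snd z))) summable_on A \<times> B"
  proof (rule summable_on_SigmaI)
    show "((\<lambda>y. norm (f (fst (x, y)) * g (snd (x, y)))) has_sum
        norm (f x) * (\<Sum>\<^sub>\<infinity>y\<in>B. norm (g y))) B" for x
      unfolding norm_mult fst_conv snd_conv
      by (intro has_sum_cmult_right has_sum_infsum g(1))
    show "(\<lambda>x. norm (f x) * (\<Sum>\<^sub>\<infinity>y\<in>B. norm (g y))) summable_on A"
      by (intro summable_on_cmult_left f(1))
  qed auto
  show "((\<lambda>z. f (fst z) * g (snd z)) has_sum a * b) (A \<times> B)"
  proof (rule has_sum_SigmaI)
    show "((\<lambda>y. f (fst (x, y)) * g (snd (x, y))) has_sum f x * b) B" for x
      unfolding fst_conv snd_conv by (intro has_sum_cmult_right g(2))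
    show "((\<lambda>x. f x * b) has_sum a * b) A"
      by (intro has_sum_cmult_left f(2))
    show "(\<lambda>z. f (fst z) * g (snd z)) summable_on A \<times> B"
      by (rule abs_summable_summable[OF *])
  qed
qed

text \<open>The tuples of length 2 and sum 0 are the pairs (-j, j), whose
  \<open>core_exponent\<close> is 2 j^2 + j.\<close>

lemma sum_qpow_quadratic:
  assumes c: "Re c < 0"
  shows "(\<lambda>j::int. norm (qpow c (2 * (of_int j)\<^sup>2 + of_int j))) summable_on UNIV"
    and "((\<lambda>j::int. qpow c (2 * (of_int j)\<^sup>2 + of_int j)) has_sum core_factor c 2) UNIV"
proof -
  define F where "F j = (\<lambda>i\<in>{..<2::nat}. if i = 0 then - j else j :: int)" for j
  have bij: "bij_betw F UNIV (int_tuples 2 0)"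
  proof (rule bij_betwI[of _ _ _ "\<lambda>f. f 1"])
    fix f assume "f \<in> int_tuples 2 0"
    hence f: "f \<in> {..<2} \<rightarrow>\<^sub>E UNIV" "f 0 + f 1 = 0"
      by (auto simp: int_tuples_def numeral_2_eq_2)
    show "F (f 1) = f"
    proof
      fix i show "F (f 1) i = f i"
      proof (cases "i < 2")
        case True
        hence "i = 0 \<or> i = 1" by auto
        thus ?thesis using f(2) by (auto simp: F_def)
      qed (use f(1) in \<open>auto simp: F_def PiE_def extensional_def\<close>)
    qed
  qed (auto simp: F_def int_tuples_def numeral_2_eq_2)
  have e: "core_exponent 2 (F j) = 2 * (of_int j)\<^sup>2 + of_int j" for j
    by (simp add: core_exponent_def F_def numeral_2_eq_2)
  show "(\<lambda>j::int. norm (qpow c (2 * (of_int j)\<^sup>2 + of_int j))) summable_on UNIV"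
    using core_sum(1)[OF c, of 2 0]
      summable_on_reindex_bij_betw[OF bij, of "\<lambda>f. norm (qpow c (core_exponent 2 f))"]
    by (simp add: e)
  show "((\<lambda>j::int. qpow c (2 * (of_int j)\<^sup>2 + of_int j)) has_sum core_factor c 2) UNIV"
    using core_sum(2)[OF c, of 2 0]
      has_sum_reindex_bij_betw[OF bij, of "\<lambda>f. qpow c (core_exponent 2 f)"]
    by (simp add: e)
qed

text \<open>A lattice vector with coordinate \<open>j\<close> at the trivalent node and coordinates \<open>u\<^sub>1, \<dots>, u\<^bsub>p-1\<^esub>\<close>
  along a branch is encoded by \<open>j\<close> and the differences \<open>f\<^sub>i = u\<^sub>i - u\<^bsub>i+1\<^esub>\<close>, where \<open>u\<^sub>0 = j\<close> and
  \<open>u\<^sub>p = 0\<close>; then its norm is the sum of the squares of all differences minus \<open>j\<^sup>2\<close>.\<close>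

definition star_set :: "nat \<Rightarrow> nat \<Rightarrow> nat \<Rightarrow> (int \<times> (nat \<Rightarrow> int) \<times> (nat \<Rightarrow> int) \<times> (nat \<Rightarrow> int)) set" where
  "star_set p q r = Sigma UNIV (\<lambda>j. int_tuples p j \<times> int_tuples q j \<times> int_tuples r j)"

text \<open>This is k/2 (m|m) + k (x|m) in the encoded coordinates. The term -k/2 j^2 corrects the
  count of j^2, which occurs once in each of the three branches but only twice in (m|m); the
  coefficient 3 - k is k times the value 3/k - 1 of (x|alpha) at the trivalent node.\<close>

definition star_exponent ::
    "real \<Rightarrow> nat \<Rightarrow> nat \<Rightarrow> nat \<Rightarrow> int \<times> (nat \<Rightarrow> int) \<times> (nat \<Rightarrow> int) \<times> (nat \<Rightarrow> int) \<Rightarrow> real" where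
  "star_exponent k p q r = (\<lambda>(j, f, g, h).
     k / p * core_exponent p f + k / q * core_exponent q g + k / r * core_exponent r h
     - k / 2 * (of_int j)\<^sup>2 + (3 - k) * of_int j)"

lemma star_sum:
  assumes c: "Re c < 0" and pos: "p > 0" "q > 0" "r > 0" "k > 0"
    and k: "k / real p + k / real q + k / real r = k + 4"
  shows "((\<lambda>x. qpow c (star_exponent k p q r x)) has_sum
           core_factor (c * of_real (k / p)) p * core_factor (c * of_real (k / q)) q *
           core_factor (c * of_real (k / r)) r * core_factor c 2) (star_set p q r)"
proof -
  define C where "C c = core_factor (c * of_real (k / p)) p * core_factor (c * of_real (k / q)) q *
    core_factor (c * of_real (k / r)) r" for c
  define B where "B j = int_tuples p j \<times> int_tuples q j \<times> int_tuples r j" for j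
  have inner: "((\<lambda>y. qpow c (star_exponent k p q r (j, y))) has_sum
      C c * qpow c (2 * (of_int j)\<^sup>2 + of_int j)) (B j)"
    if c: "Re c < 0" for c j
  proof -
    define e where "e t f = qpow (c * of_real (k / real t)) (core_exponent t f)" for t f
    define v where "v t = qpow (c * of_real (k / real t))
        ((of_int j)\<^sup>2 / 2 + (real t - 1) / 2 * of_int j)" for t
    have e: "(\<lambda>f. norm (e t f)) summable_on int_tuples t j"
      "(e t has_sum core_factor (c * of_real (k / real t)) t * v t) (int_tuples t j)" if "t > 0" for t
    proof -
      have "Re (c * of_real (k / real t)) < 0"
        using c \<open>k > 0\<close> that by (simp add: mult_neg_pos divide_neg_pos)
      from core_sum[OF this that, of j] show "(\<lambda>f. norm (e t f)) summable_on int_tuples t j"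
        "(e t has_sum core_factor (c * of_real (k / real t)) t * v t) (int_tuples t j)"
        unfolding e_def[abs_def] v_def .
    qed
    define L where "L = qpow c (- k / 2 * (of_int j)\<^sup>2 + (3 - k) * of_int j)"
    note gh = has_sum_times[OF e[OF pos(2)] e[OF pos(3)]]
    have "((\<lambda>y. L * (e p (fst y) * (e q (fst (snd y)) * e r (snd (snd y))))) has_sum
        L * (core_factor (c * of_real (k / p)) p * v p * (core_factor (c * of_real (k / q)) q * v q *
          (core_factor (c * of_real (k / r)) r * v r)))) (B j)"
      unfolding B_def
      by (intro has_sum_cmult_right has_sum_times(2)[OF e[OF pos(1)] gh])
    moreover have "L * (e p (fst y) * (e q (fst (snd y)) * e r (snd (snd y)))) =
        qpow c (star_exponent k p q r (j, y))" for y
      unfolding L_def e_def qpow_scale qpow_add[symmetric]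
      by (simp add: star_exponent_def case_prod_unfold algebra_simps)
    moreover have "L * (v p * (v q * v r)) = qpow c (2 * (of_int j)\<^sup>2 + of_int j)"
    proof -
      define J where "J = real_of_int j"
      define P where "P = k / real p"
      define Q where "Q = k / real q"
      define R where "R = k / real r"
      have PQR: "P * p = k" "Q * q = k" "R * r = k" and sum: "P + Q + R = k + 4"
        using pos k by (auto simp: P_def Q_def R_def)
      have "- k / 2 * J\<^sup>2 + (3 - k) * J + (P * (J\<^sup>2 / 2 + (real p - 1) / 2 * J) +
          (Q * (J\<^sup>2 / 2 + (real q - 1) / 2 * J) + R * (J\<^sup>2 / 2 + (real r - 1) / 2 * J)))
        = (P + Q + R - k) / 2 * J\<^sup>2 + (3 - k + (P * p + Q * q + R * r - (P + Q + R)) / 2) * J"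
        by (simp add: algebra_simps add_divide_distrib diff_divide_distrib)
      also have "\<dots> = 2 * J\<^sup>2 + J"
        unfolding PQR sum by (simp add: field_simps)
      finally show ?thesis
        unfolding L_def v_def qpow_scale qpow_add[symmetric]
        by (simp only: J_def P_def Q_def R_def)
    qed
    hence "L * (core_factor (c * of_real (k / p)) p * v p * (core_factor (c * of_real (k / q)) q * v q *
        (core_factor (c * of_real (k / r)) r * v r))) = C c * qpow c (2 * (of_int j)\<^sup>2 + of_int j)"
      unfolding C_def by (metis (no_types, lifting) mult.assoc mult.left_commute)
    ultimately show ?thesis
      by simp
  qed
  have "((\<lambda>x. qpow c (star_exponent k p q r x)) has_sum C c * core_factor c 2) (Sigma UNIV B)"
  proof (rule has_sum_SigmaI)
    show "((\<lambda>y. qpow c (star_exponent k p q r (j, y))) has_sum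
        C c * qpow c (2 * (of_int j)\<^sup>2 + of_int j)) (B j)" for j
      by (rule inner[OF c])
    show "((\<lambda>j::int. C c * qpow c (2 * (of_int j)\<^sup>2 + of_int j)) has_sum C c * core_factor c 2) UNIV"
      by (intro has_sum_cmult_right sum_qpow_quadratic(2) c)
    \<comment> \<open>For absolute convergence \<open>inner\<close> is applied to the real number Re
      c: by \<open>qpow_Re\<close> its terms are then the norms of the original ones. This is why
      \<open>inner\<close> is stated for arbitrary \<open>c\<close>.\<close>
    define c' where "c' = complex_of_real (Re c)"
    have c': "Re c' < 0" using c by (simp add: c'_def)
    have "(\<lambda>x. norm (qpow c (star_exponent k p q r x))) summable_on Sigma UNIV B"
    proof (rule summable_on_SigmaI)
      fix j :: int
      have "((\<lambda>y. of_real (norm (qpow c (star_exponent k p q r (j, y))))) has_sum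
        C c' * of_real (norm (qpow c (2 * (of_int j)\<^sup>2 + of_int j)))) (B j)"
        using inner[OF c', of j] unfolding c'_def qpow_Re .
      from has_sum_Re[OF this]
      show "((\<lambda>y. norm (qpow c (star_exponent k p q r (j, y)))) has_sum
          Re (C c') * norm (qpow c (2 * (of_int j)\<^sup>2 + of_int j))) (B j)"
        by simp
    next
      show "(\<lambda>j::int. Re (C c') * norm (qpow c (2 * (of_int j)\<^sup>2 + of_int j))) summable_on UNIV"
        by (intro summable_on_cmult_right sum_qpow_quadratic(1) c)
    qed auto
    thus "(\<lambda>x. qpow c (star_exponent k p q r x)) summable_on Sigma UNIV B"
      by (rule abs_summable_summable)
  qed
  thus ?thesis
    by (simp only: C_def B_def[abs_def] star_set_def)
qed

section \<open>Orders of the finite subgroups of SU(2)\<close>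

definition conj_transpose :: "complex^2^2 \<Rightarrow> complex^2^2" where
  "conj_transpose A = (\<chi> i j. cnj (A $ j $ i))"

lemma conj_transpose_mult: "conj_transpose (A ** B) = conj_transpose B ** conj_transpose A"
  by (simp add: conj_transpose_def matrix_matrix_mult_def vec_eq_iff mult.commute)

lemma conj_transpose_involution [simp]: "conj_transpose (conj_transpose A) = A"
  by (simp add: conj_transpose_def vec_eq_iff)

lemma conj_transpose_1: "conj_transpose (mat 1) = mat 1"
  by (simp add: conj_transpose_def vec_eq_iff mat_def)

lemma carrier_SU2: "A \<in> carrier SU2 \<longleftrightarrow> A ** conj_transpose A = mat 1 \<and> det A = 1"
  by (simp add: SU2_def conj_transpose_def)

lemma mult_SU2 [simp]: "A \<otimes>\<^bsub>SU2\<^esub> B = A ** B"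
  by (simp add: SU2_def)

lemma one_SU2 [simp]: "\<one>\<^bsub>SU2\<^esub> = mat 1"
  by (simp add: SU2_def)

lemma conj_transpose_in_SU2:
  assumes "A \<in> carrier SU2"
  shows "conj_transpose A \<in> carrier SU2" "conj_transpose A ** A = mat 1"
proof -
  have A: "A ** conj_transpose A = mat 1" "det A = 1"
    using assms by (auto simp: carrier_SU2)
  show inv: "conj_transpose A ** A = mat 1"
    using A(1) by (simp add: matrix_left_right_inverse)
  have "det A * det (conj_transpose A) = 1"
    using A(1) by (metis det_I det_mul)
  thus "conj_transpose A \<in> carrier SU2"
    using A inv by (simp add: carrier_SU2)
qed

lemma group_SU2: "group SU2"
proof (rule groupI)
  fix A B assume AB: "A \<in> carrier SU2" "B \<in> carrier SU2"
  have "(A ** B) ** conj_transpose (A ** B) = A ** (B ** conj_transpose B) ** conj_transpose A"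
    by (simp only: conj_transpose_mult matrix_mul_assoc)
  thus "A \<otimes>\<^bsub>SU2\<^esub> B \<in> carrier SU2"
    using AB by (simp add: carrier_SU2 det_mul)
next
  fix A assume "A \<in> carrier SU2"
  thus "\<exists>B\<in>carrier SU2. B \<otimes>\<^bsub>SU2\<^esub> A = \<one>\<^bsub>SU2\<^esub>"
    using conj_transpose_in_SU2[of A] by auto
qed (auto simp: carrier_SU2 matrix_mul_assoc conj_transpose_1)

lemma su2_mult: "su2 a b ** su2 c d = su2 (a * c - b * cnj d) (a * d + b * cnj c)"
  by (simp add: su2_def vec_eq_iff forall_2 matrix_matrix_mult_def sum_2 algebra_simps)

lemma su2_1: "su2 1 0 = mat 1"
  by (simp add: su2_def vec_eq_iff forall_2 mat_def)

lemma su2_inject: "su2 a b = su2 c d \<longleftrightarrow> a = c \<and> b = d"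
  by (auto simp: su2_def vec_eq_iff forall_2)

lemma su2_in_carrier: "a * cnj a + b * cnj b = 1 \<Longrightarrow> su2 a b \<in> carrier SU2"
  unfolding carrier_SU2
  by (simp add: conj_transpose_def su2_def vec_eq_iff forall_2 mat_def matrix_matrix_mult_def sum_2
      det_2 algebra_simps)

text \<open>Left multiplication by a generator is injective and maps the finite set \<open>L\<close>
  into itself, hence onto itself. So \<open>L\<close> is closed under inverses of generators as
  well, although only the generators are checked.\<close>

lemma (in group) generate_eq_of_closed:
  assumes S: "S \<subseteq> carrier G" and L: "finite L" "L \<subseteq> generate G S" "\<one> \<in> L"
    and closed: "\<And>g x. g \<in> S \<Longrightarrow> x \<in> L \<Longrightarrow> g \<otimes> x \<in> L"
  shows "generate G S = L"
proof
  have car: "L \<subseteq> carrier G"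
    using L(2) generate_in_carrier[OF S] by blast
  have "h \<otimes> x \<in> L" if "h \<in> generate G S" "x \<in> L" for h x
    using that
  proof (induction arbitrary: x rule: generate.induct)
    case one
    thus ?case using car by auto
  next
    case (incl h)
    thus ?case by (rule closed)
  next
    case (inv h)
    have h: "h \<in> carrier G" using S inv.hyps by auto
    have cancel: "inv h \<otimes> (h \<otimes> y) = y" if "y \<in> L" for y
      using h car that by (metis inv_closed l_inv l_one m_assoc subsetD)
    hence "inj_on (\<lambda>x. h \<otimes> x) L"
      by (metis inj_onI)
    hence "(\<lambda>x. h \<otimes> x) ` L = L"
      using endo_inj_surj[OF L(1)] closed[OF inv.hyps] by blast
    then obtain y where "y \<in> L" "x = h \<otimes> y" using inv.prems by blast
    thus ?case by (simp add: cancel)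
  next
    case (eng h1 h2)
    have "h1 \<in> carrier G" "h2 \<in> carrier G" "x \<in> carrier G"
      using eng.hyps eng.prems generate_in_carrier[OF S] car by auto
    thus ?case using eng by (simp add: m_assoc)
  qed
  from this[OF _ L(3)] show "generate G S \<subseteq> L"
    using generate_in_carrier[OF S] by (metis r_one subsetI)
qed (rule L(2))

section \<open>The binary polyhedral groups by computation in quadratic rings\<close>

text \<open>The pair \<open>(a, b)\<close> stands for \<open>a + b \<theta>\<close>, and the parameter \<open>(u, v)\<close> below says that
  \<open>\<theta>\<^sup>2 = u \<theta> + v\<close>. A quadruple of pairs stands for half the quaternion with these coordinates.\<close>

type_synonym zpair = "int \<times> int"
type_synonym zquat = "zpair \<times> zpair \<times> zpair \<times> zpair"

fun zadd :: "zpair \<Rightarrow> zpair \<Rightarrow> zpair" where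
  "zadd (a, b) (c, d) = (a + c, b + d)"

fun zsub :: "zpair \<Rightarrow> zpair \<Rightarrow> zpair" where
  "zsub (a, b) (c, d) = (a - c, b - d)"

fun zmul :: "zpair \<Rightarrow> zpair \<Rightarrow> zpair \<Rightarrow> zpair" where
  "zmul (u, v) (a, b) (c, d) = (a * c + v * (b * d), a * d + b * c + u * (b * d))"

fun zhalf :: "zpair \<Rightarrow> zpair" where
  "zhalf (a, b) = (a div 2, b div 2)"

fun zeven :: "zpair \<Rightarrow> bool" where
  "zeven (a, b) \<longleftrightarrow> a mod 2 = 0 \<and> b mod 2 = 0"

fun zqmul :: "zpair \<Rightarrow> zquat \<Rightarrow> zquat \<Rightarrow> zquat" where
  "zqmul e (x0, x1, x2, x3) (y0, y1, y2, y3) =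
     (zsub (zsub (zmul e x0 y0) (zmul e x1 y1)) (zadd (zmul e x2 y2) (zmul e x3 y3)),
      zadd (zsub (zmul e x0 y1) (zmul e x3 y2)) (zadd (zmul e x1 y0) (zmul e x2 y3)),
      zadd (zsub (zmul e x0 y2) (zmul e x1 y3)) (zadd (zmul e x2 y0) (zmul e x3 y1)),
      zadd (zsub (zmul e x0 y3) (zmul e x2 y1)) (zadd (zmul e x1 y2) (zmul e x3 y0)))"

text \<open>As quadruples stand for halves, the product of x/2 and y/2 is represented by xy/2;
  \<open>zqeven\<close> certifies that this halving is exact.\<close>

fun zqhalf :: "zquat \<Rightarrow> zquat" where
  "zqhalf (x0, x1, x2, x3) = (zhalf x0, zhalf x1, zhalf x2, zhalf x3)"

fun zqeven :: "zquat \<Rightarrow> bool" where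
  "zqeven (x0, x1, x2, x3) \<longleftrightarrow> zeven x0 \<and> zeven x1 \<and> zeven x2 \<and> zeven x3"

definition zqone :: zquat where
  "zqone = ((2, 0), (0, 0), (0, 0), (0, 0))"

text \<open>The entry \<open>(a, b)\<close> of the last argument appends the product of the \<open>a\<close>-th generator and the
  \<open>b\<close>-th element of the list built so far. The lists of entries used below come from a
  breadth-first search.\<close>

fun build :: "zpair \<Rightarrow> zquat list \<Rightarrow> zquat list \<Rightarrow> (nat \<times> nat) list \<Rightarrow> zquat list" where
  "build e gs L [] = L"
| "build e gs L ((a, b) # ws) =
     (if a < length gs \<and> b < length L
      then build e gs (L @ [zqhalf (zqmul e (gs ! a) (L ! b))]) ws else L)"

definition closed_list :: "zpair \<Rightarrow> zquat list \<Rightarrow> zquat list \<Rightarrow> bool" where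
  "closed_list e gs L \<longleftrightarrow> distinct L \<and>
     list_all (\<lambda>g. list_all (\<lambda>x. zqeven (zqmul e g x) \<and> zqhalf (zqmul e g x) \<in> set L) L) gs"

definition zval :: "real \<Rightarrow> zpair \<Rightarrow> real" where
  "zval \<theta> x = of_int (fst x) + of_int (snd x) * \<theta>"

fun zmat :: "real \<Rightarrow> zquat \<Rightarrow> complex^2^2" where
  "zmat \<theta> (x0, x1, x2, x3) =
     su2 (Complex (zval \<theta> x0 / 2) (zval \<theta> x1 / 2)) (Complex (zval \<theta> x2 / 2) (zval \<theta> x3 / 2))"

lemma zval_add: "zval \<theta> (zadd x y) = zval \<theta> x + zval \<theta> y"
  by (cases x; cases y) (simp add: zval_def algebra_simps)

lemma zval_sub: "zval \<theta> (zsub x y) = zval \<theta> x - zval \<theta> y"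
  by (cases x; cases y) (simp add: zval_def algebra_simps)

lemma zval_mul:
  assumes "\<theta>\<^sup>2 = of_int u * \<theta> + of_int v"
  shows "zval \<theta> (zmul (u, v) x y) = zval \<theta> x * zval \<theta> y"
proof -
  obtain a b c d where xy: "x = (a, b)" "y = (c, d)" by (cases x; cases y)
  have "zval \<theta> x * zval \<theta> y = a * c + (a * d + b * c) * \<theta> + b * d * \<theta>\<^sup>2"
    by (simp add: xy zval_def algebra_simps power2_eq_square)
  also have "\<dots> = zval \<theta> (zmul (u, v) x y)"
    unfolding assms by (simp add: xy zval_def algebra_simps)
  finally show ?thesis ..
qed

lemma zval_half: "zeven x \<Longrightarrow> zval \<theta> (zhalf x) = zval \<theta> x / 2"
  by (cases x) (auto simp: zval_def real_of_int_div dvd_eq_mod_eq_0 add_divide_distrib)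

lemma zmat_mult:
  assumes \<theta>: "\<theta>\<^sup>2 = of_int u * \<theta> + of_int v" and "zqeven (zqmul (u, v) x y)"
  shows "zmat \<theta> (zqhalf (zqmul (u, v) x y)) = zmat \<theta> x ** zmat \<theta> y"
proof -
  obtain x0 x1 x2 x3 y0 y1 y2 y3 where xy: "x = (x0, x1, x2, x3)" "y = (y0, y1, y2, y3)"
    by (cases x; cases y)
  show ?thesis
    using assms(2)
    by (simp add: xy zval_half zval_add zval_sub zval_mul[OF \<theta>] su2_mult su2_inject
        complex_eq_iff field_simps)
qed

lemma inj_zmat:
  assumes "\<And>a b :: int. of_int a + of_int b * \<theta> = 0 \<Longrightarrow> a = 0 \<and> b = 0"
  shows "inj (zmat \<theta>)"
proof -
  have "x = y" if "zval \<theta> x = zval \<theta> y" for x y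
    using assms[of "fst x - fst y" "snd x - snd y"] that
    by (cases x; cases y) (simp add: zval_def algebra_simps)
  thus ?thesis
    by (intro injI) (auto simp: su2_inject complex_eq_iff)
qed

lemma build_superset: "set L \<subseteq> set (build e gs L ws)"
  by (induction e gs L ws rule: build.induct) auto

text \<open>Exactness of the halvings is known only on the final list, for which \<open>C\<close>
  stands; every intermediate list is contained in it.\<close>

lemma build_in_generate:
  assumes \<theta>: "\<theta>\<^sup>2 = of_int u * \<theta> + of_int v"
    and even: "\<And>g x. g \<in> set gs \<Longrightarrow> x \<in> C \<Longrightarrow> zqeven (zqmul (u, v) g x)"
    and "set (build (u, v) gs L ws) \<subseteq> C"
    and "zmat \<theta> ` set L \<subseteq> generate SU2 (zmat \<theta> ` set gs)"
  shows "zmat \<theta> ` set (build (u, v) gs L ws) \<subseteq> generate SU2 (zmat \<theta> ` set gs)"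
  using assms(3,4)
proof (induction ws arbitrary: L)
  case (Cons w ws)
  obtain a b where w: "w = (a, b)" by (cases w)
  show ?case
  proof (cases "a < length gs \<and> b < length L")
    case True
    define x where "x = zqhalf (zqmul (u, v) (gs ! a) (L ! b))"
    have eq: "build (u, v) gs L (w # ws) = build (u, v) gs (L @ [x]) ws"
      using True by (simp add: w x_def)
    have "L ! b \<in> C"
      using True Cons.prems(1) build_superset[of L "(u, v)" gs "w # ws"] nth_mem by blast
    hence "zmat \<theta> x = zmat \<theta> (gs ! a) ** zmat \<theta> (L ! b)"
      unfolding x_def using True by (intro zmat_mult[OF \<theta>] even) auto
    moreover have "zmat \<theta> (gs ! a) \<in> generate SU2 (zmat \<theta> ` set gs)"
      using True by (intro generate.incl) auto
    moreover have "zmat \<theta> (L ! b) \<in> generate SU2 (zmat \<theta> ` set gs)"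
      using True Cons.prems(2) by auto
    ultimately have "zmat \<theta> x \<in> generate SU2 (zmat \<theta> ` set gs)"
      using generate.eng[of "zmat \<theta> (gs ! a)" SU2 _ "zmat \<theta> (L ! b)"] by simp
    thus ?thesis
      unfolding eq using Cons.prems by (intro Cons.IH) (auto simp: eq)
  next
    case False
    hence "build (u, v) gs L (w # ws) = L" by (auto simp: w)
    thus ?thesis using Cons.prems by simp
  qed
qed auto

text \<open>The construction of the list shows that its elements are products of generators, and its
  closure under the generators shows that nothing else is generated. Independence of 1 and \<theta>
  over the integers turns distinct list entries into distinct matrices.\<close>

lemma card_generate_zmat:
  assumes \<theta>: "\<theta>\<^sup>2 = of_int u * \<theta> + of_int v"
    and irr: "\<And>a b :: int. of_int a + of_int b * \<theta> = 0 \<Longrightarrow> a = 0 \<and> b = 0"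
    and gs: "zmat \<theta> ` set gs \<subseteq> carrier SU2"
    and L: "let L = build (u, v) gs [zqone] ws in closed_list (u, v) gs L \<and> length L = N"
  shows "card (generate SU2 (zmat \<theta> ` set gs)) = N"
proof -
  define L where "L = build (u, v) gs [zqone] ws"
  have L: "distinct L" "length L = N"
    using L by (auto simp: L_def[symmetric] closed_list_def Let_def)
  have closed: "zqeven (zqmul (u, v) g x)" "zqhalf (zqmul (u, v) g x) \<in> set L"
    if "g \<in> set gs" "x \<in> set L" for g x
    using assms(4) that by (auto simp: L_def[symmetric] closed_list_def Let_def list_all_iff)
  have one: "zmat \<theta> zqone = mat 1"
    by (simp add: zqone_def zval_def flip: su2_1) (simp add: complex_eq_iff su2_inject)
  have sub: "zmat \<theta> ` set L \<subseteq> generate SU2 (zmat \<theta> ` set gs)"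
    unfolding L_def
  proof (rule build_in_generate[OF \<theta>])
    show "zqeven (zqmul (u, v) g x)" if "g \<in> set gs" "x \<in> set L" for g x
      by (rule closed(1)[OF that])
    show "zmat \<theta> ` set [zqone] \<subseteq> generate SU2 (zmat \<theta> ` set gs)"
      using generate.one[of SU2] by (simp add: one)
  qed (simp add: L_def)
  have "generate SU2 (zmat \<theta> ` set gs) = zmat \<theta> ` set L"
  proof (rule group.generate_eq_of_closed[OF group_SU2 gs _ sub])
    show "\<one>\<^bsub>SU2\<^esub> \<in> zmat \<theta> ` set L"
      using imageI[of zqone "set L" "zmat \<theta>"] build_superset[of "[zqone]" "(u, v)" gs ws]
      by (simp add: one L_def)
    fix A B assume "A \<in> zmat \<theta> ` set gs" "B \<in> zmat \<theta> ` set L"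
    then obtain g x where gx: "g \<in> set gs" "x \<in> set L" "A = zmat \<theta> g" "B = zmat \<theta> x" by blast
    have "A ** B = zmat \<theta> (zqhalf (zqmul (u, v) g x))"
      unfolding gx by (rule zmat_mult[OF \<theta> closed(1)[OF gx(1,2)], symmetric])
    thus "A \<otimes>\<^bsub>SU2\<^esub> B \<in> zmat \<theta> ` set L"
      using closed(2)[OF gx(1,2)] by simp
  qed auto
  moreover have "inj_on (zmat \<theta>) (set L)"
    using inj_zmat[OF irr] by (rule inj_on_subset) auto
  ultimately show ?thesis
    using L by (simp add: card_image distinct_card)
qed

definition tetrahedral_gens :: "zquat list" where
  "tetrahedral_gens = [((0, 0), (2, 0), (0, 0), (0, 0)), ((1, 0), (1, 0), (1, 0), (1, 0))]"

lemma tetrahedral_orbit: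
  "let L = build (0, 2) tetrahedral_gens [zqone]
    [(0, 0), (1, 0), (0, 1), (1, 1), (0, 2), (1, 2), (0, 3), (1, 3), (0, 4), (1, 4), (1,
    5), (0, 6), (1, 7), (0, 8), (1, 8), (0, 10), (1, 11), (1, 12), (0, 13), (1, 13), (0,
    15), (1, 16), (0, 17)]
   in closed_list (0, 2) tetrahedral_gens L \<and> length L = 24"
  by code_simp

text \<open>Here \<theta> is the square root of 2, and the first entry is (1 + i) / \<theta> =
  (\<theta> + \<theta> i) / 2.\<close>

definition octahedral_gens :: "zquat list" where
  "octahedral_gens = [((0, 1), (0, 1), (0, 0), (0, 0)), ((1, 0), (1, 0), (1, 0), (1, 0))]"

lemma octahedral_orbit:
  "let L = build (0, 2) octahedral_gens [zqone]
    [(0, 0), (1, 0), (0, 1), (1, 1), (0, 2), (1, 2), (0, 3), (1, 3), (1, 4), (0, 5), (0,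
    6), (1, 6), (1, 7), (1, 8), (0, 9), (1, 9), (0, 10), (1, 10), (0, 11), (1, 12), (1,
    13), (0, 14), (1, 14), (0, 15), (1, 16), (1, 17), (1, 18), (1, 19), (1, 20), (0, 21),
    (1, 21), (0, 22), (1, 23), (1, 24), (1, 25), (1, 26), (0, 27), (1, 28), (0, 30), (1,
    31), (1, 32), (1, 33), (1, 34), (0, 36), (0, 37), (0, 38), (1, 39)]
   in closed_list (0, 2) octahedral_gens L \<and> length L = 48"
  by code_simp

text \<open>Here \<theta> is the golden ratio, with \<theta>^2 = \<theta> + 1; the pair (-1, 1) is
  its inverse \<theta> - 1.\<close>

definition icosahedral_gens :: "zquat list" where
  "icosahedral_gens = [((1, 0), (1, 0), (1, 0), (1, 0)), ((0, 1), (-1, 1), (1, 0), (0, 0))]"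

lemma icosahedral_orbit:
  "let L = build (1, 1) icosahedral_gens [zqone]
    [(0, 0), (1, 0), (0, 1), (1, 1), (0, 2), (1, 2), (0, 3), (1, 3), (0, 4), (1, 4), (0,
    5), (0, 6), (1, 6), (0, 7), (1, 7), (0, 8), (1, 8), (0, 9), (0, 10), (1, 10), (1, 11),
    (0, 12), (0, 13), (0, 14), (1, 14), (0, 15), (1, 15), (0, 16), (0, 17), (1, 17), (1,
    18), (0, 19), (0, 20), (1, 21), (1, 22), (1, 24), (0, 25), (1, 25), (0, 26), (0, 27),
    (1, 27), (1, 28), (0, 29), (0, 30), (1, 31), (1, 32), (0, 34), (1, 34), (1, 35), (0,
    36), (1, 36), (0, 37), (0, 38), (1, 38), (1, 39), (0, 40), (0, 41), (1, 42), (1, 43),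
    (0, 45), (1, 45), (1, 46), (0, 47), (0, 48), (0, 49), (0, 50), (0, 51), (1, 51), (1,
    52), (0, 53), (0, 54), (1, 55), (1, 56), (0, 58), (1, 58), (1, 59), (0, 60), (0, 61),
    (0, 62), (1, 63), (0, 65), (1, 66), (0, 67), (0, 68), (1, 69), (1, 70), (0, 72), (1,
    72), (1, 73), (0, 74), (0, 75), (0, 76), (0, 79), (1, 80), (1, 81), (1, 82), (1, 83),
    (0, 85), (1, 85), (1, 86), (0, 87), (0, 88), (0, 89), (0, 92), (1, 93), (0, 94), (1,
    95), (0, 96), (1, 96), (1, 97), (0, 98), (0, 99), (0, 103), (1, 104), (1, 105), (0,
    106), (0, 107), (0, 108), (0, 109)]
   in closed_list (1, 1) icosahedral_gens L \<and> length L = 120"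
  by code_simp

text \<open>For nonzero x and y the multiplicity of p would be even on the left and odd on the
  right.\<close>

lemma square_eq_prime_mult_square:
  fixes x y :: int
  assumes "prime p" "x\<^sup>2 = p * y\<^sup>2"
  shows "x = 0 \<and> y = 0"
proof (rule ccontr)
  assume "\<not> (x = 0 \<and> y = 0)"
  with assms have nz: "x \<noteq> 0" "y \<noteq> 0" "p \<noteq> 0" by auto
  have p: "prime_elem p" using assms(1) by (rule prime_imp_prime_elem)
  have "multiplicity p (x\<^sup>2) = 2 * multiplicity p x"
    using nz p by (simp add: prime_elem_multiplicity_power_distrib)
  moreover have "multiplicity p (p * y\<^sup>2) = Suc (2 * multiplicity p y)"
    using nz p prime_elem_not_unit[OF p]
    by (subst prime_elem_multiplicity_mult_distrib[OF p])
       (simp_all only: power_not_zero prime_elem_multiplicity_power_distrib[OF p] multiplicity_self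
          not_False_eq_True plus_1_eq_Suc)
  ultimately have "2 * multiplicity p x = Suc (2 * multiplicity p y)"
    using assms(2) by simp
  thus False by presburger
qed

lemma sqrt2_independent:
  assumes "of_int a + of_int b * sqrt 2 = (0 :: real)"
  shows "a = 0 \<and> b = 0"
proof -
  have "(real_of_int a)\<^sup>2 = (- (of_int b * sqrt 2))\<^sup>2"
    using assms by (metis add_eq_0_iff2)
  hence "real_of_int (a\<^sup>2) = real_of_int (2 * b\<^sup>2)"
    by (simp add: power_mult_distrib)
  hence "a\<^sup>2 = 2 * b\<^sup>2" by linarith
  thus ?thesis using square_eq_prime_mult_square[of 2 a b] by simp
qed

lemma golden_ratio_independent:
  assumes "of_int a + of_int b * ((sqrt 5 + 1) / 2) = (0 :: real)"
  shows "a = 0 \<and> b = 0"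
proof -
  have "(2 * real_of_int a + of_int b) = - (of_int b * sqrt 5)"
    using assms by (simp add: field_simps)
  hence "(2 * real_of_int a + of_int b)\<^sup>2 = (of_int b * sqrt 5)\<^sup>2"
    by simp
  hence "real_of_int ((2 * a + b)\<^sup>2) = real_of_int (5 * b\<^sup>2)"
    by (simp add: power_mult_distrib)
  hence "(2 * a + b)\<^sup>2 = 5 * b\<^sup>2" by linarith
  thus ?thesis using square_eq_prime_mult_square[of 5 "2 * a + b" b] by simp
qed

lemma card_SU2_subgroup_E6: "card (SU2_subgroup E6) = 24"
proof -
  have eq: "SU2_generators E6 = zmat (sqrt 2) ` set tetrahedral_gens"
    by (simp add: tetrahedral_gens_def zval_def su2_inject complex_eq_iff
        insert_eq_iff[of "su2 _ _"])
  have car: "SU2_generators E6 \<subseteq> carrier SU2"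
    by (auto intro!: su2_in_carrier simp: complex_eq_iff)
  show ?thesis
    using card_generate_zmat[OF _ sqrt2_independent _ tetrahedral_orbit] car
    unfolding SU2_subgroup_def eq by simp
qed


lemma card_SU2_subgroup_E7: "card (SU2_subgroup E7) = 48"
proof -
  have eq: "SU2_generators E7 = zmat (sqrt 2) ` set octahedral_gens"
    by (simp add: octahedral_gens_def zval_def su2_inject complex_eq_iff cos_45 sin_45
        insert_eq_iff[of "su2 _ _"])
  have car: "SU2_generators E7 \<subseteq> carrier SU2"
    by (auto intro!: su2_in_carrier simp: complex_eq_iff simp flip: power2_eq_square)
  show ?thesis
    using card_generate_zmat[OF _ sqrt2_independent _ octahedral_orbit] car
    unfolding SU2_subgroup_def eq by simp
qed

lemma card_SU2_subgroup_E8: "card (SU2_subgroup E8) = 120"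
proof -
  define \<phi> where "\<phi> = (sqrt 5 + 1) / 2"
  have \<phi>: "\<phi>\<^sup>2 = of_int 1 * \<phi> + of_int 1"
    by (simp add: \<phi>_def power2_eq_square field_simps)
  have eq: "SU2_generators E8 = zmat \<phi> ` set icosahedral_gens"
    by (simp add: icosahedral_gens_def zval_def su2_inject complex_eq_iff \<phi>_def field_simps
        insert_eq_iff[of "su2 _ _"])
  have car: "SU2_generators E8 \<subseteq> carrier SU2"
    by (auto intro!: su2_in_carrier simp: complex_eq_iff field_simps)
  show ?thesis
    using card_generate_zmat[OF \<phi> golden_ratio_independent[folded \<phi>_def] _ icosahedral_orbit] car
    unfolding SU2_subgroup_def eq by simp
qed

section \<open>The cyclic and binary dihedral groups\<close>

lemma su2_power_in_generate:
  assumes "su2 w 0 \<in> S"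
  shows "su2 (w ^ m) 0 \<in> generate SU2 S"
proof (induction m)
  case 0
  show ?case using generate.one[of SU2 S] by (simp add: su2_1)
next
  case (Suc m)
  have "su2 w 0 \<otimes>\<^bsub>SU2\<^esub> su2 (w ^ m) 0 \<in> generate SU2 S"
    by (rule generate.eng[OF generate.incl[OF assms] Suc.IH])
  thus ?case by (simp add: su2_mult)
qed

lemma root_of_unity_eq_power:
  assumes "N > 0" "z ^ N = 1"
  shows "\<exists>m. z = cis (2 * pi / real N) ^ m"
proof -
  have "z \<in> (\<lambda>k. cis (2 * pi * real k / real N)) ` {..<N}"
    using Complex.bij_betw_roots_unity[OF assms(1)] assms(2) by (auto simp: bij_betw_def)
  thus ?thesis
    by (auto simp: Complex.DeMoivre mult_ac)
qed

lemma cis_root_of_unity: "N > 0 \<Longrightarrow> cis (2 * pi / real N) ^ N = 1"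
  unfolding Complex.DeMoivre by simp

lemma card_SU2_subgroup_An: "card (SU2_subgroup (An n)) = n + 1"
proof -
  define w where "w = cis (2 * pi / real (n + 1))"
  define R where "R = {z :: complex. z ^ (n + 1) = 1}"
  have w: "w ^ (n + 1) = 1" unfolding w_def by (rule cis_root_of_unity) simp
  have R: "finite R" "card R = n + 1"
    unfolding R_def by (simp_all add: finite_roots_unity Complex.card_roots_unity_eq del: power_Suc)
  have gens: "SU2_generators (An n) = {su2 w 0}"
    by (simp add: w_def)
  have "SU2_subgroup (An n) = (\<lambda>z. su2 z 0) ` R"
    unfolding SU2_subgroup_def gens
  proof (rule group.generate_eq_of_closed[OF group_SU2])
    show "{su2 w 0} \<subseteq> carrier SU2"
      by (auto intro!: su2_in_carrier simp: w_def cis_cnj cis_mult)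
    show "(\<lambda>z. su2 z 0) ` R \<subseteq> generate SU2 {su2 w 0}"
    proof safe
      fix z assume "z \<in> R"
      then obtain m where "z = w ^ m"
        using root_of_unity_eq_power[of "n + 1" z] by (auto simp: R_def w_def)
      thus "su2 z 0 \<in> generate SU2 {su2 w 0}"
        by (simp add: su2_power_in_generate)
    qed
    show "\<one>\<^bsub>SU2\<^esub> \<in> (\<lambda>z. su2 z 0) ` R"
      using imageI[of 1 R "\<lambda>z. su2 z 0"] by (simp add: su2_1 R_def)
    show "A \<otimes>\<^bsub>SU2\<^esub> B \<in> (\<lambda>z. su2 z 0) ` R" if AB: "A \<in> {su2 w 0}" "B \<in> (\<lambda>z. su2 z 0) ` R" for A B
    proof -
      obtain z where "z \<in> R" "A = su2 w 0" "B = su2 z 0" using AB by blast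
      moreover from this have "w * z \<in> R"
        using w by (simp add: R_def power_mult_distrib del: power_Suc)
      ultimately show ?thesis by (simp add: su2_mult)
    qed
  qed (use R in auto)
  moreover have "inj_on (\<lambda>z. su2 z 0) R"
    by (auto simp: inj_on_def su2_inject)
  ultimately show ?thesis
    by (simp add: card_image R)
qed

text \<open>The group is the disjoint union of the matrices \<open>su2 z 0\<close> and
  \<open>su2 0 z\<close> with z^N = 1, N = 2(n - 2). Left multiplication by \<open>su2 0 1\<close>
  exchanges the two halves through z -> cnj z and z -> - cnj z; the sign stays within the roots of
  unity because N is even.\<close>

lemma card_SU2_subgroup_Dn:
  assumes "n \<ge> 3"
  shows "card (SU2_subgroup (Dn n)) = 4 * (n - 2)"
proof -
  define N where "N = 2 * (n - 2)"
  have N: "N > 0" "even N" using assms by (auto simp: N_def)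
  define w where "w = cis (2 * pi / real N)"
  define R where "R = {z :: complex. z ^ N = 1}"
  define D where "D = (\<lambda>z. su2 z 0) ` R \<union> (\<lambda>z. su2 0 z) ` R"
  have w: "w ^ N = 1" unfolding w_def by (rule cis_root_of_unity[OF N(1)])
  have R: "finite R" "card R = N"
    unfolding R_def using N by (simp_all add: finite_roots_unity Complex.card_roots_unity_eq)
  have one: "1 \<in> R" by (simp add: R_def)
  have mult: "w * z \<in> R" if "z \<in> R" for z
    using that w by (simp add: R_def power_mult_distrib)
  have cnj: "cnj z \<in> R" "- cnj z \<in> R" if "z \<in> R" for z
    using that N by (auto simp: R_def simp flip: complex_cnj_power)
  have "2 * pi / real N = pi / real (n - 2)"
    unfolding N_def of_nat_mult by simp
  hence gens: "SU2_generators (Dn n) = {su2 w 0, su2 0 1}"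
    by (simp only: w_def SU2_generators.simps)
  have "SU2_subgroup (Dn n) = D"
    unfolding SU2_subgroup_def gens
  proof (rule group.generate_eq_of_closed[OF group_SU2])
    show "{su2 w 0, su2 0 1} \<subseteq> carrier SU2"
      by (auto intro!: su2_in_carrier simp: w_def cis_cnj cis_mult)
    have gen: "su2 z 0 \<in> generate SU2 {su2 w 0, su2 0 1}" if z: "z \<in> R" for z
    proof -
      obtain m where "z = w ^ m"
        using root_of_unity_eq_power[OF N(1), of z] z by (auto simp: R_def w_def)
      thus ?thesis by (simp add: su2_power_in_generate)
    qed
    have "su2 0 z \<in> generate SU2 {su2 w 0, su2 0 1}" if z: "z \<in> R" for z
    proof -
      have "su2 z 0 \<otimes>\<^bsub>SU2\<^esub> su2 0 1 \<in> generate SU2 {su2 w 0, su2 0 1}"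
        by (rule generate.eng[OF gen[OF z] generate.incl]) auto
      thus ?thesis by (simp add: su2_mult)
    qed
    with gen show "D \<subseteq> generate SU2 {su2 w 0, su2 0 1}"
      by (auto simp: D_def)
    show "\<one>\<^bsub>SU2\<^esub> \<in> D"
      using imageI[OF one, of "\<lambda>z. su2 z 0"] by (simp add: su2_1 D_def)
    show "A \<otimes>\<^bsub>SU2\<^esub> B \<in> D" if AB: "A \<in> {su2 w 0, su2 0 1}" "B \<in> D" for A B
    proof -
      obtain z where z: "z \<in> R" "B = su2 z 0 \<or> B = su2 0 z" using AB by (auto simp: D_def)
      have "A = su2 w 0 \<or> A = su2 0 1" using AB by auto
      thus ?thesis
        using z(2) imageI[OF mult[OF z(1)], of "\<lambda>z. su2 z 0"] imageI[OF mult[OF z(1)], of "\<lambda>z. su2 0 z"]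
          imageI[OF cnj(1)[OF z(1)], of "\<lambda>z. su2 0 z"] imageI[OF cnj(2)[OF z(1)], of "\<lambda>z. su2 z 0"]
        by (auto simp: su2_mult D_def)
    qed
  qed (use R in \<open>auto simp: D_def\<close>)
  moreover have "card D = card R + card R"
  proof -
    have "0 \<notin> R" using N by (simp add: R_def power_0_left)
    hence "(\<lambda>z. su2 z 0) ` R \<inter> (\<lambda>z. su2 0 z) ` R = {}"
      by (auto simp: su2_inject)
    moreover have "card ((\<lambda>z. su2 z 0) ` R) = card R" "card ((\<lambda>z. su2 0 z) ` R) = card R"
      by (auto intro!: card_image simp: inj_on_def su2_inject)
    ultimately show ?thesis
      unfolding D_def using R by (subst card_Un_disjoint) auto
  qed
  ultimately show ?thesis
    by (simp add: R N_def)
qed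

section \<open>Longest roots and their duals\<close>

lemma form_add_left: "form \<Delta> (\<lambda>i. u i + v i) w = form \<Delta> u w + form \<Delta> v w"
  by (simp add: form_def distrib_right sum.distrib)

lemma form_add_right: "form \<Delta> w (\<lambda>i. u i + v i) = form \<Delta> w u + form \<Delta> w v"
  by (simp add: form_def distrib_left sum.distrib)

lemma form_scale_left: "form \<Delta> (\<lambda>i. a * u i) w = a * form \<Delta> u w"
  by (simp add: form_def sum_distrib_left mult.assoc)

lemma form_scale_right: "form \<Delta> w (\<lambda>i. a * u i) = a * form \<Delta> w u"
  by (simp add: form_def sum_distrib_left mult_ac)

lemma form_diff_left: "form \<Delta> (\<lambda>i. u i - v i) w = form \<Delta> u w - form \<Delta> v w"
  using form_add_left[of \<Delta> u "\<lambda>i. - 1 * v i" w] form_scale_left[of \<Delta> "- 1" v w] by simp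

lemma form_diff_right: "form \<Delta> w (\<lambda>i. u i - v i) = form \<Delta> w u - form \<Delta> w v"
  using form_add_right[of \<Delta> w u "\<lambda>i. - 1 * v i"] form_scale_right[of \<Delta> w "- 1" v] by simp

lemma form_commute: "form \<Delta> u v = form \<Delta> v u"
proof -
  have "cartan \<Delta> i j = cartan \<Delta> j i" for i j by (auto simp: cartan_def)
  hence "form \<Delta> u v = (\<Sum>i=1..ade_rank \<Delta>. \<Sum>j=1..ade_rank \<Delta>. v j * of_int (cartan \<Delta> j i) * u i)"
    by (simp add: form_def mult_ac)
  thus ?thesis by (subst (asm) sum.swap) (simp add: form_def)
qed

lemma form_of_int: "form \<Delta> (\<lambda>i. of_int (u i)) (\<lambda>i. of_int (v i)) = of_int (form \<Delta> u v)"
  by (simp add: form_def)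

lemma form_simple_root:
  assumes "i \<in> {1..ade_rank \<Delta>}"
  shows "form \<Delta> v (simple_root i) = (\<Sum>j=1..ade_rank \<Delta>. v j * of_int (cartan \<Delta> j i))"
proof -
  have "(\<Sum>l=1..ade_rank \<Delta>. v j * of_int (cartan \<Delta> j l) * simple_root i l)
      = v j * of_int (cartan \<Delta> j i)" for j
    using assms by (simp add: simple_root_def if_distrib[of "\<lambda>x. _ * x"] cong: if_cong)
  thus ?thesis by (simp add: form_def)
qed

lemma form_expand:
  "form \<Delta> u v = (\<Sum>i=1..ade_rank \<Delta>. form \<Delta> u (simple_root i) * v i)"
proof -
  have "form \<Delta> u v = (\<Sum>i=1..ade_rank \<Delta>. \<Sum>j=1..ade_rank \<Delta>. u j * of_int (cartan \<Delta> j i) * v i)"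
    unfolding form_def by (rule sum.swap)
  also have "\<dots> = (\<Sum>i=1..ade_rank \<Delta>. form \<Delta> u (simple_root i) * v i)"
    by (intro sum.cong refl) (simp add: form_simple_root sum_distrib_right)
  finally show ?thesis .
qed

lemma form_edges:
  fixes u v :: "nat \<Rightarrow> 'a :: comm_ring_1"
  assumes fin: "finite (dynkin_edges \<Delta>)"
    and E: "\<And>i j. (i, j) \<in> dynkin_edges \<Delta> \<Longrightarrow> 1 \<le> i \<and> i < j \<and> j \<le> ade_rank \<Delta>"
  shows "form \<Delta> u v = 2 * (\<Sum>i=1..ade_rank \<Delta>. u i * v i) -
           (\<Sum>(i, j)\<in>dynkin_edges \<Delta>. u i * v j + u j * v i)"
proof -
  define I where "I = {1..ade_rank \<Delta>}"
  define D where "D = dynkin_edges \<Delta>"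
  have cartan: "of_int (cartan \<Delta> i j) =
      (if j = i then 2 else 0) - (if (i, j) \<in> D then 1 else 0) - (if (j, i) \<in> D then 1 else (0::'a))" for i j
    using E[of i j] E[of j i] by (auto simp: cartan_def D_def)
  have sum_D: "(\<Sum>i\<in>I. \<Sum>j\<in>I. if (i, j) \<in> D then f i j else 0) = (\<Sum>(i, j)\<in>D. f i j)"
    for f :: "nat \<Rightarrow> nat \<Rightarrow> 'a"
  proof -
    have "(\<Sum>(i, j)\<in>D. f i j) = (\<Sum>p\<in>I \<times> I. if p \<in> D then (case p of (i, j) \<Rightarrow> f i j) else 0)"
      using fin E by (subst sum.inter_restrict[symmetric])
        (auto simp: I_def D_def intro!: sum.cong, fastforce+)
    also have "\<dots> = (\<Sum>i\<in>I. \<Sum>j\<in>I. if (i, j) \<in> D then f i j else 0)"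
      unfolding sum.cartesian_product by (intro sum.cong) auto
    finally show ?thesis ..
  qed
  have "form \<Delta> u v = (\<Sum>i\<in>I. \<Sum>j\<in>I. (if j = i then 2 * (u i * v j) else 0) -
      (if (i, j) \<in> D then u i * v j else 0) - (if (j, i) \<in> D then u i * v j else 0))"
    unfolding form_def I_def[symmetric] cartan by (intro sum.cong refl) (auto simp: algebra_simps)
  also have "\<dots> = (\<Sum>i\<in>I. \<Sum>j\<in>I. if j = i then 2 * (u i * v j) else 0) -
      (\<Sum>i\<in>I. \<Sum>j\<in>I. if (i, j) \<in> D then u i * v j else 0) -
      (\<Sum>i\<in>I. \<Sum>j\<in>I. if (j, i) \<in> D then u i * v j else 0)"
    by (simp only: sum_subtractf)
  also have "(\<Sum>i\<in>I. \<Sum>j\<in>I. if (j, i) \<in> D then u i * v j else 0) = (\<Sum>(i, j)\<in>D. u j * v i)"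
    by (subst sum.swap) (rule sum_D)
  also have "(\<Sum>i\<in>I. \<Sum>j\<in>I. if (i, j) \<in> D then u i * v j else 0) = (\<Sum>(i, j)\<in>D. u i * v j)"
    by (rule sum_D)
  also have "(\<Sum>i\<in>I. \<Sum>j\<in>I. if j = i then 2 * (u i * v j) else 0) = 2 * (\<Sum>i\<in>I. u i * v i)"
    by (simp add: I_def sum_distrib_left)
  finally show ?thesis
    by (simp add: I_def D_def case_prod_unfold sum.distrib)
qed

lemma norm_simple_root:
  assumes "i \<in> {1..ade_rank \<Delta>}"
  shows "form \<Delta> (simple_root i) (simple_root i) = (2 :: 'a :: comm_ring_1)"
  using assms unfolding form_simple_root[OF assms]
  by (simp add: simple_root_def if_distrib[of "\<lambda>x. x * _"] cartan_def cong: if_cong)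

lemma roots_in_lattice: "v \<in> roots \<Delta> \<Longrightarrow> v \<in> root_lattice \<Delta>"
  by (induction rule: roots.induct) (auto simp: vectors_def simple_root_def)

lemma norm_root: "v \<in> roots \<Delta> \<Longrightarrow> form \<Delta> v v = 2"
proof (induction rule: roots.induct)
  case (simple i)
  thus ?case by (rule norm_simple_root)
next
  case (reflect v i)
  define a where "a = form \<Delta> v (simple_root i)"
  have "form \<Delta> (\<lambda>j. v j - a * simple_root i j) (\<lambda>j. v j - a * simple_root i j) =
      form \<Delta> v v - a * form \<Delta> v (simple_root i) -
      a * (form \<Delta> (simple_root i) v - a * form \<Delta> (simple_root i) (simple_root i))"
    by (simp only: form_diff_left form_diff_right form_scale_left form_scale_right right_diff_distrib)
  also have "\<dots> = 2"
    using reflect norm_simple_root[OF reflect.hyps(2), where 'a = int] form_commute[of \<Delta> "simple_root i" v]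
    by (simp add: a_def[symmetric] algebra_simps)
  finally show ?case by (simp add: a_def)
qed

section \<open>How the longest root and its dual are identified\<close>

lemma longest_rootI:
  assumes "d \<in> roots \<Delta>" "\<And>v i. v \<in> roots \<Delta> \<Longrightarrow> v i \<le> d i"
  shows "longest_root \<Delta> = d"
  unfolding longest_root_def using assms by (intro the_equality) (auto intro!: antisym ext)

text \<open>Uniqueness comes from definiteness: the difference of two solutions pairs to 0 with all
  simple roots, hence with itself.\<close>

lemma dual_longest_rootI:
  assumes \<zeta>: "\<zeta> \<in> vectors \<Delta>"
    and dual: "\<And>i. i \<in> {1..ade_rank \<Delta>} \<Longrightarrow> form \<Delta> \<zeta> (simple_root i) = of_int (longest_root \<Delta> i)"
    and definite: "\<And>x :: nat \<Rightarrow> rat. x \<in> vectors \<Delta> \<Longrightarrow> form \<Delta> x x = 0 \<Longrightarrow> x = (\<lambda>_. 0)"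
  shows "dual_longest_root \<Delta> = \<zeta>"
  unfolding dual_longest_root_def
proof (rule the_equality)
  fix \<xi> assume \<xi>: "\<xi> \<in> vectors \<Delta> \<and>
      (\<forall>i\<in>{1..ade_rank \<Delta>}. form \<Delta> \<xi> (simple_root i) = rat_of_int (longest_root \<Delta> i))"
  define x where "x = (\<lambda>i. \<xi> i - \<zeta> i)"
  have "form \<Delta> x x = (\<Sum>i=1..ade_rank \<Delta>. form \<Delta> x (simple_root i) * x i)"
    by (rule form_expand)
  also have "\<dots> = 0"
    using \<xi> dual by (intro sum.neutral) (simp add: x_def form_diff_left)
  finally have "x = (\<lambda>_. 0)"
    using \<zeta> \<xi> by (intro definite) (auto simp: x_def vectors_def)
  thus "\<xi> = \<zeta>" by (simp add: x_def fun_eq_iff)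
qed (use \<zeta> dual in auto)

text \<open>Pairing with zeta is the plain dot product with the coordinates of the longest root.
  After expansion of the square, zeta itself survives only in the constant (zeta|zeta) /
  (2k).\<close>

lemma theta_exponent_eq:
  assumes k: "card (SU2_subgroup \<Delta>) = k" "k > 0"
    and dual: "\<And>i. i \<in> {1..ade_rank \<Delta>} \<Longrightarrow>
      form \<Delta> (dual_longest_root \<Delta>) (simple_root i) = of_int (longest_root \<Delta> i)"
  shows "theta_exponent \<Delta> m =
    of_nat k / 2 * of_int (form \<Delta> m m) + of_int (\<Sum>i=1..ade_rank \<Delta>. longest_root \<Delta> i * m i) +
    (\<Sum>i=1..ade_rank \<Delta>. of_int (longest_root \<Delta> i) * dual_longest_root \<Delta> i) / (2 * of_nat k)"
proof -
  define \<zeta> where "\<zeta> = dual_longest_root \<Delta>"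
  define \<mu> where "\<mu> = (\<lambda>i. rat_of_int (m i))"
  define \<kappa> where "\<kappa> = rat_of_nat k"
  have \<kappa>: "\<kappa> \<noteq> 0" using k by (simp add: \<kappa>_def)
  have \<zeta>: "form \<Delta> \<zeta> v = (\<Sum>i=1..ade_rank \<Delta>. of_int (longest_root \<Delta> i) * v i)" for v
    by (subst form_expand) (simp add: dual \<zeta>_def)
  have "theta_exponent \<Delta> m = \<kappa> / 2 * form \<Delta> (\<lambda>i. \<mu> i + 1 / \<kappa> * \<zeta> i) (\<lambda>i. \<mu> i + 1 / \<kappa> * \<zeta> i)"
    by (simp add: theta_exponent_def Let_def k \<kappa>_def \<mu>_def \<zeta>_def)
  also have "\<dots> = \<kappa> / 2 * form \<Delta> \<mu> \<mu> + form \<Delta> \<zeta> \<mu> + form \<Delta> \<zeta> \<zeta> / (2 * \<kappa>)"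
    using \<kappa> unfolding form_add_left form_add_right form_scale_left form_scale_right form_commute[of \<Delta> \<mu> \<zeta>]
    by (simp add: field_simps)
  also have "form \<Delta> \<mu> \<mu> = of_int (form \<Delta> m m)"
    unfolding \<mu>_def by (rule form_of_int)
  also have "form \<Delta> \<zeta> \<mu> = of_int (\<Sum>i=1..ade_rank \<Delta>. longest_root \<Delta> i * m i)"
    by (simp add: \<zeta> \<mu>_def)
  finally show ?thesis
    by (simp add: \<zeta> \<kappa>_def) (simp add: \<zeta>_def)
qed

text \<open>A root that is not dominant is raised by some simple reflection, and heights are bounded.\<close>

lemma root_le_dominant:
  assumes bound: "\<And>v. v \<in> root_lattice \<Delta> \<Longrightarrow> form \<Delta> v v = 2 \<Longrightarrow> (\<Sum>i=1..ade_rank \<Delta>. v i) \<le> B"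
    and dominant: "\<And>v. v \<in> root_lattice \<Delta> \<Longrightarrow> form \<Delta> v v = 2 \<Longrightarrow>
      (\<And>i. i \<in> {1..ade_rank \<Delta>} \<Longrightarrow> form \<Delta> v (simple_root i) \<ge> 0) \<Longrightarrow> v = d"
    and "v \<in> roots \<Delta>"
  shows "d \<in> roots \<Delta> \<and> (\<forall>i. v i \<le> d i)"
  using assms(3)
proof (induction "nat (B - (\<Sum>i=1..ade_rank \<Delta>. v i))" arbitrary: v rule: less_induct)
  case less
  note v = roots_in_lattice[OF less.prems] norm_root[OF less.prems]
  show ?case
  proof (cases "\<forall>i\<in>{1..ade_rank \<Delta>}. form \<Delta> v (simple_root i) \<ge> 0")
    case True
    hence "v = d" using dominant v by blast
    thus ?thesis using less.prems by simp
  next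
    case False
    then obtain i where i: "i \<in> {1..ade_rank \<Delta>}" "form \<Delta> v (simple_root i) < 0" by force
    define a where "a = - form \<Delta> v (simple_root i)"
    define w where "w = (\<lambda>j. v j - form \<Delta> v (simple_root i) * simple_root i j)"
    have w: "w \<in> roots \<Delta>" unfolding w_def by (rule roots.reflect[OF less.prems i(1)])
    have w_eq: "w j = v j + (if j = i then a else 0)" for j
      by (simp add: w_def a_def simple_root_def)
    have "(\<Sum>j=1..ade_rank \<Delta>. w j) = (\<Sum>j=1..ade_rank \<Delta>. v j) + a"
      using i by (simp add: w_eq sum.distrib)
    hence "nat (B - (\<Sum>j=1..ade_rank \<Delta>. w j)) < nat (B - (\<Sum>j=1..ade_rank \<Delta>. v j))"
      using bound[OF roots_in_lattice[OF w] norm_root[OF w]] i(2) by (simp add: a_def)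
    from less.hyps[OF this w] have "d \<in> roots \<Delta>" "\<And>j. w j \<le> d j" by auto
    moreover have "v j \<le> w j" for j using i(2) by (simp add: w_eq a_def)
    ultimately show ?thesis using order.trans by blast
  qed
qed

text \<open>Every root lies below the unique dominant vector of norm 2. A simple root serves as the
  starting point from which reflections reach d, so that d is itself a root.\<close>

lemma longest_root_eq_dominant:
  assumes "\<And>v. v \<in> root_lattice \<Delta> \<Longrightarrow> form \<Delta> v v = 2 \<Longrightarrow> (\<Sum>i=1..ade_rank \<Delta>. v i) \<le> B"
    and "\<And>v. v \<in> root_lattice \<Delta> \<Longrightarrow> form \<Delta> v v = 2 \<Longrightarrow>
      (\<And>i. i \<in> {1..ade_rank \<Delta>} \<Longrightarrow> form \<Delta> v (simple_root i) \<ge> 0) \<Longrightarrow> v = d"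
    and "ade_rank \<Delta> \<ge> 1"
  shows "longest_root \<Delta> = d"
proof -
  have *: "d \<in> roots \<Delta> \<and> (\<forall>i. v i \<le> d i)" if "v \<in> roots \<Delta>" for v
    using assms(1,2) that by (rule root_le_dominant)
  have "simple_root 1 \<in> roots \<Delta>"
    using assms(3) by (intro roots.simple) auto
  with * show ?thesis by (intro longest_rootI) blast+
qed

text \<open>Here \<open>x\<close> is twice the Weyl vector, and the bound is the positivity of \<open>(v - x|v - x)\<close>.\<close>

lemma height_bounded:
  fixes x v :: "nat \<Rightarrow> int"
  assumes pos: "\<And>w :: nat \<Rightarrow> int. form \<Delta> w w \<ge> 0"
    and x: "\<And>i. i \<in> {1..ade_rank \<Delta>} \<Longrightarrow> form \<Delta> x (simple_root i) = 2"
    and v: "form \<Delta> v v = 2"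
  shows "(\<Sum>i=1..ade_rank \<Delta>. v i) \<le> form \<Delta> x x + 2"
proof -
  define h where "h = (\<Sum>i=1..ade_rank \<Delta>. v i)"
  have "form \<Delta> x v = 2 * h"
    by (subst form_expand) (simp add: x h_def sum_distrib_left)
  moreover have "0 \<le> form \<Delta> (\<lambda>i. v i - x i) (\<lambda>i. v i - x i)"
    by (rule pos)
  ultimately have "4 * h \<le> form \<Delta> x x + 2"
    unfolding form_diff_left form_diff_right form_commute[of \<Delta> v x] v by simp
  moreover have "form \<Delta> x x \<ge> 0" by (rule pos)
  ultimately show ?thesis unfolding h_def[symmetric] by linarith
qed

definition vec_of :: "'a :: zero list \<Rightarrow> nat \<Rightarrow> 'a" where
  "vec_of xs i = (if i \<in> {1..length xs} then xs ! (i - 1) else 0)"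

lemma vec_of_in_vectors: "length xs = ade_rank \<Delta> \<Longrightarrow> vec_of xs \<in> vectors \<Delta>"
  by (simp add: vectors_def vec_of_def)

text \<open>For a dominant v of norm 2 and a_i = (v|alpha_i) the sum of the a_i v_i is (v|v) = 2.
  All its terms are nonnegative, so a_j can be positive only where v_j is at most 2.\<close>

lemma dominant_coeff_eq_0:
  fixes a v :: "nat \<Rightarrow> int"
  assumes "(\<Sum>i\<in>I. a i * v i) = 2" "finite I" "\<And>i. i \<in> I \<Longrightarrow> a i \<ge> 0" "\<And>i. i \<in> I \<Longrightarrow> v i \<ge> 0"
    and j: "j \<in> I" "a j \<ge> 1 \<Longrightarrow> v j \<ge> 3"
  shows "a j = 0"
proof (rule ccontr)
  assume "a j \<noteq> 0"
  hence "a j \<ge> 1" using assms(3)[OF j(1)] by linarith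
  hence "1 * 3 \<le> a j * v j" using j(2) by (intro mult_mono) auto
  also have "\<dots> \<le> (\<Sum>i\<in>I. a i * v i)"
    using assms by (intro member_le_sum) auto
  finally show False using assms(1) by simp
qed

section \<open>Type E6\<close>

lemma nodes_E6: "{1..ade_rank E6} = {1, 2, 3, 4, 5, 6}"
  by auto

lemma form_E6:
  fixes u v :: "nat \<Rightarrow> 'a :: comm_ring_1"
  shows "form E6 u v = 2 * (u 1 * v 1 + u 2 * v 2 + u 3 * v 3 + u 4 * v 4 + u 5 * v 5 + u 6 * v 6) -
    (u 1 * v 3 + u 3 * v 1 + u 3 * v 4 + u 4 * v 3 + u 2 * v 4 + u 4 * v 2 + u 4 * v 5 + u 5 * v 4 + u 5 * v 6 + u 6 * v 5)"
proof -
  have "form E6 u v = 2 * (\<Sum>i=1..ade_rank E6. u i * v i) -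
      (\<Sum>(i, j)\<in>dynkin_edges E6. u i * v j + u j * v i)"
    by (rule form_edges) auto
  thus ?thesis
    unfolding nodes_E6 by (simp add: add.assoc)
qed

text \<open>The squares are completed along each branch from its end towards node 4. What remains in
  (v|v) is (1/p + 1/q + 1/r - 1) v_4^2 = (4/k) v_4^2, which is positive; the factor 6 clears
  denominators.\<close>

lemma norm_E6:
  fixes v :: "nat \<Rightarrow> 'a :: comm_ring_1"
  shows "6 * form E6 v v = 3 * (2 * v 1 - v 3)\<^sup>2 + (3 * v 3 - 2 * v 4)\<^sup>2 + 3 * (2 * v 2 - v 4)\<^sup>2 + 3 * (2 * v 6 - v 5)\<^sup>2 + (3 * v 5 - 2 * v 4)\<^sup>2 + (v 4)\<^sup>2"
  unfolding form_E6 by (simp add: power2_eq_square algebra_simps)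

lemma norm_E6_nonneg: "form E6 v v \<ge> (0 :: 'a :: linordered_idom)"
proof -
  have "6 * form E6 v v \<ge> 0"
    unfolding norm_E6 by (intro add_nonneg_nonneg mult_nonneg_nonneg) auto
  thus ?thesis by (simp add: zero_le_mult_iff)
qed

lemma norm_E6_definite:
  fixes v :: "nat \<Rightarrow> 'a :: linordered_field"
  assumes "v \<in> vectors E6" "form E6 v v = 0"
  shows "v = (\<lambda>_. 0)"
proof -
  have "3 * (2 * v 1 - v 3)\<^sup>2 + (3 * v 3 - 2 * v 4)\<^sup>2 + 3 * (2 * v 2 - v 4)\<^sup>2 + 3 * (2 * v 6 - v 5)\<^sup>2 + (3 * v 5 - 2 * v 4)\<^sup>2 + (v 4)\<^sup>2 = 0"
    unfolding norm_E6[symmetric] by (simp add: assms(2))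
  hence "2 * v 1 = v 3 \<and> 3 * v 3 = 2 * v 4 \<and> 2 * v 2 = v 4 \<and> 2 * v 6 = v 5 \<and> 3 * v 5 = 2 * v 4 \<and> v 4 = 0"
    by (simp add: add_nonneg_eq_0_iff add_nonneg_nonneg)
  hence "\<forall>i\<in>{1, 2, 3, 4, 5, 6}. v i = 0"
    by auto
  thus ?thesis
    using assms(1) unfolding vectors_def nodes_E6 by fast
qed

lemma longest_root_E6: "longest_root E6 = vec_of [1, 2, 2, 3, 2, 1]"
proof (rule longest_root_eq_dominant)
  fix v assume v: "v \<in> root_lattice E6" "form E6 v v = 2"
  show "(\<Sum>i=1..ade_rank E6. v i) \<le> form E6 (vec_of [16, 22, 30, 42, 30, 16]) (vec_of [16, 22, 30, 42, 30, 16]) + 2"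
  proof (rule height_bounded[OF norm_E6_nonneg _ v(2)])
    fix i assume "i \<in> {1..ade_rank E6}"
    thus "form E6 (vec_of [16, 22, 30, 42, 30, 16]) (simple_root i) = 2"
      unfolding nodes_E6 form_E6 by (elim insertE emptyE) (simp_all add: vec_of_def simple_root_def)
  qed
  assume dom: "\<And>i. i \<in> {1..ade_rank E6} \<Longrightarrow> form E6 v (simple_root i) \<ge> 0"
  define a where "a i = form E6 v (simple_root i)" for i
  have a: "a 1 = 2 * v 1 - v 3" "a 2 = 2 * v 2 - v 4" "a 3 = 2 * v 3 - v 1 - v 4" 
    "a 4 = 2 * v 4 - v 2 - v 3 - v 5" "a 5 = 2 * v 5 - v 4 - v 6" "a 6 = 2 * v 6 - v 5"
    by (simp_all add: a_def form_E6 simple_root_def)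
  have a0: "a 1 \<ge> 0" "a 2 \<ge> 0" "a 3 \<ge> 0" "a 4 \<ge> 0" "a 5 \<ge> 0" "a 6 \<ge> 0"
    using dom unfolding a_def[symmetric] by simp_all
  have v0: "v 1 \<ge> 0" "v 2 \<ge> 0" "v 3 \<ge> 0" "v 4 \<ge> 0" "v 5 \<ge> 0" "v 6 \<ge> 0"
    using a a0 by linarith+
  have sum: "(\<Sum>i\<in>{1, 2, 3, 4, 5, 6}. a i * v i) = 2"
    using v(2) unfolding form_expand[of E6 v v] a_def[symmetric] nodes_E6 .
  have pos: "\<And>i. i \<in> {1, 2, 3, 4, 5, 6} \<Longrightarrow> a i \<ge> 0" "\<And>i. i \<in> {1, 2, 3, 4, 5, 6} \<Longrightarrow> v i \<ge> 0"
    using a0 v0 by auto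
  note zero = dominant_coeff_eq_0[OF sum _ pos]
  \<comment> \<open>A positive \<open>a j\<close> forces \<open>v j\<close> to be at least the j-th
    diagonal entry of the inverse Cartan matrix. At nodes 3, 4 and 5 it is 10/3, 6 and 10/3.\<close>
  have z: "a 3 = 0" "a 4 = 0" "a 5 = 0"
    by (rule zero; use a a0 v0 in force)+
  have "a 1 * v 1 + a 6 * v 6 + a 2 * v 2 = 2"
    using sum z by simp
  have v16: "3 * v 1 = 4 * a 1 + 3 * a 2 + 2 * a 6" "3 * v 6 = 4 * a 6 + 3 * a 2 + 2 * a 1"
    using a z by linarith+
  \<comment> \<open>At nodes 1 and 6 the diagonal entry is only 4/3, and integrality must help: if
    \<open>a 6 = 0\<close>, then \<open>v16\<close> makes \<open>a 1\<close> divisible by 3, and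
    conversely. This leaves the case where both are positive.\<close>
  have not_both: "\<not> (a 1 \<ge> 1 \<and> a 6 \<ge> 1)"
  proof
    assume *: "a 1 \<ge> 1 \<and> a 6 \<ge> 1"
    hence "v 1 \<ge> 2" "v 6 \<ge> 2" using v16 a0 by linarith+
    hence "1 * 2 \<le> a 1 * v 1" "1 * 2 \<le> a 6 * v 6" "0 \<le> a 2 * v 2"
      using * a0 v0 by (intro mult_mono mult_nonneg_nonneg; simp)+
    thus False using \<open>a 1 * v 1 + a 6 * v 6 + a 2 * v 2 = 2\<close> by simp
  qed
  have "a 1 \<ge> 1 \<Longrightarrow> v 1 \<ge> 3" "a 6 \<ge> 1 \<Longrightarrow> v 6 \<ge> 3"
    using v16 a0 not_both by presburger+
  hence z16: "a 1 = 0" "a 6 = 0"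
    by (intro zero; simp)+
  have eq: "v 1 = 1 * a 2" "v 2 = 2 * a 2" "v 3 = 2 * a 2" "v 4 = 3 * a 2" "v 5 = 2 * a 2" "v 6 = 1 * a 2"
    using a z z16 by linarith+
  have "a 2 * a 2 = 1"
    using sum z z16 eq by simp
  hence "a 2 = 1"
    using a0 by (auto simp: zmult_eq_1_iff)
  note eq = eq[unfolded this]
  show "v = vec_of [1, 2, 2, 3, 2, 1]"
  proof
    fix i
    show "v i = vec_of [1, 2, 2, 3, 2, 1] i"
    proof (cases "i \<in> {1..ade_rank E6}")
      case True
      thus ?thesis unfolding nodes_E6 by (elim insertE emptyE) (simp_all add: vec_of_def eq eq[unfolded One_nat_def])
    qed (use v(1) in \<open>auto simp: vectors_def vec_of_def\<close>)
  qed
qed simp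

text \<open>The witness for zeta solves C zeta = d. The constant (zeta|zeta) / (2k) = 334/48 has the
  form (k (n + 1) - 1) / 24, which it takes in every type.\<close>

lemma theta_exponent_E6:
  "theta_exponent E6 m = 12 * of_int (form E6 m m) +
     of_int (m 1 + 2 * m 2 + 2 * m 3 + 3 * m 4 + 2 * m 5 + m 6) + 167 / 24"
proof -
  have pair: "form E6 (vec_of [16, 23, 31, 44, 31, 16] :: nat \<Rightarrow> rat) (simple_root i) = of_int (longest_root E6 i)"
    if "i \<in> {1..ade_rank E6}" for i
    using that unfolding longest_root_E6 nodes_E6 form_E6
    by (elim insertE emptyE) (simp_all add: vec_of_def simple_root_def)
  have \<zeta>: "dual_longest_root E6 = vec_of [16, 23, 31, 44, 31, 16]"
    by (rule dual_longest_rootI) (auto intro: vec_of_in_vectors pair norm_E6_definite)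
  show ?thesis
    using theta_exponent_eq[OF card_SU2_subgroup_E6 _ pair[folded \<zeta>], of m]
    unfolding \<zeta> longest_root_E6 nodes_E6 by (simp add: vec_of_def)
qed

section \<open>Type E7\<close>

lemma nodes_E7: "{1..ade_rank E7} = {1, 2, 3, 4, 5, 6, 7}"
  by auto

lemma form_E7:
  fixes u v :: "nat \<Rightarrow> 'a :: comm_ring_1"
  shows "form E7 u v = 2 * (u 1 * v 1 + u 2 * v 2 + u 3 * v 3 + u 4 * v 4 + u 5 * v 5 + u 6 * v 6 + u 7 * v 7) -
    (u 1 * v 3 + u 3 * v 1 + u 3 * v 4 + u 4 * v 3 + u 2 * v 4 + u 4 * v 2 + u 4 * v 5 + u 5 * v 4 + u 5 * v 6 + u 6 * v 5 + u 6 * v 7 + u 7 * v 6)"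
proof -
  have "form E7 u v = 2 * (\<Sum>i=1..ade_rank E7. u i * v i) -
      (\<Sum>(i, j)\<in>dynkin_edges E7. u i * v j + u j * v i)"
    by (rule form_edges) auto
  thus ?thesis
    unfolding nodes_E7 by (simp add: add.assoc)
qed

lemma norm_E7:
  fixes v :: "nat \<Rightarrow> 'a :: comm_ring_1"
  shows "12 * form E7 v v = 6 * (2 * v 1 - v 3)\<^sup>2 + 2 * (3 * v 3 - 2 * v 4)\<^sup>2 + 6 * (2 * v 2 - v 4)\<^sup>2 + 6 * (2 * v 7 - v 6)\<^sup>2 + 2 * (3 * v 6 - 2 * v 5)\<^sup>2 + (4 * v 5 - 3 * v 4)\<^sup>2 + (v 4)\<^sup>2"
  unfolding form_E7 by (simp add: power2_eq_square algebra_simps)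

lemma norm_E7_nonneg: "form E7 v v \<ge> (0 :: 'a :: linordered_idom)"
proof -
  have "12 * form E7 v v \<ge> 0"
    unfolding norm_E7 by (intro add_nonneg_nonneg mult_nonneg_nonneg) auto
  thus ?thesis by (simp add: zero_le_mult_iff)
qed

lemma norm_E7_definite:
  fixes v :: "nat \<Rightarrow> 'a :: linordered_field"
  assumes "v \<in> vectors E7" "form E7 v v = 0"
  shows "v = (\<lambda>_. 0)"
proof -
  have "6 * (2 * v 1 - v 3)\<^sup>2 + 2 * (3 * v 3 - 2 * v 4)\<^sup>2 + 6 * (2 * v 2 - v 4)\<^sup>2 + 6 * (2 * v 7 - v 6)\<^sup>2 + 2 * (3 * v 6 - 2 * v 5)\<^sup>2 + (4 * v 5 - 3 * v 4)\<^sup>2 + (v 4)\<^sup>2 = 0"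
    unfolding norm_E7[symmetric] by (simp add: assms(2))
  hence "2 * v 1 = v 3 \<and> 3 * v 3 = 2 * v 4 \<and> 2 * v 2 = v 4 \<and> 2 * v 7 = v 6 \<and> 3 * v 6 = 2 * v 5 \<and> 4 * v 5 = 3 * v 4 \<and> v 4 = 0"
    by (simp add: add_nonneg_eq_0_iff add_nonneg_nonneg)
  hence "\<forall>i\<in>{1, 2, 3, 4, 5, 6, 7}. v i = 0"
    by auto
  thus ?thesis
    using assms(1) unfolding vectors_def nodes_E7 by fast
qed

lemma longest_root_E7: "longest_root E7 = vec_of [2, 2, 3, 4, 3, 2, 1]"
proof (rule longest_root_eq_dominant)
  fix v assume v: "v \<in> root_lattice E7" "form E7 v v = 2"
  show "(\<Sum>i=1..ade_rank E7. v i) \<le> form E7 (vec_of [34, 49, 66, 96, 75, 52, 27]) (vec_of [34, 49, 66, 96, 75, 52, 27]) + 2"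
  proof (rule height_bounded[OF norm_E7_nonneg _ v(2)])
    fix i assume "i \<in> {1..ade_rank E7}"
    thus "form E7 (vec_of [34, 49, 66, 96, 75, 52, 27]) (simple_root i) = 2"
      unfolding nodes_E7 form_E7 by (elim insertE emptyE) (simp_all add: vec_of_def simple_root_def)
  qed
  assume dom: "\<And>i. i \<in> {1..ade_rank E7} \<Longrightarrow> form E7 v (simple_root i) \<ge> 0"
  define a where "a i = form E7 v (simple_root i)" for i
  have a: "a 1 = 2 * v 1 - v 3" "a 2 = 2 * v 2 - v 4" "a 3 = 2 * v 3 - v 1 - v 4" 
    "a 4 = 2 * v 4 - v 2 - v 3 - v 5" "a 5 = 2 * v 5 - v 4 - v 6" "a 6 = 2 * v 6 - v 5 - v 7" 
    "a 7 = 2 * v 7 - v 6"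
    by (simp_all add: a_def form_E7 simple_root_def)
  have a0: "a 1 \<ge> 0" "a 2 \<ge> 0" "a 3 \<ge> 0" "a 4 \<ge> 0" "a 5 \<ge> 0" "a 6 \<ge> 0" "a 7 \<ge> 0"
    using dom unfolding a_def[symmetric] by simp_all
  have v0: "v 1 \<ge> 0" "v 2 \<ge> 0" "v 3 \<ge> 0" "v 4 \<ge> 0" "v 5 \<ge> 0" "v 6 \<ge> 0" "v 7 \<ge> 0"
    using a a0 by linarith+
  have sum: "(\<Sum>i\<in>{1, 2, 3, 4, 5, 6, 7}. a i * v i) = 2"
    using v(2) unfolding form_expand[of E7 v v] a_def[symmetric] nodes_E7 .
  have pos: "\<And>i. i \<in> {1, 2, 3, 4, 5, 6, 7} \<Longrightarrow> a i \<ge> 0" "\<And>i. i \<in> {1, 2, 3, 4, 5, 6, 7} \<Longrightarrow> v i \<ge> 0"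
    using a0 v0 by auto
  note zero = dominant_coeff_eq_0[OF sum _ pos]
  \<comment> \<open>The diagonal entries of the inverse Cartan matrix at nodes 2 to 6 are 7/2, 6,
    12, 15/2 and 4, all above 2.\<close>
  have z: "a 2 = 0" "a 3 = 0" "a 4 = 0" "a 5 = 0" "a 6 = 0"
    by (rule zero; use a a0 v0 in force)+
  have "2 * v 7 = 2 * a 1 + 3 * a 7"
    using a z by linarith
  \<comment> \<open>The preceding relation makes \<open>3 * a 7\<close> even, so a positive
    \<open>a 7\<close> is at least 2.\<close>
  have "a 7 \<ge> 1 \<Longrightarrow> v 7 \<ge> 3"
    using \<open>2 * v 7 = 2 * a 1 + 3 * a 7\<close> a0(1) by presburger
  hence z7: "a 7 = 0"
    by (intro zero; simp)
  have eq: "v 1 = 2 * a 1" "v 2 = 2 * a 1" "v 3 = 3 * a 1" "v 4 = 4 * a 1" "v 5 = 3 * a 1" "v 6 = 2 * a 1" "v 7 = 1 * a 1"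
    using a z z7 by linarith+
  have "a 1 * a 1 = 1"
    using sum z z7 eq by simp
  hence "a 1 = 1"
    using a0 by (auto simp: zmult_eq_1_iff)
  note eq = eq[unfolded this]
  show "v = vec_of [2, 2, 3, 4, 3, 2, 1]"
  proof
    fix i
    show "v i = vec_of [2, 2, 3, 4, 3, 2, 1] i"
    proof (cases "i \<in> {1..ade_rank E7}")
      case True
      thus ?thesis unfolding nodes_E7 by (elim insertE emptyE) (simp_all add: vec_of_def eq eq[unfolded One_nat_def])
    qed (use v(1) in \<open>auto simp: vectors_def vec_of_def\<close>)
  qed
qed simp

lemma theta_exponent_E7:
  "theta_exponent E7 m = 24 * of_int (form E7 m m) +
     of_int (2 * m 1 + 2 * m 2 + 3 * m 3 + 4 * m 4 + 3 * m 5 + 2 * m 6 + m 7) + 383 / 24"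
proof -
  have pair: "form E7 (vec_of [47, 68, 92, 134, 104, 71, 36] :: nat \<Rightarrow> rat) (simple_root i) = of_int (longest_root E7 i)"
    if "i \<in> {1..ade_rank E7}" for i
    using that unfolding longest_root_E7 nodes_E7 form_E7
    by (elim insertE emptyE) (simp_all add: vec_of_def simple_root_def)
  have \<zeta>: "dual_longest_root E7 = vec_of [47, 68, 92, 134, 104, 71, 36]"
    by (rule dual_longest_rootI) (auto intro: vec_of_in_vectors pair norm_E7_definite)
  show ?thesis
    using theta_exponent_eq[OF card_SU2_subgroup_E7 _ pair[folded \<zeta>], of m]
    unfolding \<zeta> longest_root_E7 nodes_E7 by (simp add: vec_of_def)
qed

section \<open>Type E8\<close>

lemma nodes_E8: "{1..ade_rank E8} = {1, 2, 3, 4, 5, 6, 7, 8}"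
  by auto

lemma form_E8:
  fixes u v :: "nat \<Rightarrow> 'a :: comm_ring_1"
  shows "form E8 u v = 2 * (u 1 * v 1 + u 2 * v 2 + u 3 * v 3 + u 4 * v 4 + u 5 * v 5 + u 6 * v 6 + u 7 * v 7 + u 8 * v 8) -
    (u 1 * v 3 + u 3 * v 1 + u 3 * v 4 + u 4 * v 3 + u 2 * v 4 + u 4 * v 2 + u 4 * v 5 + u 5 * v 4 + u 5 * v 6 + u 6 * v 5 + u 6 * v 7 + u 7 * v 6 + u 7 * v 8 + u 8 * v 7)"
proof -
  have "form E8 u v = 2 * (\<Sum>i=1..ade_rank E8. u i * v i) -
      (\<Sum>(i, j)\<in>dynkin_edges E8. u i * v j + u j * v i)"
    by (rule form_edges) auto
  thus ?thesis
    unfolding nodes_E8 by (simp add: add.assoc)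
qed

lemma norm_E8:
  fixes v :: "nat \<Rightarrow> 'a :: comm_ring_1"
  shows "60 * form E8 v v = 30 * (2 * v 1 - v 3)\<^sup>2 + 10 * (3 * v 3 - 2 * v 4)\<^sup>2 + 30 * (2 * v 2 - v 4)\<^sup>2 + 30 * (2 * v 8 - v 7)\<^sup>2 + 10 * (3 * v 7 - 2 * v 6)\<^sup>2 + 5 * (4 * v 6 - 3 * v 5)\<^sup>2 + 3 * (5 * v 5 - 4 * v 4)\<^sup>2 + 2 * (v 4)\<^sup>2"
  unfolding form_E8 by (simp add: power2_eq_square algebra_simps)

lemma norm_E8_nonneg: "form E8 v v \<ge> (0 :: 'a :: linordered_idom)"
proof -
  have "60 * form E8 v v \<ge> 0"
    unfolding norm_E8 by (intro add_nonneg_nonneg mult_nonneg_nonneg) auto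
  thus ?thesis by (simp add: zero_le_mult_iff)
qed

lemma norm_E8_definite:
  fixes v :: "nat \<Rightarrow> 'a :: linordered_field"
  assumes "v \<in> vectors E8" "form E8 v v = 0"
  shows "v = (\<lambda>_. 0)"
proof -
  have "30 * (2 * v 1 - v 3)\<^sup>2 + 10 * (3 * v 3 - 2 * v 4)\<^sup>2 + 30 * (2 * v 2 - v 4)\<^sup>2 + 30 * (2 * v 8 - v 7)\<^sup>2 + 10 * (3 * v 7 - 2 * v 6)\<^sup>2 + 5 * (4 * v 6 - 3 * v 5)\<^sup>2 + 3 * (5 * v 5 - 4 * v 4)\<^sup>2 + 2 * (v 4)\<^sup>2 = 0"
    unfolding norm_E8[symmetric] by (simp add: assms(2))
  hence "2 * v 1 = v 3 \<and> 3 * v 3 = 2 * v 4 \<and> 2 * v 2 = v 4 \<and> 2 * v 8 = v 7 \<and> 3 * v 7 = 2 * v 6 \<and> 4 * v 6 = 3 * v 5 \<and> 5 * v 5 = 4 * v 4 \<and> v 4 = 0"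
    by (simp add: add_nonneg_eq_0_iff add_nonneg_nonneg)
  hence "\<forall>i\<in>{1, 2, 3, 4, 5, 6, 7, 8}. v i = 0"
    by auto
  thus ?thesis
    using assms(1) unfolding vectors_def nodes_E8 by fast
qed

lemma longest_root_E8: "longest_root E8 = vec_of [2, 3, 4, 6, 5, 4, 3, 2]"
proof (rule longest_root_eq_dominant)
  fix v assume v: "v \<in> root_lattice E8" "form E8 v v = 2"
  show "(\<Sum>i=1..ade_rank E8. v i) \<le> form E8 (vec_of [92, 136, 182, 270, 220, 168, 114, 58]) (vec_of [92, 136, 182, 270, 220, 168, 114, 58]) + 2"
  proof (rule height_bounded[OF norm_E8_nonneg _ v(2)])
    fix i assume "i \<in> {1..ade_rank E8}"
    thus "form E8 (vec_of [92, 136, 182, 270, 220, 168, 114, 58]) (simple_root i) = 2"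
      unfolding nodes_E8 form_E8 by (elim insertE emptyE) (simp_all add: vec_of_def simple_root_def)
  qed
  assume dom: "\<And>i. i \<in> {1..ade_rank E8} \<Longrightarrow> form E8 v (simple_root i) \<ge> 0"
  define a where "a i = form E8 v (simple_root i)" for i
  have a: "a 1 = 2 * v 1 - v 3" "a 2 = 2 * v 2 - v 4" "a 3 = 2 * v 3 - v 1 - v 4" 
    "a 4 = 2 * v 4 - v 2 - v 3 - v 5" "a 5 = 2 * v 5 - v 4 - v 6" "a 6 = 2 * v 6 - v 5 - v 7" 
    "a 7 = 2 * v 7 - v 6 - v 8" "a 8 = 2 * v 8 - v 7"
    by (simp_all add: a_def form_E8 simple_root_def)
  have a0: "a 1 \<ge> 0" "a 2 \<ge> 0" "a 3 \<ge> 0" "a 4 \<ge> 0" "a 5 \<ge> 0" "a 6 \<ge> 0" "a 7 \<ge> 0" "a 8 \<ge> 0"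
    using dom unfolding a_def[symmetric] by simp_all
  have v0: "v 1 \<ge> 0" "v 2 \<ge> 0" "v 3 \<ge> 0" "v 4 \<ge> 0" "v 5 \<ge> 0" "v 6 \<ge> 0" "v 7 \<ge> 0" "v 8 \<ge> 0"
    using a a0 by linarith+
  have sum: "(\<Sum>i\<in>{1, 2, 3, 4, 5, 6, 7, 8}. a i * v i) = 2"
    using v(2) unfolding form_expand[of E8 v v] a_def[symmetric] nodes_E8 .
  have pos: "\<And>i. i \<in> {1, 2, 3, 4, 5, 6, 7, 8} \<Longrightarrow> a i \<ge> 0" "\<And>i. i \<in> {1, 2, 3, 4, 5, 6, 7, 8} \<Longrightarrow> v i \<ge> 0"
    using a0 v0 by auto
  note zero = dominant_coeff_eq_0[OF sum _ pos]
  \<comment> \<open>Only node 8, where the extended Dynkin diagram has its extra node attached, has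
    a diagonal entry of the inverse Cartan matrix as small as 2; the next smallest is 4.\<close>
  have z: "a 1 = 0" "a 2 = 0" "a 3 = 0" "a 4 = 0" "a 5 = 0" "a 6 = 0" "a 7 = 0"
    by (rule zero; use a a0 v0 in force)+
  have eq: "v 1 = 2 * a 8" "v 2 = 3 * a 8" "v 3 = 4 * a 8" "v 4 = 6 * a 8" "v 5 = 5 * a 8" "v 6 = 4 * a 8" "v 7 = 3 * a 8" "v 8 = 2 * a 8"
    using a z by linarith+
  have "a 8 * a 8 = 1"
    using sum z eq by simp
  hence "a 8 = 1"
    using a0 by (auto simp: zmult_eq_1_iff)
  note eq = eq[unfolded this]
  show "v = vec_of [2, 3, 4, 6, 5, 4, 3, 2]"
  proof
    fix i
    show "v i = vec_of [2, 3, 4, 6, 5, 4, 3, 2] i"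
    proof (cases "i \<in> {1..ade_rank E8}")
      case True
      thus ?thesis unfolding nodes_E8 by (elim insertE emptyE) (simp_all add: vec_of_def eq eq[unfolded One_nat_def])
    qed (use v(1) in \<open>auto simp: vectors_def vec_of_def\<close>)
  qed
qed simp

lemma theta_exponent_E8:
  "theta_exponent E8 m = 60 * of_int (form E8 m m) +
     of_int (2 * m 1 + 3 * m 2 + 4 * m 3 + 6 * m 4 + 5 * m 5 + 4 * m 6 + 3 * m 7 + 2 * m 8) + 1079 / 24"
proof -
  have pair: "form E8 (vec_of [191, 284, 380, 565, 460, 350, 236, 119] :: nat \<Rightarrow> rat) (simple_root i) = of_int (longest_root E8 i)"
    if "i \<in> {1..ade_rank E8}" for i
    using that unfolding longest_root_E8 nodes_E8 form_E8
    by (elim insertE emptyE) (simp_all add: vec_of_def simple_root_def)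
  have \<zeta>: "dual_longest_root E8 = vec_of [191, 284, 380, 565, 460, 350, 236, 119]"
    by (rule dual_longest_rootI) (auto intro: vec_of_in_vectors pair norm_E8_definite)
  show ?thesis
    using theta_exponent_eq[OF card_SU2_subgroup_E8 _ pair[folded \<zeta>], of m]
    unfolding \<zeta> longest_root_E8 nodes_E8 by (simp add: vec_of_def)
qed

section \<open>Types A and D\<close>

lemma chain_norm:
  fixes v :: "nat \<Rightarrow> 'a :: comm_ring_1"
  assumes "v 0 = 0"
  shows "2 * (\<Sum>i=1..n. v i * v i) - (\<Sum>i=1..<n. v i * v (Suc i) + v (Suc i) * v i) =
           (\<Sum>i<n. (v (Suc i) - v i)\<^sup>2) + (v n)\<^sup>2"
proof (induction n)
  case (Suc n)
  have "(\<Sum>i=1..<Suc n. v i * v (Suc i) + v (Suc i) * v i) =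
      (\<Sum>i=1..<n. v i * v (Suc i) + v (Suc i) * v i) + (v n * v (Suc n) + v (Suc n) * v n)"
    using assms by (cases n) auto
  thus ?case
    using Suc.IH by (simp add: power2_eq_square algebra_simps)
qed (simp add: assms)

lemma dynkin_edges_An: "dynkin_edges (An n) = (\<lambda>i. (i, Suc i)) ` {1..<n}"
  by auto

lemma dynkin_edges_Dn: "dynkin_edges (Dn n) = insert (n - 2, n) ((\<lambda>i. (i, Suc i)) ` {1..<n - 1})"
  by auto

lemma form_An:
  fixes u v :: "nat \<Rightarrow> 'a :: comm_ring_1"
  shows "form (An n) u v = 2 * (\<Sum>i=1..n. u i * v i) - (\<Sum>i=1..<n. u i * v (Suc i) + u (Suc i) * v i)"
proof -
  have "form (An n) u v = 2 * (\<Sum>i=1..ade_rank (An n). u i * v i) -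
      (\<Sum>(i, j)\<in>dynkin_edges (An n). u i * v j + u j * v i)"
    by (rule form_edges) (unfold dynkin_edges_An, auto)
  thus ?thesis
    unfolding dynkin_edges_An by (simp add: sum.reindex inj_on_def)
qed

lemma form_Dn:
  fixes u v :: "nat \<Rightarrow> 'a :: comm_ring_1"
  assumes n: "n \<ge> 3"
  shows "form (Dn n) u v = 2 * (\<Sum>i=1..n. u i * v i) -
           (\<Sum>i=1..<n - 1. u i * v (Suc i) + u (Suc i) * v i) - (u (n - 2) * v n + u n * v (n - 2))"
proof -
  have "form (Dn n) u v = 2 * (\<Sum>i=1..ade_rank (Dn n). u i * v i) -
      (\<Sum>(i, j)\<in>dynkin_edges (Dn n). u i * v j + u j * v i)"
    by (rule form_edges) (unfold dynkin_edges_Dn, use n in auto)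
  moreover have "(n - 2, n) \<notin> (\<lambda>i. (i, Suc i)) ` {1..<n - 1}"
    using n by auto
  ultimately show ?thesis
    unfolding dynkin_edges_Dn by (simp add: sum.reindex inj_on_def algebra_simps)
qed

lemma norm_An:
  fixes v :: "nat \<Rightarrow> 'a :: comm_ring_1"
  assumes "v \<in> vectors (An n)"
  shows "form (An n) v v = (\<Sum>i<Suc n. (v (Suc i) - v i)\<^sup>2)"
  using assms chain_norm[of v n] by (simp add: form_An vectors_def)

text \<open>The squared terms are the standard coordinates in which D_n is the lattice of integral
  vectors with even sum; the last two come from the two end nodes \<open>n - 1\<close> and
  \<open>n\<close> attached to \<open>n - 2\<close>.\<close>

lemma norm_Dn:
  fixes v :: "nat \<Rightarrow> 'a :: comm_ring_1"
  assumes n: "n \<ge> 3" and v: "v \<in> vectors (Dn n)"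
  shows "form (Dn n) v v = (\<Sum>i<n - 2. (v (Suc i) - v i)\<^sup>2) +
           (v n + v (n - 1) - v (n - 2))\<^sup>2 + (v n - v (n - 1))\<^sup>2"
proof -
  obtain N where N: "n = Suc (Suc N)" using n that[of "n - 2"] by simp
  show ?thesis
    using v chain_norm[of v "Suc N"] unfolding form_Dn[OF n]
    by (simp add: N vectors_def power2_eq_square algebra_simps)
qed

lemma pairing_An:
  fixes v :: "nat \<Rightarrow> 'a :: comm_ring_1"
  assumes v: "v \<in> vectors (An n)" and i: "i \<in> {1..n}"
  shows "form (An n) v (simple_root i) = 2 * v i - v (i - 1) - v (Suc i)"
proof -
  have "(\<Sum>j=1..<n. v j * simple_root i (Suc j)) = (\<Sum>j=1..<n. if j = i - 1 then v j else 0)"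
    using i by (intro sum.cong) (auto simp: simple_root_def)
  also have "\<dots> = v (i - 1)"
    using v i by (auto simp: vectors_def)
  finally have 1: "(\<Sum>j=1..<n. v j * simple_root i (Suc j)) = v (i - 1)" .
  have "(\<Sum>j=1..<n. v (Suc j) * simple_root i j) = (\<Sum>j=1..<n. if j = i then v (Suc j) else 0)"
    by (intro sum.cong) (auto simp: simple_root_def)
  also have "\<dots> = v (Suc i)"
    using v i by (auto simp: vectors_def)
  finally have 2: "(\<Sum>j=1..<n. v (Suc j) * simple_root i j) = v (Suc i)" .
  have "(\<Sum>j=1..n. v j * simple_root i j) = (\<Sum>j=1..n. if j = i then v j else 0)"
    by (intro sum.cong) (auto simp: simple_root_def)
  also have "\<dots> = v i" using i by simp
  finally show ?thesis
    unfolding form_An sum.distrib 1 2 by simp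
qed

lemma pairing_Dn:
  fixes v :: "nat \<Rightarrow> 'a :: comm_ring_1"
  assumes n: "n \<ge> 3" and v: "v \<in> vectors (Dn n)" and i: "i \<in> {1..n}"
  shows "form (Dn n) v (simple_root i) =
           2 * v i - (if i < n then v (i - 1) else v (n - 2)) - (if i < n - 1 then v (Suc i) else 0)
           - (if i = n - 2 then v n else 0)"
proof -
  have "(\<Sum>j=1..<n - 1. v j * simple_root i (Suc j)) = (\<Sum>j=1..<n - 1. if j = i - 1 then v j else 0)"
    using i by (intro sum.cong) (auto simp: simple_root_def)
  also have "\<dots> = (if i < n then v (i - 1) else 0)"
    using v i by (auto simp: vectors_def)
  finally have 1: "(\<Sum>j=1..<n - 1. v j * simple_root i (Suc j)) = (if i < n then v (i - 1) else 0)" .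
  have "(\<Sum>j=1..<n - 1. v (Suc j) * simple_root i j) = (\<Sum>j=1..<n - 1. if j = i then v (Suc j) else 0)"
    by (intro sum.cong) (auto simp: simple_root_def)
  also have "\<dots> = (if i < n - 1 then v (Suc i) else 0)"
    using v i by (auto simp: vectors_def)
  finally have 2: "(\<Sum>j=1..<n - 1. v (Suc j) * simple_root i j) = (if i < n - 1 then v (Suc i) else 0)" .
  have "(\<Sum>j=1..n. v j * simple_root i j) = (\<Sum>j=1..n. if j = i then v j else 0)"
    by (intro sum.cong) (auto simp: simple_root_def)
  also have "\<dots> = v i" using i by simp
  finally show ?thesis
    using i n unfolding form_Dn[OF n] sum.distrib 1 2 by (auto simp: simple_root_def)
qed

lemma norm_An_definite:
  fixes v :: "nat \<Rightarrow> 'a :: linordered_field"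
  assumes v: "v \<in> vectors (An n)" "form (An n) v v = 0"
  shows "v = (\<lambda>_. 0)"
proof -
  have step: "v (Suc i) = v i" if "i < Suc n" for i
    using v that unfolding norm_An[OF v(1)] by (subst (asm) sum_nonneg_eq_0_iff) auto
  have "v i = 0" if "i \<le> Suc n" for i
    using that v(1) step by (induction i) (auto simp: vectors_def)
  moreover have "v i = 0" if "\<not> i \<le> Suc n" for i
    using that v(1) by (auto simp: vectors_def)
  ultimately show ?thesis by blast
qed

lemma norm_Dn_definite:
  fixes v :: "nat \<Rightarrow> 'a :: linordered_field"
  assumes n: "n \<ge> 3" and v: "v \<in> vectors (Dn n)" "form (Dn n) v v = 0"
  shows "v = (\<lambda>_. 0)"
proof -
  have "(\<Sum>i<n - 2. (v (Suc i) - v i)\<^sup>2) = 0 \<and> (v n + v (n - 1) - v (n - 2))\<^sup>2 = 0 \<and>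
      (v n - v (n - 1))\<^sup>2 = 0"
    using v(2) unfolding norm_Dn[OF n v(1)]
    by (simp add: add_nonneg_eq_0_iff sum_nonneg add_nonneg_nonneg)
  hence step: "\<And>i. i < n - 2 \<Longrightarrow> v (Suc i) = v i" and last: "v n + v (n - 1) = v (n - 2)" "v n = v (n - 1)"
    by (auto simp: sum_nonneg_eq_0_iff)
  have "v i = 0" if "i \<le> n - 2" for i
    using that v(1) step by (induction i) (auto simp: vectors_def)
  moreover from this last have "v n = 0" "v (n - 1) = 0" by auto
  moreover have "i \<le> n - 2 \<or> i = n - 1 \<or> i = n \<or> i > n" for i by linarith
  moreover have "v i = 0" if "i > n" for i
    using that v(1) by (auto simp: vectors_def)
  ultimately show ?thesis by (intro ext) metis
qed

lemma le_square_int: "x \<le> x\<^sup>2" "- x \<le> x\<^sup>2" for x :: int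
proof -
  have "\<bar>x\<bar> * 1 \<le> \<bar>x\<bar> * \<bar>x\<bar>"
  proof (cases "x = 0")
    case False
    thus ?thesis by (intro mult_left_mono) linarith+
  qed simp
  hence "\<bar>x\<bar> \<le> x\<^sup>2" by (simp add: power2_eq_square)
  thus "x \<le> x\<^sup>2" "- x \<le> x\<^sup>2" by linarith+
qed

text \<open>The entry \<open>v i\<close> is the sum of the differences before i, and, since v
  vanishes at n + 1, minus the sum of those after i. So it is bounded by the sum of squares on
  either side, and the two sums add up to 2.\<close>

lemma norm_2_le_An:
  assumes v: "v \<in> root_lattice (An n)" "form (An n) v v = 2" and "i \<in> {1..n}"
  shows "v i \<le> 1"
proof -
  define e where "e j = v (Suc j) - v j" for j
  have "v i = (\<Sum>j<i. e j)"
    using v(1) sum_lessThan_telescope[of v i] by (simp add: e_def vectors_def)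
  also have "\<dots> \<le> (\<Sum>j<i. (e j)\<^sup>2)"
    by (intro sum_mono le_square_int)
  finally have 1: "v i \<le> (\<Sum>j<i. (e j)\<^sup>2)" .
  have "(\<Sum>j=i..<Suc n. e j) = v (Suc n) - v i"
    unfolding e_def using assms(3) by (intro sum_Suc_diff') auto
  hence "v i = (\<Sum>j=i..<Suc n. - e j)"
    using v(1) by (simp add: vectors_def sum_negf)
  also have "\<dots> \<le> (\<Sum>j=i..<Suc n. (e j)\<^sup>2)"
    by (intro sum_mono le_square_int)
  finally have 2: "v i \<le> (\<Sum>j=i..<Suc n. (e j)\<^sup>2)" .
  have "(\<Sum>j<i. (e j)\<^sup>2) + (\<Sum>j=i..<Suc n. (e j)\<^sup>2) = (\<Sum>j<Suc n. (e j)\<^sup>2)"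
    using assms(3) unfolding lessThan_atLeast0 by (intro sum.atLeastLessThan_concat) auto
  also have "\<dots> = 2"
    using v(2) by (simp only: norm_An[OF v(1)] e_def)
  finally show ?thesis using 1 2 by linarith
qed

lemma interval_root_An:
  assumes "1 \<le> m" "m \<le> n"
  shows "(\<lambda>i. if i \<in> {1..m} then 1 else 0) \<in> roots (An n)"
  using assms
proof (induction m rule: dec_induct)
  case base
  have "simple_root 1 \<in> roots (An n)" using assms by (intro roots.simple) auto
  moreover have "simple_root 1 = (\<lambda>i. if i \<in> {1..1} then 1 else (0 :: int))"
    by (auto simp: simple_root_def)
  ultimately show ?case by simp
next
  case (step m)
  define v where "v = (\<lambda>i. if i \<in> {1..m} then 1 else (0 :: int))"
  have v: "v \<in> roots (An n)" using step unfolding v_def by simp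
  have "form (An n) v (simple_root (Suc m)) = - 1"
    using step by (subst pairing_An[OF roots_in_lattice[OF v]]) (auto simp: v_def)
  hence "(\<lambda>j. v j - - 1 * simple_root (Suc m) j) \<in> roots (An n)"
    using roots.reflect[OF v, of "Suc m"] step by simp
  moreover have "(\<lambda>j. v j - - 1 * simple_root (Suc m) j) = (\<lambda>i. if i \<in> {1..Suc m} then 1 else 0)"
    by (auto simp: v_def simple_root_def)
  ultimately show ?case by simp
qed

lemma longest_root_An:
  assumes "n \<ge> 1"
  shows "longest_root (An n) = (\<lambda>i. if i \<in> {1..n} then 1 else 0)"
proof (rule longest_rootI)
  fix v i assume "v \<in> roots (An n)"
  thus "v i \<le> (if i \<in> {1..n} then 1 else 0)"
    using norm_2_le_An[of v n i] roots_in_lattice[of v "An n"] norm_root[of v "An n"]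
    by (auto simp: vectors_def)
qed (use assms interval_root_An[of n n] in auto)

lemma sum_mult_diff:
  "(\<Sum>i=1..n. of_nat i * (a - of_nat i)) =
     a * (of_nat n * (of_nat n + 1)) / 2 - of_nat n * (of_nat n + 1) * (2 * of_nat n + 1) / (6 :: rat)"
  by (induction n) (simp_all add: field_simps)

lemma theta_exponent_An:
  assumes n: "n \<ge> 1"
  shows "theta_exponent (An n) m =
    of_nat (n + 1) / 2 * of_int (form (An n) m m) + of_int (\<Sum>i=1..n. m i) + of_nat (n * (n + 2)) / 24"
proof -
  \<comment> \<open>All coordinates of the longest root are 1, so zeta is the Weyl vector, with
    coordinates i (n + 1 - i) / 2.\<close>
  define z :: "nat \<Rightarrow> rat" where
    "z i = (if i \<in> {1..n} then of_nat i * (of_nat (n + 1) - of_nat i) / 2 else 0)" for i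
  have z: "z \<in> vectors (An n)" by (auto simp: vectors_def z_def)
  have z_eq: "z i = of_nat i * (of_nat (n + 1) - of_nat i) / 2" if "i \<le> n + 1" for i
    using that by (cases "i = 0 \<or> i = n + 1") (auto simp: z_def)
  have pair: "form (An n) z (simple_root i) = of_int (longest_root (An n) i)"
    if "i \<in> {1..ade_rank (An n)}" for i
  proof -
    have i: "i \<in> {1..n}" using that by simp
    hence "rat_of_nat (i - 1) = of_nat i - 1" by (auto simp: of_nat_diff)
    thus ?thesis
      using i unfolding longest_root_An[OF n]
      by (subst pairing_An[OF z i]) (simp add: z_eq field_simps)
  qed
  have \<zeta>: "dual_longest_root (An n) = z"
    by (rule dual_longest_rootI[OF z pair norm_An_definite])
  have "(\<Sum>i=1..n. z i) = (\<Sum>i=1..n. of_nat i * (of_nat (n + 1) - of_nat i)) / 2"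
    by (simp add: z_eq sum_divide_distrib)
  also have "\<dots> = of_nat n * of_nat (n + 1) * of_nat (n + 2) / 12"
    unfolding sum_mult_diff by (simp add: field_simps)
  finally have "(\<Sum>i=1..n. z i) / (2 * of_nat (n + 1)) = of_nat (n * (n + 2)) / 24"
    by (simp add: divide_simps del: of_nat_Suc) (simp add: algebra_simps)
  thus ?thesis
    using theta_exponent_eq[OF card_SU2_subgroup_An _ pair[folded \<zeta>], of m]
    unfolding \<zeta> longest_root_An[OF n] by simp
qed

text \<open>Partial sums of differences are at most the partial sums of squares, hence at most 2. At
  the last two nodes the bound is halved because \<open>2 * v n = x + y + v (n - 2)\<close>, and
  similarly for \<open>n - 1\<close>; at node 1 it is (v 1)^2 that is at most 2.\<close>

lemma norm_2_le_Dn: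
  assumes n: "n \<ge> 4" and v: "v \<in> root_lattice (Dn n)" "form (Dn n) v v = 2"
  shows "v i \<le> (if i \<in> {2..n - 2} then 2 else if i \<in> {1, n - 1, n} then 1 else 0)"
proof -
  define x where "x = v n + v (n - 1) - v (n - 2)"
  define y where "y = v n - v (n - 1)"
  define S where "S j = (\<Sum>l<j. (v (Suc l) - v l)\<^sup>2)" for j
  have norm: "S (n - 2) + x\<^sup>2 + y\<^sup>2 = 2"
    using n v(2) by (simp add: norm_Dn[OF _ v(1)] S_def x_def y_def)
  have le: "v j \<le> S j" for j
  proof -
    have "v j = (\<Sum>l<j. v (Suc l) - v l)"
      using v(1) sum_lessThan_telescope[of v j] by (simp add: vectors_def)
    also have "\<dots> \<le> S j"
      unfolding S_def by (intro sum_mono le_square_int)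
    finally show ?thesis .
  qed
  have S_mono: "S j \<le> S (n - 2)" if "j \<le> n - 2" for j
    unfolding S_def using that by (intro sum_mono2) auto
  have le2: "v j \<le> 2" if "j \<le> n - 2" for j
    using le[of j] S_mono[OF that] norm zero_le_power2[of x] zero_le_power2[of y] by linarith
  have "2 * v n = x + y + v (n - 2)" "2 * v (n - 1) = x - y + v (n - 2)"
    by (simp_all add: x_def y_def)
  hence last: "v n \<le> 1" "v (n - 1) \<le> 1"
    using le[of "n - 2"] norm le_square_int[of x] le_square_int[of y] by linarith+
  have first: "v 1 \<le> 1"
  proof (rule ccontr)
    assume "\<not> v 1 \<le> 1"
    hence "2 * 2 \<le> v 1 * v 1" by (intro mult_mono) auto
    moreover have "S 1 = v 1 * v 1"
      using v(1) by (simp add: S_def vectors_def power2_eq_square)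
    moreover have "S 1 \<le> S (n - 2)" using n by (intro S_mono) auto
    ultimately show False using norm zero_le_power2[of x] zero_le_power2[of y] by linarith
  qed
  consider "i \<in> {2..n - 2}" | "i = 1" | "i = n - 1" | "i = n" | "i \<notin> {1..n}"
    using n by fastforce
  thus ?thesis
    using le2[of i] first last v(1) n by cases (auto simp: vectors_def)
qed

text \<open>A chain of roots from the sum of all simple roots, at \<open>m = n - 1\<close>, to the
  highest root, at \<open>m = 2\<close>; the reflection in the m-th simple root leads from
  \<open>m + 1\<close> to \<open>m\<close>.\<close>

definition highest_Dn :: "nat \<Rightarrow> nat \<Rightarrow> nat \<Rightarrow> int" where
  "highest_Dn n m = (\<lambda>i. if i \<in> {m..n - 2} then 2 else if i \<in> {1..n} then 1 else 0)"

lemma interval_root_Dn: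
  assumes n: "n \<ge> 4" and "1 \<le> m" "m \<le> n - 1"
  shows "(\<lambda>i. if i \<in> {1..m} then 1 else 0) \<in> roots (Dn n)"
  using assms(2,3)
proof (induction m rule: dec_induct)
  case base
  have "simple_root 1 \<in> roots (Dn n)" using n by (intro roots.simple) auto
  moreover have "simple_root 1 = (\<lambda>i. if i \<in> {1..1} then 1 else (0 :: int))"
    by (auto simp: simple_root_def)
  ultimately show ?case by simp
next
  case (step m)
  define v where "v = (\<lambda>i. if i \<in> {1..m} then 1 else (0 :: int))"
  have v: "v \<in> roots (Dn n)" using step unfolding v_def by simp
  have "form (Dn n) v (simple_root (Suc m)) = - 1"
    using step n by (subst pairing_Dn[OF _ roots_in_lattice[OF v]]) (auto simp: v_def)
  hence "(\<lambda>j. v j - - 1 * simple_root (Suc m) j) \<in> roots (Dn n)"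
    using roots.reflect[OF v, of "Suc m"] step by simp
  moreover have "(\<lambda>j. v j - - 1 * simple_root (Suc m) j) = (\<lambda>i. if i \<in> {1..Suc m} then 1 else 0)"
    by (auto simp: v_def simple_root_def)
  ultimately show ?case by simp
qed

lemma highest_Dn_root:
  assumes n: "n \<ge> 4" and "2 \<le> m" "m \<le> n - 1"
  shows "highest_Dn n m \<in> roots (Dn n)"
  using assms(3,2)
proof (induction m rule: inc_induct)
  case base
  define v where "v = (\<lambda>i. if i \<in> {1..n - 1} then 1 else (0 :: int))"
  have v: "v \<in> roots (Dn n)" using interval_root_Dn[OF n, of "n - 1"] n unfolding v_def by simp
  have "form (Dn n) v (simple_root n) = - 1"
    using n by (subst pairing_Dn[OF _ roots_in_lattice[OF v]]) (auto simp: v_def)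
  hence "(\<lambda>j. v j - - 1 * simple_root n j) \<in> roots (Dn n)"
    using roots.reflect[OF v, of n] n by simp
  moreover have "(\<lambda>j. v j - - 1 * simple_root n j) = highest_Dn n (n - 1)"
    using n by (auto simp: fun_eq_iff v_def highest_Dn_def simple_root_def)
  ultimately show ?case by simp
next
  case (step m)
  define v where "v = highest_Dn n (Suc m)"
  have v: "v \<in> roots (Dn n)" using step unfolding v_def by simp
  have "form (Dn n) v (simple_root m) = - 1"
    using step n by (subst pairing_Dn[OF _ roots_in_lattice[OF v]]) (auto simp: v_def highest_Dn_def)
  hence "(\<lambda>j. v j - - 1 * simple_root m j) \<in> roots (Dn n)"
    using roots.reflect[OF v, of m] step by simp
  moreover have "(\<lambda>j. v j - - 1 * simple_root m j) = highest_Dn n m"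
    using step by (auto simp: fun_eq_iff v_def highest_Dn_def simple_root_def)
  ultimately show ?case by simp
qed

lemma longest_root_Dn:
  assumes n: "n \<ge> 4"
  shows "longest_root (Dn n) = highest_Dn n 2"
proof (rule longest_rootI)
  show "highest_Dn n 2 \<in> roots (Dn n)" by (rule highest_Dn_root) (use n in auto)
  fix v i assume v: "v \<in> roots (Dn n)"
  show "v i \<le> highest_Dn n 2 i"
    using norm_2_le_Dn[OF n roots_in_lattice[OF v] norm_root[OF v], of i] n
    by (auto simp: highest_Dn_def split: if_splits)
qed

lemma sum_highest_Dn:
  fixes m :: "nat \<Rightarrow> 'a :: comm_ring_1"
  assumes n: "n \<ge> 4"
  shows "(\<Sum>i=1..n. of_int (highest_Dn n 2 i) * m i) =
           2 * (\<Sum>i=1..n - 2. m i) - m 1 + m (n - 1) + m n"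
proof -
  obtain N where N: "n = N + 4" using n by (metis add.commute le_Suc_ex)
  have "(\<Sum>i=1..n. of_int (highest_Dn n 2 i) * m i) =
      m 1 + (\<Sum>i=2..n - 2. 2 * m i) + m (n - 1) + m n"
  proof -
    have "{1..n} = insert 1 (insert (n - 1) (insert n {2..n - 2}))"
      using n by auto
    hence "(\<Sum>i=1..n. of_int (highest_Dn n 2 i) * m i) =
        (\<Sum>i\<in>insert 1 (insert (n - 1) (insert n {2..n - 2})). of_int (highest_Dn n 2 i) * m i)"
      by simp
    also have "\<dots> = m 1 + (m (n - 1) + (m n + (\<Sum>i=2..n - 2. of_int (highest_Dn n 2 i) * m i)))"
      using n by (subst sum.insert; simp)+ (auto simp: highest_Dn_def)
    also have "(\<Sum>i=2..n - 2. of_int (highest_Dn n 2 i) * m i) = (\<Sum>i=2..n - 2. 2 * m i)"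
      by (intro sum.cong) (auto simp: highest_Dn_def)
    finally show ?thesis by (simp add: algebra_simps)
  qed
  moreover have "(\<Sum>i=1..n - 2. m i) = m 1 + (\<Sum>i=2..n - 2. m i)"
    using n by (subst sum.atLeast_Suc_atMost) (auto simp: numeral_2_eq_2)
  ultimately show ?thesis
    by (simp add: algebra_simps sum_distrib_left)
qed

lemma theta_exponent_Dn:
  assumes n: "n \<ge> 4"
  shows "theta_exponent (Dn n) m =
    2 * (of_nat n - 2) * of_int (form (Dn n) m m) +
    of_int (2 * (\<Sum>i=1..n - 2. m i) - m 1 + m (n - 1) + m n) +
    (4 * (of_nat n + 1) * (of_nat n - 2) - 1) / 24"
proof -
  define N where "N = rat_of_nat n"
  \<comment> \<open>In the standard coordinates zeta is (2n - 4, 2n - 5, 2n - 7, ..., 3, 1, 0). The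
    entries \<open>z i\<close> with i at most n - 2 are its partial sums; without the exceptional
    first coordinate they would be i (2n - 2 - i).\<close>
  define z :: "nat \<Rightarrow> rat" where
    "z i = (if i \<in> {1..n - 2} then of_nat i * (2 * N - 2 - of_nat i) - 1
            else if i \<in> {n - 1, n} then N * (N - 2) / 2 else 0)" for i
  have N: "of_nat (n - 1) = N - 1" "of_nat (n - 2) = N - 2" "of_nat n = N" "N \<ge> 4"
    using n by (auto simp: N_def of_nat_diff)
  have z: "z \<in> vectors (Dn n)" using n by (auto simp: vectors_def z_def)
  have z_last: "z (n - 1) = N * (N - 2) / 2" "z n = N * (N - 2) / 2" "z (n - 2) = (N - 2) * N - 1"
    using n by (auto simp: z_def N)
  have n2: "2 \<le> n - 2" using n by simp
  have d: "highest_Dn n 2 1 = 1" "highest_Dn n 2 (n - 1) = 1" "highest_Dn n 2 n = 1"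
      "highest_Dn n 2 (n - 2) = 2"
    using n by (auto simp: highest_Dn_def)
  note d = d d(2)[unfolded One_nat_def]
  note z_last' = z_last z_last(1)[unfolded One_nat_def]
  have pair: "form (Dn n) z (simple_root i) = of_int (longest_root (Dn n) i)"
    if "i \<in> {1..ade_rank (Dn n)}" for i
  proof -
    have i: "i \<in> {1..n}" using that by simp
    have p: "form (Dn n) z (simple_root i) =
        2 * z i - (if i < n then z (i - 1) else z (n - 2)) - (if i < n - 1 then z (Suc i) else 0)
           - (if i = n - 2 then z n else 0)"
      using n by (intro pairing_Dn z i) auto
    have z_mid: "z j = of_nat j * (2 * N - 2 - of_nat j) - 1" if "j \<in> {1..n - 2}" for j
      using that by (simp add: z_def)
    have z0: "z 0 = 0" using n by (auto simp: z_def)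
    consider "i = 1" | "2 \<le> i" "i < n - 2" | "i = n - 2" | "i = n - 1" | "i = n"
      using i by fastforce
    thus ?thesis
    proof cases
      case 1
      thus ?thesis unfolding p longest_root_Dn[OF n]
        using n by (simp add: z0) (simp add: z_def highest_Dn_def N field_simps)
    next
      case 2
      have "rat_of_nat (i - 1) = of_nat i - 1" using 2 by (simp add: of_nat_diff)
      moreover have "i - 1 \<in> {1..n - 2}" "i \<in> {1..n - 2}" "Suc i \<in> {1..n - 2}"
        "i < n" "i < n - 1" "i \<noteq> n - 2" "i \<in> {2..n - 2}"
        using 2 by auto
      ultimately show ?thesis
        unfolding p longest_root_Dn[OF n] by (simp add: z_mid highest_Dn_def) (simp add: field_simps)
    next
      case 3
      have "n - 2 - 1 = n - 3" "rat_of_nat (n - 3) = N - 3" "Suc (n - 2) = n - 1"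
        using n by (simp_all add: of_nat_diff N_def)
      moreover have "n - 3 \<in> {1..n - 2}" using n by auto
      from z_mid[OF this] have "z (n - 3) = (N - 3) * (N + 1) - 1"
        unfolding \<open>rat_of_nat (n - 3) = N - 3\<close> by simp
      ultimately show ?thesis unfolding p longest_root_Dn[OF n]
        using 3 n n2 by (simp add: z_last' d) (simp add: field_simps)
    next
      case 4
      have "n - 1 - 1 = n - 2" by simp
      thus ?thesis unfolding p longest_root_Dn[OF n]
        using 4 n n2 by (simp add: z_last' d field_simps) arith
    next
      case 5
      thus ?thesis unfolding p longest_root_Dn[OF n]
        using n n2 by (simp add: z_last' d field_simps) arith
    qed
  qed
  have \<zeta>: "dual_longest_root (Dn n) = z"
    by (rule dual_longest_rootI[OF z pair norm_Dn_definite]) (use n in auto)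
  have "(\<Sum>i=1..n - 2. z i) = (\<Sum>i=1..n - 2. of_nat i * (2 * N - 2 - of_nat i)) - (N - 2)"
    using n by (simp add: z_def sum_subtractf N)
  also have "\<dots> = (N - 2) * (N - 1) * (4 * N - 3) / 6 - (N - 2)"
    unfolding sum_mult_diff N by (simp add: field_simps)
  finally have S: "(\<Sum>i=1..n - 2. z i) = (N - 2) * (N - 1) * (4 * N - 3) / 6 - (N - 2)" .
  have "z 1 = 2 * N - 4" using n2 by (auto simp: z_def)
  hence "2 * (\<Sum>i=1..n - 2. z i) - z 1 + z (n - 1) + z n =
      (N - 2) * (4 * (N + 1) * (N - 2) - 1) / 3"
    unfolding S z_last by (simp add: field_simps)
  hence const: "(\<Sum>i=1..n. of_int (highest_Dn n 2 i) * z i) = (N - 2) * (4 * (N + 1) * (N - 2) - 1) / 3"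
    unfolding sum_highest_Dn[OF n] .
  have int: "(\<Sum>i=1..n. highest_Dn n 2 i * m i) = 2 * (\<Sum>i=1..n - 2. m i) - m 1 + m (n - 1) + m n"
    using sum_highest_Dn[OF n, of m] by simp
  have "theta_exponent (Dn n) m = of_nat (4 * (n - 2)) / 2 * of_int (form (Dn n) m m) +
      of_int (\<Sum>i=1..n. highest_Dn n 2 i * m i) +
      (\<Sum>i=1..n. of_int (highest_Dn n 2 i) * z i) / (2 * of_nat (4 * (n - 2)))"
    using theta_exponent_eq[OF card_SU2_subgroup_Dn _ pair[folded \<zeta>], of m] n
    unfolding \<zeta> longest_root_Dn[OF n] by simp
  also have "of_nat (4 * (n - 2)) / 2 = 2 * (N - 2)"
    by (simp add: N)
  also have "(\<Sum>i=1..n. of_int (highest_Dn n 2 i) * z i) / (2 * of_nat (4 * (n - 2))) =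
      (4 * (N + 1) * (N - 2) - 1) / 24"
  proof -
    define X where "X = 4 * (N + 1) * (N - 2) - 1"
    define M where "M = N - 2"
    have "2 * rat_of_nat (4 * (n - 2)) = 8 * M" by (simp add: N M_def)
    moreover have "M \<noteq> 0" using N(4) by (simp add: M_def)
    ultimately show ?thesis
      unfolding const X_def[symmetric] M_def[symmetric] by simp
  qed
  finally show ?thesis
    by (simp only: int N_def)
qed

section \<open>The theta functions as eta products\<close>

lemma theta_eq_qpow:
  "theta \<Delta> \<tau> = (\<Sum>\<^sub>\<infinity>m\<in>root_lattice \<Delta>. qpow (2 * of_real pi * \<i> * \<tau>) (of_rat (theta_exponent \<Delta> m)))"
proof -
  have "complex_of_rat r = of_real (of_rat r)" for r
    by (cases r) (simp add: of_rat_rat)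
  thus ?thesis
    unfolding theta_def qpow_def by (simp add: mult_ac)
qed

lemma dedekind_eta_eq_qpow:
  "dedekind_eta (of_nat N * \<tau>) =
     qpow (2 * of_real pi * \<i> * \<tau>) (real N / 24) * euler_prod (qpow (2 * of_real pi * \<i> * \<tau>) (real N))"
  unfolding dedekind_eta_def qpow_def euler_prod_def by (simp add: mult_ac)

lemma core_factor_eq:
  "core_factor (c * of_real x) t = euler_prod (qpow c (x * real t)) ^ t / euler_prod (qpow c x)"
  by (simp add: core_factor_def qpow_def mult_ac)

lemma has_sum_imp_theta_eq:
  fixes C :: real
  assumes "((\<lambda>x. qpow (2 * of_real pi * \<i> * \<tau>) (Q x)) has_sum S) T"
    and F: "bij_betw F (root_lattice \<Delta>) T"
    and Q: "\<And>m. m \<in> root_lattice \<Delta> \<Longrightarrow> of_rat (theta_exponent \<Delta> m) = Q (F m) + C"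
  shows "theta \<Delta> \<tau> = S * qpow (2 * of_real pi * \<i> * \<tau>) C"
proof -
  define c where "c = 2 * of_real pi * \<i> * \<tau>"
  have "((\<lambda>m. qpow c (Q (F m))) has_sum S) (root_lattice \<Delta>)"
    using assms(1) has_sum_reindex_bij_betw[OF F, of "\<lambda>x. qpow c (Q x)"] by (simp add: c_def)
  hence "((\<lambda>m. qpow c (Q (F m)) * qpow c C) has_sum S * qpow c C) (root_lattice \<Delta>)"
    by (rule has_sum_cmult_left)
  also have "?this \<longleftrightarrow>
      ((\<lambda>m. qpow c (of_rat (theta_exponent \<Delta> m))) has_sum S * qpow c C) (root_lattice \<Delta>)"
    by (intro has_sum_cong) (simp add: Q qpow_add)
  finally show ?thesis
    unfolding theta_eq_qpow c_def[symmetric] by (simp add: has_sum_iff)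
qed

lemma Re_two_pi_i_mult_neg: "Im \<tau> > 0 \<Longrightarrow> Re (2 * of_real pi * \<i> * \<tau>) < 0"
  by simp

text \<open>The numbers 2E, 2F, 2V are k/p, k/q, k/r for k = 4E. The branches have p - 1, q - 1 and
  r - 1 nodes besides the common one, whence p + q + r = n + 2, the exponent of the eta function in
  the numerator.\<close>

lemma theta_of_star:
  fixes E F V :: nat
  assumes \<tau>: "Im \<tau> > 0"
    and bij: "bij_betw B (root_lattice \<Delta>) (star_set p q r)"
    and Q: "\<And>m. m \<in> root_lattice \<Delta> \<Longrightarrow> of_rat (theta_exponent \<Delta> m) =
      star_exponent (4 * real E) p q r (B m) + (4 * real E * (real (ade_rank \<Delta>) + 1) - 1) / 24"
    and E: "E > 0" "p * (2 * E) = 4 * E" "q * (2 * F) = 4 * E" "r * (2 * V) = 4 * E"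
      "2 * E + 2 * F + 2 * V = 4 * E + 4" "p + q + r = ade_rank \<Delta> + 2"
  shows "theta \<Delta> \<tau> =
    dedekind_eta (2 * \<tau>) ^ 2 * dedekind_eta (4 * of_nat E * \<tau>) ^ (ade_rank \<Delta> + 2) /
      (dedekind_eta \<tau> * dedekind_eta (2 * of_nat E * \<tau>) *
       dedekind_eta (2 * of_nat F * \<tau>) * dedekind_eta (2 * of_nat V * \<tau>))"
proof -
  define c where "c = 2 * of_real pi * \<i> * \<tau>"
  define k where "k = 4 * real E"
  define C where "C = (k * (real (ade_rank \<Delta>) + 1) - 1) / 24"
  define P where "P x = euler_prod (qpow c x)" for x
  have c: "Re c < 0" unfolding c_def by (rule Re_two_pi_i_mult_neg[OF \<tau>])
  have pos: "p > 0" "q > 0" "r > 0" "k > 0"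
    using E by (auto simp: k_def intro!: Nat.gr0I)
  have real: "real p * (2 * real E) = k" "real q * (2 * real F) = k" "real r * (2 * real V) = k"
    using arg_cong[OF E(2), of real] arg_cong[OF E(3), of real] arg_cong[OF E(4), of real]
    by (simp_all add: k_def)
  have div: "k / real p = 2 * real E" "k / real q = 2 * real F" "k / real r = 2 * real V"
    using real pos by (simp_all add: field_simps)
  have "k / real p + k / real q + k / real r = k + 4"
    using arg_cong[OF E(5), of real] unfolding div by (simp add: k_def)
  note star = star_sum[OF c pos this]
  have core: "core_factor (c * of_real x) t = P k ^ t / P x" if "real t * x = k" for x t
    using that by (simp add: core_factor_eq P_def mult.commute)
  have core_2: "core_factor c 2 = P 2 ^ 2 / P 1"
    using core_factor_eq[of c 1 2] by (simp add: P_def)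
  have "((\<lambda>x. qpow c (star_exponent k p q r x)) has_sum
      P k ^ p / P (2 * real E) * (P k ^ q / P (2 * real F)) * (P k ^ r / P (2 * real V)) *
      (P 2 ^ 2 / P 1)) (star_set p q r)"
    using star unfolding div core_2 core[OF real(1)] core[OF real(2)] core[OF real(3)] .
  from has_sum_imp_theta_eq[OF this[unfolded c_def] bij Q[folded k_def]]
  have "theta \<Delta> \<tau> = P k ^ p / P (2 * real E) * (P k ^ q / P (2 * real F)) * (P k ^ r / P (2 * real V)) *
      (P 2 ^ 2 / P 1) * qpow c C"
    by (simp add: c_def C_def)
  also have "\<dots> = P 2 ^ 2 * P k ^ (p + q + r) / (P 1 * P (2 * real E) * P (2 * real F) * P (2 * real V)) * qpow c C"
    by (simp add: power_add mult_ac)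
  also have "qpow c C = qpow c (2 / 24) ^ 2 * qpow c (k / 24) ^ (p + q + r) /
      (qpow c (1 / 24) * qpow c (2 * real E / 24) * qpow c (2 * real F / 24) * qpow c (2 * real V / 24))"
  proof -
    have "2 * real E + 2 * real F + 2 * real V = k + 4" "real (p + q + r) = real (ade_rank \<Delta>) + 2"
      using arg_cong[OF E(5), of real] arg_cong[OF E(6), of real] by (simp_all add: k_def)
    \<comment> \<open>The powers of q in front of the eta products: 4 + k (n + 2) - 1 - (2E + 2F +
      2V) equals k (n + 1) - 1, because 2E + 2F + 2V = k + 4.\<close>
    hence "C = real 2 * (2 / 24) + real (p + q + r) * (k / 24) -
        (1 / 24 + 2 * real E / 24 + 2 * real F / 24 + 2 * real V / 24)"
      by (simp add: C_def field_simps)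
    thus ?thesis
      by (simp only: qpow_diff qpow_add qpow_power)
  qed
  finally have "theta \<Delta> \<tau> = (qpow c (2 / 24) * P 2) ^ 2 * (qpow c (k / 24) * P k) ^ (p + q + r) /
      ((qpow c (1 / 24) * P 1) * (qpow c (2 * real E / 24) * P (2 * real E)) *
       (qpow c (2 * real F / 24) * P (2 * real F)) * (qpow c (2 * real V / 24) * P (2 * real V)))"
    by (simp add: power_mult_distrib mult_ac)
  moreover have eta: "dedekind_eta (of_nat N * \<tau>) = qpow c (real N / 24) * P (real N)" for N
    unfolding c_def P_def by (rule dedekind_eta_eq_qpow)
  ultimately show ?thesis
    using eta[of 1] eta[of 2] eta[of "4 * E"] eta[of "2 * E"] eta[of "2 * F"] eta[of "2 * V"] E(6)
    by (simp add: k_def)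
qed

section \<open>The theta function of type A\<close>

lemma bij_An:
  "bij_betw (\<lambda>m. \<lambda>i\<in>{..<Suc n}. m i - m (Suc i)) (root_lattice (An n)) (int_tuples (Suc n) 0)"
proof (rule bij_betwI[where g = "\<lambda>f i. if i \<in> {1..n} then - (\<Sum>l<i. f l) else 0"])
  show "(\<lambda>m. \<lambda>i\<in>{..<Suc n}. m i - m (Suc i)) \<in> root_lattice (An n) \<rightarrow> int_tuples (Suc n) 0"
  proof
    fix m :: "nat \<Rightarrow> int" assume m: "m \<in> root_lattice (An n)"
    have "(\<Sum>i<Suc n. m i - m (Suc i)) = m 0 - m (Suc n)"
      by (rule sum_lessThan_telescope')
    thus "(\<lambda>i\<in>{..<Suc n}. m i - m (Suc i)) \<in> int_tuples (Suc n) 0"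
      using m by (simp add: int_tuples_def vectors_def del: sum.lessThan_Suc)
  qed
  show "(\<lambda>f i. if i \<in> {1..n} then - (\<Sum>l<i. f l) else 0) \<in> int_tuples (Suc n) 0 \<rightarrow> root_lattice (An n)"
    by (auto simp: vectors_def)
next
  fix m :: "nat \<Rightarrow> int" assume m: "m \<in> root_lattice (An n)"
  have "(\<Sum>l<i. (\<lambda>i\<in>{..<Suc n}. m i - m (Suc i)) l) = m 0 - m i" if "i \<le> n" for i
  proof -
    have "(\<Sum>l<i. (\<lambda>i\<in>{..<Suc n}. m i - m (Suc i)) l) = (\<Sum>l<i. m l - m (Suc l))"
      using that by (intro sum.cong) auto
    thus ?thesis by (simp add: sum_lessThan_telescope')
  qed
  thus "(\<lambda>i. if i \<in> {1..n} then - (\<Sum>l<i. (\<lambda>i\<in>{..<Suc n}. m i - m (Suc i)) l) else 0) = m"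
    using m by (auto simp: vectors_def fun_eq_iff)
next
  fix f assume f: "f \<in> int_tuples (Suc n) 0"
  define m where "m = (\<lambda>i. if i \<in> {1..n} then - (\<Sum>l<i. f l) else 0)"
  \<comment> \<open>The default value 0 at i = 0 and at i = n + 1 agrees with the partial sums, at n
    + 1 because the total of f is 0.\<close>
  have m: "m i = - (\<Sum>l<i. f l)" if "i \<le> Suc n" for i
  proof -
    have "(\<Sum>l<Suc n. f l) = 0" using f by (simp add: int_tuples_def)
    moreover have "i = 0 \<or> i \<in> {1..n} \<or> i = Suc n" using that by auto
    ultimately show ?thesis by (elim disjE) (simp_all add: m_def del: sum.lessThan_Suc)
  qed
  show "(\<lambda>i\<in>{..<Suc n}. m i - m (Suc i)) = f"
  proof
    fix i show "(\<lambda>i\<in>{..<Suc n}. m i - m (Suc i)) i = f i"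
    proof (cases "i < Suc n")
      case True
      thus ?thesis by (simp add: m[of i] m[of "Suc i"])
    next
      case False
      thus ?thesis using f by (auto simp: int_tuples_def PiE_def extensional_def)
    qed
  qed
qed

text \<open>Here zeta is the Weyl vector and k = n + 1, so the exponent is already a
  \<open>core_exponent\<close>, on tuples of sum 0.\<close>

lemma theta_An:
  assumes n: "n \<ge> 1" and \<tau>: "Im \<tau> > 0"
  shows "theta (An n) \<tau> = dedekind_eta (of_nat (n + 1) * \<tau>) ^ (n + 1) / dedekind_eta \<tau>"
proof -
  define c where "c = 2 * of_real pi * \<i> * \<tau>"
  define P where "P x = euler_prod (qpow c x)" for x
  define k where "k = real (n + 1)"
  have c: "Re c < 0" unfolding c_def by (rule Re_two_pi_i_mult_neg[OF \<tau>])
  have "((\<lambda>f. qpow c (core_exponent (Suc n) f)) has_sum P k ^ Suc n / P 1) (int_tuples (Suc n) 0)"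
    using core_sum(2)[OF c, of "Suc n" 0] core_factor_eq[of c 1 "Suc n"]
    by (simp add: P_def k_def add.commute del: power_Suc)
  moreover have "of_rat (theta_exponent (An n) m) =
      core_exponent (Suc n) (\<lambda>i\<in>{..<Suc n}. m i - m (Suc i)) + real (n * (n + 2)) / 24"
    if m: "m \<in> root_lattice (An n)" for m
  proof -
    have "form (An n) m m = (\<Sum>i<Suc n. (m i - m (Suc i))\<^sup>2)"
      unfolding norm_An[OF m] by (intro sum.cong) (auto simp: power2_commute)
    \<comment> \<open>Summation by parts; at l = n + 1 the boundary term vanishes and the pairing
      (zeta|m) remains.\<close>
    moreover have "(\<Sum>i<l. real i * of_int (m i - m (Suc i))) = of_int (\<Sum>i=1..l. m i) - real l * of_int (m l)" for l
      by (induction l) (simp_all add: algebra_simps)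
    from this[of "Suc n"] have "(\<Sum>i<Suc n. real i * of_int (m i - m (Suc i))) = of_int (\<Sum>i=1..n. m i)"
      using m by (simp add: vectors_def del: sum.lessThan_Suc)
    moreover have "core_exponent (Suc n) (\<lambda>i\<in>{..<Suc n}. m i - m (Suc i)) =
        k / 2 * (\<Sum>i<Suc n. (of_int (m i - m (Suc i)))\<^sup>2) + (\<Sum>i<Suc n. real i * of_int (m i - m (Suc i)))"
      unfolding core_exponent_def k_def by simp
    moreover have "of_rat (theta_exponent (An n) m) =
        k / 2 * of_int (form (An n) m m) + of_int (\<Sum>i=1..n. m i) + real (n * (n + 2)) / 24"
      unfolding theta_exponent_An[OF n] k_def
      by (simp add: of_rat_add of_rat_mult of_rat_divide del: of_int_sum)
    ultimately show ?thesis
      by (simp del: sum.lessThan_Suc)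
  qed
  ultimately have "theta (An n) \<tau> = P k ^ Suc n / P 1 * qpow c (real (n * (n + 2)) / 24)"
    unfolding c_def by (rule has_sum_imp_theta_eq[OF _ bij_An])
  also have "real (n * (n + 2)) / 24 = real (Suc n) * (k / 24) - 1 / 24"
    by (simp add: k_def field_simps)
  also have "qpow c \<dots> = qpow c (k / 24) ^ Suc n / qpow c (1 / 24)"
    unfolding qpow_diff qpow_power ..
  also have "P k ^ Suc n / P 1 * \<dots> = (qpow c (k / 24) * P k) ^ Suc n / (qpow c (1 / 24) * P 1)"
    by (simp add: power_mult_distrib mult_ac del: power_Suc)
  also have "qpow c (k / 24) * P k = dedekind_eta (of_nat (n + 1) * \<tau>)"
    unfolding dedekind_eta_eq_qpow c_def P_def k_def ..
  also have "qpow c (1 / 24) * P 1 = dedekind_eta \<tau>"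
    using dedekind_eta_eq_qpow[of 1 \<tau>] by (simp add: c_def P_def)
  finally show ?thesis by simp
qed

section \<open>The theta functions of types E6, E7 and E8\<close>

definition tuple_of :: "int list \<Rightarrow> nat \<Rightarrow> int" where
  "tuple_of xs = (\<lambda>i\<in>{..<length xs}. xs ! i)"

lemma tuple_of_in_int_tuples: "length xs = t \<Longrightarrow> sum_list xs = j \<Longrightarrow> tuple_of xs \<in> int_tuples t j"
  by (auto simp: int_tuples_def tuple_of_def sum_list_sum_nth atLeast0LessThan)

lemma int_tuplesE:
  assumes "f \<in> int_tuples t j"
  obtains xs where "f = tuple_of xs" "length xs = t" "sum_list xs = j"
proof
  show "f = tuple_of (map f [0..<t])"
    using assms by (force simp: int_tuples_def tuple_of_def PiE_def extensional_def)
  show "sum_list (map f [0..<t]) = j"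
    using assms by (simp add: int_tuples_def interv_sum_list_conv_sum_set_nat atLeast0LessThan)
qed simp

lemma core_exponent_tuple_of:
  "core_exponent t (tuple_of xs) = real t / 2 * (\<Sum>i<t. (of_int (xs ! i))\<^sup>2) + (\<Sum>i<t. real i * of_int (xs ! i))"
  if "length xs = t"
  using that by (simp add: core_exponent_def tuple_of_def)

lemma sum_lessThan_numerals:
  "(\<Sum>i<2. f i) = f 0 + f 1" "(\<Sum>i<3. f i) = f 0 + f 1 + f 2"
  "(\<Sum>i<4. f i) = f 0 + f 1 + f 2 + f 3" "(\<Sum>i<5. f i) = f 0 + f 1 + f 2 + f 3 + f (4 :: nat)"
  for f :: "nat \<Rightarrow> 'a :: comm_monoid_add"
  by (simp_all add: eval_nat_numeral)

lemma int_tuples_2E: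
  assumes "f \<in> int_tuples 2 j"
  obtains b where "f = tuple_of [j - b, b]"
proof -
  obtain xs where xs: "f = tuple_of xs" "length xs = 2" "sum_list xs = j"
    using int_tuplesE[OF assms] .
  from xs(2) obtain a b where "xs = [a, b]"
    by (auto simp: eval_nat_numeral length_Suc_conv)
  with xs show ?thesis by (intro that[of b]) auto
qed

lemma int_tuples_3E:
  assumes "f \<in> int_tuples 3 j"
  obtains b c where "f = tuple_of [j - b - c, b, c]"
proof -
  obtain xs where xs: "f = tuple_of xs" "length xs = 3" "sum_list xs = j"
    using int_tuplesE[OF assms] .
  from xs(2) obtain a b c where "xs = [a, b, c]"
    by (auto simp: eval_nat_numeral length_Suc_conv)
  with xs show ?thesis by (intro that[of b c]) auto
qed

lemma int_tuples_4E:
  assumes "f \<in> int_tuples 4 j"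
  obtains b c d where "f = tuple_of [j - b - c - d, b, c, d]"
proof -
  obtain xs where xs: "f = tuple_of xs" "length xs = 4" "sum_list xs = j"
    using int_tuplesE[OF assms] .
  from xs(2) obtain a b c d where "xs = [a, b, c, d]"
    by (auto simp: eval_nat_numeral length_Suc_conv)
  with xs show ?thesis by (intro that[of b c d]) auto
qed

lemma int_tuples_5E:
  assumes "f \<in> int_tuples 5 j"
  obtains b c d e where "f = tuple_of [j - b - c - d - e, b, c, d, e]"
proof -
  obtain xs where xs: "f = tuple_of xs" "length xs = 5" "sum_list xs = j"
    using int_tuplesE[OF assms] .
  from xs(2) obtain a b c d e where "xs = [a, b, c, d, e]"
    by (auto simp: eval_nat_numeral length_Suc_conv)
  with xs show ?thesis by (intro that[of b c d e]) auto
qed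

text \<open>In terms of the encoding by \<open>star_set\<close>, the maps \<open>star_E6\<close>, \<open>star_E7\<close>, \<open>star_E8\<close> are the inverses
  of Weyl group elements that carry the vector \<open>x\<close> with \<open>(x|\<alpha>\<^sub>i) = 1/p, 1/q, 1/r\<close> on the three
  branches and \<open>(x|\<alpha>\<^sub>4) = 3/k - 1\<close> to \<open>\<zeta>/k\<close>. They were found by folding \<open>x\<close> into the
  fundamental alcove.\<close>

definition star_E6 :: "(nat \<Rightarrow> int) \<Rightarrow> int \<times> (nat \<Rightarrow> int) \<times> (nat \<Rightarrow> int) \<times> (nat \<Rightarrow> int)" where
  "star_E6 m =
      (- m 1 + 2 * m 2 + 2 * m 3 - 3 * m 4 + 2 * m 5 - m 6,
       tuple_of [m 2 + m 3 - 2 * m 4 + m 5, - m 1 + m 2 + m 3 - m 4 + m 5 - m 6],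
       tuple_of [- m 1 + m 2 + m 3 - m 4, m 3 - m 4 + m 5 - m 6, m 2 - m 4 + m 5],
       tuple_of [m 2 - m 4 + m 5 - m 6, - m 1 + m 3 - m 4 + m 5, m 2 + m 3 - m 4])"

lemma vec_of_coords_E6: "m \<in> vectors E6 \<Longrightarrow> vec_of [m 1, m 2, m 3, m 4, m 5, m 6] = m"
proof
  fix i assume m: "m \<in> vectors E6"
  show "vec_of [m 1, m 2, m 3, m 4, m 5, m 6] i = m i"
  proof (cases "i \<in> {1..ade_rank E6}")
    case True
    thus ?thesis unfolding nodes_E6 by (elim insertE emptyE) (simp_all add: vec_of_def)
  qed (use m in \<open>auto simp: vectors_def vec_of_def\<close>)
qed

lemma bij_star_E6: "bij_betw star_E6 (root_lattice E6) (star_set 2 3 3)"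
proof (rule bij_betwI)
  \<comment> \<open>The inverse of the linear map. The entries \<open>f 0\<close>,
    \<open>g 0\<close>, \<open>h 0\<close> do not occur, since they are determined by
    \<open>j\<close> and the other entries.\<close>
  let ?m = "\<lambda>(j, f, g, h). vec_of
      [- j + g 1 + g 2 + h 2,
       - j + f 1 + g 2 + h 2,
       - 2 * j + f 1 + g 1 + g 2 + h 1 + 2 * h 2,
       - 3 * j + 2 * f 1 + g 1 + 2 * g 2 + h 1 + 2 * h 2,
       - 2 * j + f 1 + g 1 + 2 * g 2 + h 1 + h 2,
       - j + g 2 + h 1 + h 2]"
  show "star_E6 \<in> root_lattice E6 \<rightarrow> star_set 2 3 3"
    by (auto simp: star_E6_def star_set_def intro!: tuple_of_in_int_tuples)
  show "?m \<in> star_set 2 3 3 \<rightarrow> root_lattice E6"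
    by (auto intro!: vec_of_in_vectors)
  show "?m (star_E6 m) = m" if "m \<in> root_lattice E6" for m
    using vec_of_coords_E6[OF that] by (simp add: star_E6_def tuple_of_def)
  show "star_E6 (?m x) = x" if mem: "x \<in> star_set 2 3 3" for x
  proof -
    obtain j f g h where x: "x = (j, f, g, h)"
      and fgh: "f \<in> int_tuples 2 j" "g \<in> int_tuples 3 j" "h \<in> int_tuples 3 j"
      using mem by (auto simp: star_set_def)
    obtain f1 where f: "f = tuple_of [j - f1, f1]"
      using fgh(1) by (rule int_tuples_2E)
    obtain g1 g2 where g: "g = tuple_of [j - g1 - g2, g1, g2]"
      using fgh(2) by (rule int_tuples_3E)
    obtain h1 h2 where h: "h = tuple_of [j - h1 - h2, h1, h2]"
      using fgh(3) by (rule int_tuples_3E)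
    show ?thesis
      by (simp add: x f g h star_E6_def tuple_of_def vec_of_def algebra_simps)
  qed
qed

text \<open>A polynomial identity in the six coordinates. It contains both facts about the Weyl
  group element, that it preserves the form and that it matches the two shifts.\<close>

lemma theta_exponent_star_E6:
  "of_rat (theta_exponent E6 m) =
     star_exponent (4 * real 6) 2 3 3 (star_E6 m) + (4 * real 6 * (real (ade_rank E6) + 1) - 1) / 24"
  unfolding theta_exponent_E6 form_E6
  by (simp add: star_E6_def star_exponent_def core_exponent_tuple_of of_rat_add of_rat_mult of_rat_divide
      of_rat_diff sum_lessThan_numerals power2_eq_square field_simps)

lemma theta_E6:
  assumes "Im \<tau> > 0"
  shows "theta E6 \<tau> =
    dedekind_eta (2 * \<tau>) ^ 2 * dedekind_eta (4 * of_nat 6 * \<tau>) ^ (ade_rank E6 + 2) /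
      (dedekind_eta \<tau> * dedekind_eta (2 * of_nat 6 * \<tau>) *
       dedekind_eta (2 * of_nat 4 * \<tau>) * dedekind_eta (2 * of_nat 4 * \<tau>))"
  by (rule theta_of_star[OF assms bij_star_E6 theta_exponent_star_E6]) auto

definition star_E7 :: "(nat \<Rightarrow> int) \<Rightarrow> int \<times> (nat \<Rightarrow> int) \<times> (nat \<Rightarrow> int) \<times> (nat \<Rightarrow> int)" where
  "star_E7 m =
      (2 * m 1 - 2 * m 2 - 3 * m 3 + 4 * m 4 - 3 * m 5 + 2 * m 6 - m 7,
       tuple_of [m 1 - m 2 - 2 * m 3 + 2 * m 4 - m 5 + m 6 - m 7, m 1 - m 2 - m 3 + 2 * m 4 - 2 * m 5 + m 6],
       tuple_of [m 1 - m 2 - m 3 + m 4 - m 5 + m 6, - m 2 - m 3 + 2 * m 4 - m 5, m 1 - m 3 + m 4 - m 5 + m 6 - m 7],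
       tuple_of [m 1 - m 3 + m 4 - m 5, - m 2 + m 4 - m 5 + m 6 - m 7, - m 3 + m 4 - m 5 + m 6, m 1 - m 2 - m 3 + m 4])"

lemma vec_of_coords_E7: "m \<in> vectors E7 \<Longrightarrow> vec_of [m 1, m 2, m 3, m 4, m 5, m 6, m 7] = m"
proof
  fix i assume m: "m \<in> vectors E7"
  show "vec_of [m 1, m 2, m 3, m 4, m 5, m 6, m 7] i = m i"
  proof (cases "i \<in> {1..ade_rank E7}")
    case True
    thus ?thesis unfolding nodes_E7 by (elim insertE emptyE) (simp_all add: vec_of_def)
  qed (use m in \<open>auto simp: vectors_def vec_of_def\<close>)
qed

lemma bij_star_E7: "bij_betw star_E7 (root_lattice E7) (star_set 2 3 4)"
proof (rule bij_betwI)
  let ?m = "\<lambda>(j, f, g, h). vec_of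
      [- j + f 1 + g 2 + h 3,
       - 2 * j + f 1 + g 1 + 2 * g 2 + h 2 + h 3,
       - 3 * j + 2 * f 1 + g 1 + 2 * g 2 + h 1 + h 2 + 2 * h 3,
       - 4 * j + 2 * f 1 + 2 * g 1 + 3 * g 2 + h 1 + 2 * h 2 + 3 * h 3,
       - 3 * j + f 1 + g 1 + 2 * g 2 + h 1 + 2 * h 2 + 3 * h 3,
       - 2 * j + f 1 + g 2 + h 1 + 2 * h 2 + 2 * h 3,
       - j + f 1 + h 2 + h 3]"
  show "star_E7 \<in> root_lattice E7 \<rightarrow> star_set 2 3 4"
    by (auto simp: star_E7_def star_set_def intro!: tuple_of_in_int_tuples)
  show "?m \<in> star_set 2 3 4 \<rightarrow> root_lattice E7"
    by (auto intro!: vec_of_in_vectors)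
  show "?m (star_E7 m) = m" if "m \<in> root_lattice E7" for m
    using vec_of_coords_E7[OF that] by (simp add: star_E7_def tuple_of_def)
  show "star_E7 (?m x) = x" if mem: "x \<in> star_set 2 3 4" for x
  proof -
    obtain j f g h where x: "x = (j, f, g, h)"
      and fgh: "f \<in> int_tuples 2 j" "g \<in> int_tuples 3 j" "h \<in> int_tuples 4 j"
      using mem by (auto simp: star_set_def)
    obtain f1 where f: "f = tuple_of [j - f1, f1]"
      using fgh(1) by (rule int_tuples_2E)
    obtain g1 g2 where g: "g = tuple_of [j - g1 - g2, g1, g2]"
      using fgh(2) by (rule int_tuples_3E)
    obtain h1 h2 h3 where h: "h = tuple_of [j - h1 - h2 - h3, h1, h2, h3]"
      using fgh(3) by (rule int_tuples_4E)
    show ?thesis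
      by (simp add: x f g h star_E7_def tuple_of_def vec_of_def algebra_simps)
  qed
qed

lemma theta_exponent_star_E7:
  "of_rat (theta_exponent E7 m) =
     star_exponent (4 * real 12) 2 3 4 (star_E7 m) + (4 * real 12 * (real (ade_rank E7) + 1) - 1) / 24"
  unfolding theta_exponent_E7 form_E7
  by (simp add: star_E7_def star_exponent_def core_exponent_tuple_of of_rat_add of_rat_mult of_rat_divide
      of_rat_diff sum_lessThan_numerals power2_eq_square field_simps)

lemma theta_E7:
  assumes "Im \<tau> > 0"
  shows "theta E7 \<tau> =
    dedekind_eta (2 * \<tau>) ^ 2 * dedekind_eta (4 * of_nat 12 * \<tau>) ^ (ade_rank E7 + 2) /
      (dedekind_eta \<tau> * dedekind_eta (2 * of_nat 12 * \<tau>) *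
       dedekind_eta (2 * of_nat 8 * \<tau>) * dedekind_eta (2 * of_nat 6 * \<tau>))"
  by (rule theta_of_star[OF assms bij_star_E7 theta_exponent_star_E7]) auto

definition star_E8 :: "(nat \<Rightarrow> int) \<Rightarrow> int \<times> (nat \<Rightarrow> int) \<times> (nat \<Rightarrow> int) \<times> (nat \<Rightarrow> int)" where
  "star_E8 m =
      (2 * m 1 - 3 * m 2 - 4 * m 3 + 6 * m 4 - 5 * m 5 + 4 * m 6 - 3 * m 7 + 2 * m 8,
       tuple_of [m 1 - 2 * m 2 - 2 * m 3 + 3 * m 4 - 2 * m 5 + 2 * m 6 - 2 * m 7 + m 8, m 1 - m 2 - 2 * m 3 + 3 * m 4 - 3 * m 5 + 2 * m 6 - m 7 + m 8],
       tuple_of [m 1 - m 2 - m 3 + 2 * m 4 - 2 * m 5 + m 6 - m 7 + m 8, - m 2 - m 3 + 2 * m 4 - 2 * m 5 + 2 * m 6 - m 7, m 1 - m 2 - 2 * m 3 + 2 * m 4 - m 5 + m 6 - m 7 + m 8],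
       tuple_of [- m 3 + m 4 - m 5 + m 6 - m 7 + m 8, m 1 - m 2 - m 3 + m 4 - m 5 + m 6, - m 2 - m 3 + 2 * m 4 - m 5, m 1 - m 3 + m 4 - m 5 + m 6 - m 7, - m 2 + m 4 - m 5 + m 6 - m 7 + m 8])"

lemma vec_of_coords_E8: "m \<in> vectors E8 \<Longrightarrow> vec_of [m 1, m 2, m 3, m 4, m 5, m 6, m 7, m 8] = m"
proof
  fix i assume m: "m \<in> vectors E8"
  show "vec_of [m 1, m 2, m 3, m 4, m 5, m 6, m 7, m 8] i = m i"
  proof (cases "i \<in> {1..ade_rank E8}")
    case True
    thus ?thesis unfolding nodes_E8 by (elim insertE emptyE) (simp_all add: vec_of_def)
  qed (use m in \<open>auto simp: vectors_def vec_of_def\<close>)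
qed

lemma bij_star_E8: "bij_betw star_E8 (root_lattice E8) (star_set 2 3 5)"
proof (rule bij_betwI)
  let ?m = "\<lambda>(j, f, g, h). vec_of
      [- 2 * j + f 1 + g 2 + h 1 + h 2 + 2 * h 3 + 2 * h 4,
       - 3 * j + 2 * f 1 + g 1 + 2 * g 2 + h 2 + 2 * h 3 + 2 * h 4,
       - 4 * j + 2 * f 1 + g 1 + 2 * g 2 + h 1 + 2 * h 2 + 3 * h 3 + 4 * h 4,
       - 6 * j + 3 * f 1 + 2 * g 1 + 4 * g 2 + h 1 + 3 * h 2 + 4 * h 3 + 5 * h 4,
       - 5 * j + 2 * f 1 + 2 * g 1 + 4 * g 2 + h 1 + 2 * h 2 + 3 * h 3 + 4 * h 4,
       - 4 * j + 2 * f 1 + 2 * g 1 + 3 * g 2 + h 1 + h 2 + 2 * h 3 + 3 * h 4,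
       - 3 * j + 2 * f 1 + g 1 + 2 * g 2 + h 1 + h 2 + h 3 + 2 * h 4,
       - j + f 1 + g 2 + h 4]"
  show "star_E8 \<in> root_lattice E8 \<rightarrow> star_set 2 3 5"
    by (auto simp: star_E8_def star_set_def intro!: tuple_of_in_int_tuples)
  show "?m \<in> star_set 2 3 5 \<rightarrow> root_lattice E8"
    by (auto intro!: vec_of_in_vectors)
  show "?m (star_E8 m) = m" if "m \<in> root_lattice E8" for m
    using vec_of_coords_E8[OF that] by (simp add: star_E8_def tuple_of_def)
  show "star_E8 (?m x) = x" if mem: "x \<in> star_set 2 3 5" for x
  proof -
    obtain j f g h where x: "x = (j, f, g, h)"
      and fgh: "f \<in> int_tuples 2 j" "g \<in> int_tuples 3 j" "h \<in> int_tuples 5 j"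
      using mem by (auto simp: star_set_def)
    obtain f1 where f: "f = tuple_of [j - f1, f1]"
      using fgh(1) by (rule int_tuples_2E)
    obtain g1 g2 where g: "g = tuple_of [j - g1 - g2, g1, g2]"
      using fgh(2) by (rule int_tuples_3E)
    obtain h1 h2 h3 h4 where h: "h = tuple_of [j - h1 - h2 - h3 - h4, h1, h2, h3, h4]"
      using fgh(3) by (rule int_tuples_5E)
    show ?thesis
      by (simp add: x f g h star_E8_def tuple_of_def vec_of_def algebra_simps)
  qed
qed

lemma theta_exponent_star_E8:
  "of_rat (theta_exponent E8 m) =
     star_exponent (4 * real 30) 2 3 5 (star_E8 m) + (4 * real 30 * (real (ade_rank E8) + 1) - 1) / 24"
  unfolding theta_exponent_E8 form_E8
  by (simp add: star_E8_def star_exponent_def core_exponent_tuple_of of_rat_add of_rat_mult of_rat_divide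
      of_rat_diff sum_lessThan_numerals power2_eq_square field_simps)

lemma theta_E8:
  assumes "Im \<tau> > 0"
  shows "theta E8 \<tau> =
    dedekind_eta (2 * \<tau>) ^ 2 * dedekind_eta (4 * of_nat 30 * \<tau>) ^ (ade_rank E8 + 2) /
      (dedekind_eta \<tau> * dedekind_eta (2 * of_nat 30 * \<tau>) *
       dedekind_eta (2 * of_nat 20 * \<tau>) * dedekind_eta (2 * of_nat 12 * \<tau>))"
  by (rule theta_of_star[OF assms bij_star_E8 theta_exponent_star_E8]) auto

section \<open>The theta function of type D\<close>

text \<open>These coordinates identify the root lattice with the vectors of even coordinate sum in \<open>\<int>\<^sup>n\<close>.\<close>

definition coord_Dn :: "nat \<Rightarrow> (nat \<Rightarrow> int) \<Rightarrow> nat \<Rightarrow> int" where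
  "coord_Dn n m l = (if l \<in> {1..n - 2} then m l - m (l - 1)
     else if l = n - 1 then m (n - 1) + m n - m (n - 2)
     else if l = n then m n - m (n - 1) else 0)"

definition even_lattice :: "nat \<Rightarrow> (nat \<Rightarrow> int) set" where
  "even_lattice n = {e. (\<forall>l. l \<notin> {1..n} \<longrightarrow> e l = 0) \<and> even (\<Sum>l=1..n. e l)}"

lemma sum_atLeast1_split_last_two:
  fixes e :: "nat \<Rightarrow> 'a :: comm_monoid_add"
  assumes "n \<ge> 4"
  shows "(\<Sum>l=1..n. e l) = (\<Sum>l=1..n - 2. e l) + e (n - 1) + e n"
    and "(\<Sum>l=1..n. e l) = e 1 + (\<Sum>l=2..n - 1. e l) + e n"
proof -
  obtain k where n: "n = Suc (Suc (Suc k))"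
    using assms that[of "n - 3"] by simp
  show "(\<Sum>l=1..n. e l) = (\<Sum>l=1..n - 2. e l) + e (n - 1) + e n"
    by (simp add: n)
  have "(\<Sum>l=1..n - 1. e l) = e 1 + (\<Sum>l=2..n - 1. e l)"
    by (subst sum.atLeast_Suc_atMost) (simp_all add: n numeral_2_eq_2)
  thus "(\<Sum>l=1..n. e l) = e 1 + (\<Sum>l=2..n - 1. e l) + e n"
    by (simp add: n)
qed

lemma sum_coord_Dn:
  assumes "n \<ge> 4" "m \<in> root_lattice (Dn n)" "i \<le> n - 2"
  shows "(\<Sum>l=1..i. coord_Dn n m l) = m i"
  using assms(3)
proof (induction i)
  case 0
  thus ?case using assms by (simp add: vectors_def)
next
  case (Suc i)
  thus ?case by (simp add: coord_Dn_def)
qed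

lemma bij_coord_Dn:
  assumes n: "n \<ge> 4"
  shows "bij_betw (coord_Dn n) (root_lattice (Dn n)) (even_lattice n)"
proof (rule bij_betwI)
  let ?g = "\<lambda>e i. if i \<in> {1..n - 2} then \<Sum>l=1..i. e l
     else if i = n - 1 then ((\<Sum>l=1..n. e l) - 2 * e n) div 2
     else if i = n then (\<Sum>l=1..n. e l) div 2 else (0 :: int)"
  have last: "coord_Dn n m (n - 1) = m (n - 1) + m n - m (n - 2)" "coord_Dn n m n = m n - m (n - 1)" for m
    using n by (auto simp: coord_Dn_def)
  have sum: "(\<Sum>l=1..n. coord_Dn n m l) = 2 * m n" if "m \<in> root_lattice (Dn n)" for m
    using sum_coord_Dn[OF n that, of "n - 2"]
    unfolding sum_atLeast1_split_last_two(1)[OF n] last by simp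
  show "coord_Dn n \<in> root_lattice (Dn n) \<rightarrow> even_lattice n"
    using n sum by (auto simp: even_lattice_def) (auto simp: coord_Dn_def)
  show "?g \<in> even_lattice n \<rightarrow> root_lattice (Dn n)"
    using n by (auto simp: vectors_def)
  show "?g (coord_Dn n m) = m" if m: "m \<in> root_lattice (Dn n)" for m
  proof
    fix i
    have "i \<in> {1..n - 2} \<or> i = n - 1 \<or> i = n \<or> i \<notin> {1..n}" by auto
    thus "?g (coord_Dn n m) i = m i"
      using n m sum_coord_Dn[OF n m, of i] unfolding sum[OF m] last by (auto simp: vectors_def)
  qed
  show "coord_Dn n (?g e) = e" if e: "e \<in> even_lattice n" for e
  proof
    fix l
    define S where "S = (\<Sum>l=1..n. e l)"
    have S: "S = (\<Sum>l=1..n - 2. e l) + e (n - 1) + e n"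
      using sum_atLeast1_split_last_two(1)[OF n, of e] by (simp add: S_def)
    have "even S" using e by (simp add: S_def even_lattice_def)
    then obtain s where s: "S = 2 * s" by (elim evenE)
    have half: "(S - 2 * e n) div 2 = s - e n" "S div 2 = s" by (simp_all add: s)
    have g: "?g e (n - 1) = (S - 2 * e n) div 2" "?g e n = S div 2" "?g e (n - 2) = (\<Sum>l=1..n - 2. e l)"
      using n by (auto simp: S_def)
    have g_le: "?g e i = (\<Sum>l=1..i. e l)" if "i \<le> n - 2" for i
      using that n by auto
    consider "l \<in> {1..n - 2}" | "l = n - 1" | "l = n" | "l \<notin> {1..n}" by fastforce
    thus "coord_Dn n (?g e) l = e l"
    proof cases
      case 1
      then obtain i where i: "l = Suc i" by (cases l) auto
      have "coord_Dn n (?g e) l = ?g e l - ?g e (l - 1)"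
        using 1 unfolding coord_Dn_def by simp
      also have "\<dots> = e l"
        using 1 g_le[of l] g_le[of i] by (simp only: i diff_Suc_1) (simp add: i)
      finally show ?thesis .
    next
      case 2
      show ?thesis
        unfolding 2 last g half using S s by linarith
    next
      case 3
      show ?thesis
        unfolding 3 last g half by linarith
    next
      case 4
      hence "l \<notin> {1..n - 2}" "l \<noteq> n - 1" "l \<noteq> n" using n by auto
      hence "coord_Dn n (?g e) l = 0" by (simp only: coord_Dn_def if_False)
      moreover have "e l = 0" using 4 e by (simp add: even_lattice_def)
      ultimately show ?thesis by simp
    qed
  qed
qed

text \<open>The signed permutation matching the coordinates \<open>2(n - l) - 1\<close> of \<open>\<zeta>\<close>, for
  \<open>2 \<le> l \<le> n - 1\<close>, with the arithmetic progression \<open>4 i + 3 - 2 N\<close>, for \<open>i < N = n - 2\<close>.\<close>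

definition perm_Dn :: "nat \<Rightarrow> nat \<Rightarrow> nat" where
  "perm_Dn N i = (if N \<le> 2 * i + 1 then 2 * N - 2 * i else 2 * i + 3)"

text \<open>Parity separates the two cases of \<open>perm_Dn\<close>: even values carry the sign 1,
  odd ones the sign -1.\<close>

definition perm_inv_Dn :: "nat \<Rightarrow> nat \<Rightarrow> nat" where
  "perm_inv_Dn N l = (if even l then N - l div 2 else (l - 3) div 2)"

definition sign_Dn :: "nat \<Rightarrow> nat \<Rightarrow> int" where
  "sign_Dn N i = (if N \<le> 2 * i + 1 then 1 else - 1)"

text \<open>With these signs the odd numbers 1, 3, ..., 2N - 1 form a single progression of step 4.
  This is the slope k / (n - 2) that \<open>star_exponent\<close> prescribes on the long
  branch.\<close>

lemma perm_Dn:
  assumes "i < N"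
  shows "perm_Dn N i \<in> {2..N + 1}" "perm_inv_Dn N (perm_Dn N i) = i"
    "sign_Dn N i = (if even (perm_Dn N i) then 1 else - 1)"
    "sign_Dn N i * (2 * (int N + 2 - int (perm_Dn N i)) - 1) = 4 * int i + 3 - 2 * int N"
  using assms by (auto simp: perm_Dn_def perm_inv_Dn_def sign_Dn_def of_nat_diff)

lemma perm_inv_Dn:
  assumes "l \<in> {2..N + 1}"
  shows "perm_inv_Dn N l < N" "perm_Dn N (perm_inv_Dn N l) = l"
  using assms by (auto simp: perm_Dn_def perm_inv_Dn_def elim!: evenE oddE)

lemma sum_perm_Dn: "(\<Sum>i<N. F (perm_Dn N i)) = (\<Sum>l=2..N + 1. F l)"
  by (rule sum.reindex_bij_witness[of _ "perm_inv_Dn N" "perm_Dn N"])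
     (use perm_Dn perm_inv_Dn in auto)

text \<open>The coordinates 1 and n, at which zeta has 2n - 4 and 0, feed the two branches with a
  single node, the others the long branch. With f 1 = (j + e 1 + e n)/2 and h 1 = (j + e 1 - e n)/2
  the squares on the short branches add up to j^2 + (e 1)^2 + (e n)^2. Evenness of the coordinate
  sum makes the divisions exact.\<close>

definition star_coord_Dn :: "nat \<Rightarrow> (nat \<Rightarrow> int) \<Rightarrow> int \<times> (nat \<Rightarrow> int) \<times> (nat \<Rightarrow> int) \<times> (nat \<Rightarrow> int)" where
  "star_coord_Dn n e =
     (let g = (\<lambda>i\<in>{..<n - 2}. sign_Dn (n - 2) i * e (perm_Dn (n - 2) i)); j = (\<Sum>i<n - 2. g i)
      in (j, tuple_of [(j - e 1 - e n) div 2, (j + e 1 + e n) div 2], g,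
             tuple_of [(j - e 1 + e n) div 2, (j + e 1 - e n) div 2]))"

text \<open>Permuting coordinates and changing their signs does not affect the parity of the
  sum.\<close>

lemma even_star_coord_Dn:
  assumes n: "n \<ge> 4"
  defines "N \<equiv> n - 2"
  shows "even (\<Sum>l=1..n. e l) \<longleftrightarrow> even ((\<Sum>i<N. sign_Dn N i * e (perm_Dn N i)) + e 1 + e n)"
proof -
  have "(\<Sum>l=2..n - 1. e l) = (\<Sum>i<N. e (perm_Dn N i))"
    using n sum_perm_Dn[of e N] by (simp add: N_def Suc_diff_le numeral_2_eq_2 Suc_diff_Suc)
  moreover have "even ((\<Sum>i<N. sign_Dn N i * e (perm_Dn N i)) + (\<Sum>i<N. e (perm_Dn N i)))"
    unfolding sum.distrib[symmetric] by (intro dvd_sum) (auto simp: sign_Dn_def)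
  ultimately show ?thesis
    unfolding sum_atLeast1_split_last_two(2)[OF n] by auto
qed

lemma bij_star_coord_Dn:
  assumes n: "n \<ge> 4"
  shows "bij_betw (star_coord_Dn n) (even_lattice n) (star_set 2 (n - 2) 2)"
proof (rule bij_betwI)
  define N where "N = n - 2"
  have N: "n - 2 = N" "n = N + 2" "n - 1 = N + 1" using n by (auto simp: N_def)
  let ?e = "\<lambda>(j, f, g, h) l. if l = 1 then f 1 + h 1 - j else if l = n then f 1 - h 1
      else if l \<in> {2..n - 1} then (if even l then 1 else - 1) * g (perm_inv_Dn (n - 2) l) else (0 :: int)"
  show "star_coord_Dn n \<in> even_lattice n \<rightarrow> star_set 2 (n - 2) 2"
  proof
    fix e assume "e \<in> even_lattice n"
    hence "even ((\<Sum>i<N. sign_Dn N i * e (perm_Dn N i)) + e 1 + e n)"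
      using even_star_coord_Dn[OF n, of e] by (simp add: N even_lattice_def)
    thus "star_coord_Dn n e \<in> star_set 2 (n - 2) 2"
      by (auto simp: star_coord_Dn_def Let_def star_set_def N int_tuples_def[of N]
          intro!: tuple_of_in_int_tuples) presburger+
  qed
  show "?e (star_coord_Dn n e) = e" if e: "e \<in> even_lattice n" for e
  proof
    fix l
    define j where "j = (\<Sum>i<N. sign_Dn N i * e (perm_Dn N i))"
    have ev: "even (j + e 1 + e n)"
      using e even_star_coord_Dn[OF n, of e] by (simp add: N even_lattice_def j_def)
    consider "l = 1" | "l = n" | "l \<in> {2..n - 1}" | "l \<notin> {1..n}" by fastforce
    thus "?e (star_coord_Dn n e) l = e l"
    proof cases
      case 3
      hence "l \<in> {2..N + 1}" by (simp add: N)
      from perm_inv_Dn[OF this] perm_Dn(3)[OF perm_inv_Dn(1)[OF this]] show ?thesis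
        using 3 by (simp add: star_coord_Dn_def Let_def N)
    next
      case 4
      thus ?thesis using e n by (auto simp: star_coord_Dn_def Let_def even_lattice_def)
    qed (use ev n in \<open>simp_all add: star_coord_Dn_def Let_def N tuple_of_def j_def[symmetric], presburger+\<close>)
  qed
  have main: "star_coord_Dn n (?e x) = x \<and> ?e x \<in> even_lattice n" if mem: "x \<in> star_set 2 (n - 2) 2" for x
  proof -
    obtain j f g h where x: "x = (j, f, g, h)"
      and fgh: "f \<in> int_tuples 2 j" "g \<in> int_tuples N j" "h \<in> int_tuples 2 j"
      using mem by (auto simp: star_set_def N)
    obtain f1 where f: "f = tuple_of [j - f1, f1]" using fgh(1) by (rule int_tuples_2E)
    obtain h1 where h: "h = tuple_of [j - h1, h1]" using fgh(3) by (rule int_tuples_2E)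
    define e where "e = ?e x"
    have e1: "e 1 = f1 + h1 - j" "e n = f1 - h1"
      using n by (auto simp: e_def x f h tuple_of_def)
    have eg: "sign_Dn N i * e (perm_Dn N i) = g i" if i: "i < N" for i
    proof -
      have "perm_Dn N i \<noteq> 1" "perm_Dn N i \<noteq> n" "perm_Dn N i \<in> {2..n - 1}"
        using perm_Dn(1)[OF i] by (auto simp: N)
      thus ?thesis
        using perm_Dn(2)[OF i] unfolding e_def x perm_Dn(3)[OF i] by (simp add: N)
    qed
    have g: "(\<lambda>i\<in>{..<N}. sign_Dn N i * e (perm_Dn N i)) = g"
      using fgh(2) eg by (force simp: int_tuples_def PiE_def extensional_def restrict_def fun_eq_iff)
    have j: "(\<Sum>i<N. sign_Dn N i * e (perm_Dn N i)) = j" "(\<Sum>i<N. g i) = j"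
      using fgh(2) eg by (simp_all add: int_tuples_def)
    have "(j - (f1 + h1 - j) - (f1 - h1)) div 2 = j - f1" "(j + (f1 + h1 - j) + (f1 - h1)) div 2 = f1"
      "(j - (f1 + h1 - j) + (f1 - h1)) div 2 = j - h1" "(j + (f1 + h1 - j) - (f1 - h1)) div 2 = h1"
      by presburger+
    hence "star_coord_Dn n e = x"
      unfolding star_coord_Dn_def Let_def N(1) g j(2) e1 by (simp add: x f h)
    moreover have "even (j + e 1 + e n)" unfolding e1 by simp
    hence "e \<in> even_lattice n"
      using even_star_coord_Dn[OF n, of e] n unfolding N(1) j(1)
      by (auto simp: even_lattice_def e_def x)
    ultimately show ?thesis unfolding e_def by simp
  qed
  show "star_coord_Dn n (?e x) = x" if "x \<in> star_set 2 (n - 2) 2" for x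
    using main[OF that] by (rule conjunct1)
  show "?e \<in> star_set 2 (n - 2) 2 \<rightarrow> even_lattice n"
    using main by blast
qed

lemma sum_by_parts:
  fixes m :: "nat \<Rightarrow> int"
  assumes "m 0 = 0"
  shows "(\<Sum>l=1..M. (int M + 1 - int l) * (m l - m (l - 1))) = (\<Sum>i=1..M. m i)"
proof (induction M)
  case (Suc M)
  have tele: "(\<Sum>l=1..K. m l - m (l - 1)) = m K" for K
    by (induction K) (simp_all add: assms)
  have "(\<Sum>l=1..Suc M. (int (Suc M) + 1 - int l) * (m l - m (l - 1))) =
      (\<Sum>l=1..Suc M. (int M + 1 - int l) * (m l - m (l - 1))) + (\<Sum>l=1..Suc M. m l - m (l - 1))"
    unfolding sum.distrib[symmetric] by (intro sum.cong) (auto simp: algebra_simps)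
  thus ?case
    unfolding tele using Suc.IH by simp
qed auto

text \<open>Both sides are (zeta|m). In the standard coordinates the form is the dot product, so the
  coefficients on the right are the coordinates of zeta; summation by parts connects the
  two.\<close>

lemma linear_coord_Dn:
  assumes n: "n \<ge> 4" and m: "m \<in> root_lattice (Dn n)"
  defines "e \<equiv> coord_Dn n m"
  shows "2 * (\<Sum>i=1..n - 2. m i) - m 1 + m (n - 1) + m n =
    (2 * int n - 4) * e 1 + (\<Sum>l=2..n - 1. (2 * (int n - int l) - 1) * e l)"
proof -
  obtain k where k: "n = Suc (Suc (Suc k))"
    using n that[of "n - 3"] by simp
  have m0: "m 0 = 0" using m by (simp add: vectors_def)
  have "(\<Sum>i=1..n - 2. m i) = (\<Sum>l=1..n - 2. (int (n - 2) + 1 - int l) * (m l - m (l - 1)))"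
    using sum_by_parts[of m "n - 2", OF m0] by simp
  also have "\<dots> = (\<Sum>l=1..n - 2. (int n - 1 - int l) * e l)"
    by (intro sum.cong) (auto simp: e_def coord_Dn_def k)
  finally have "2 * (\<Sum>i=1..n - 2. m i) + (\<Sum>l=1..n - 2. e l) =
      (\<Sum>l=1..n - 2. (2 * (int n - int l) - 1) * e l)"
    by (simp add: sum_distrib_left flip: sum.distrib) (intro sum.cong; simp add: algebra_simps)
  moreover have "(\<Sum>l=1..n - 2. e l) = m (n - 2)"
    unfolding e_def by (rule sum_coord_Dn[OF n m]) simp
  moreover have "m 1 = e 1" "m (n - 1) + m n = m (n - 2) + e (n - 1)"
    using n m0 by (auto simp: e_def coord_Dn_def)
  moreover have "(\<Sum>l=1..n - 2. (2 * (int n - int l) - 1) * e l) =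
      (2 * int n - 3) * e 1 + (\<Sum>l=2..n - 2. (2 * (int n - int l) - 1) * e l)"
    by (subst sum.atLeast_Suc_atMost) (simp_all add: k numeral_2_eq_2)
  moreover have "(\<Sum>l=2..n - 1. (2 * (int n - int l) - 1) * e l) =
      (\<Sum>l=2..n - 2. (2 * (int n - int l) - 1) * e l) + e (n - 1)"
    by (simp add: k)
  ultimately show ?thesis
    by (simp add: algebra_simps)
qed

lemma norm_coord_Dn:
  assumes n: "n \<ge> 4" and m: "m \<in> root_lattice (Dn n)"
  shows "form (Dn n) m m = (\<Sum>l=1..n. (coord_Dn n m l)\<^sup>2)"
proof -
  have "(\<Sum>i<n - 2. (m (Suc i) - m i)\<^sup>2) = (\<Sum>l=1..n - 2. (coord_Dn n m l)\<^sup>2)"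
    by (rule sum.reindex_bij_witness[of _ "\<lambda>l. l - 1" Suc]) (auto simp: coord_Dn_def)
  moreover have "coord_Dn n m (n - 1) = m n + m (n - 1) - m (n - 2)" "coord_Dn n m n = m n - m (n - 1)"
    using n by (auto simp: coord_Dn_def)
  ultimately show ?thesis
    using n unfolding sum_atLeast1_split_last_two(1)[OF n] by (simp add: norm_Dn[OF _ m])
qed

lemma star_exponent_Dn:
  assumes n: "n \<ge> 4" and e: "e \<in> even_lattice n"
  shows "star_exponent (4 * real (n - 2)) 2 (n - 2) 2 (star_coord_Dn n e) =
    2 * (real n - 2) * of_int (\<Sum>l=1..n. (e l)\<^sup>2) +
    of_int ((2 * int n - 4) * e 1 + (\<Sum>l=2..n - 1. (2 * (int n - int l) - 1) * e l))"
proof -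
  define N where "N = n - 2"
  have N: "n - 2 = N" "n = N + 2" "n - 1 = N + 1" "N > 0" using n by (auto simp: N_def)
  have int_n: "int n = int N + 2" by (simp add: N(2))
  define g where "g i = sign_Dn N i * e (perm_Dn N i)" for i
  define j where "j = (\<Sum>i<N. g i)"
  define a where "a = e 1"
  define b where "b = e n"
  have "even (j + a + b)"
    using e even_star_coord_Dn[OF n, of e] by (simp add: N even_lattice_def j_def g_def a_def b_def)
  then obtain f1 where f1: "j + a + b = 2 * f1" by (elim evenE)
  have fh: "(j + a + b) div 2 = f1" "(j - a - b) div 2 = j - f1"
      "(j + a - b) div 2 = f1 - b" "(j - a + b) div 2 = j - f1 + b"
    using f1 by presburger+
  have g': "(\<lambda>i\<in>{..<N}. sign_Dn N i * e (perm_Dn N i)) = (\<lambda>i\<in>{..<N}. g i)"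
    by (simp only: g_def)
  have sum_g: "(\<Sum>i<N. (\<lambda>i\<in>{..<N}. g i) i) = j"
    by (simp add: j_def)
  have star: "star_coord_Dn n e =
      (j, tuple_of [j - f1, f1], \<lambda>i\<in>{..<N}. g i, tuple_of [j - f1 + b, f1 - b])"
    unfolding star_coord_Dn_def Let_def N(1) a_def[symmetric] b_def[symmetric] g' sum_g fh ..
  have sq: "(\<Sum>i<N. (g i)\<^sup>2) = (\<Sum>l=2..n - 1. (e l)\<^sup>2)"
  proof -
    have "(g i)\<^sup>2 = (e (perm_Dn N i))\<^sup>2" for i by (simp add: g_def sign_Dn_def)
    thus ?thesis using sum_perm_Dn[of "\<lambda>l. (e l)\<^sup>2" N] by (simp only: N(3))
  qed
  have "(\<Sum>i<N. (4 * int i + 3 - 2 * int N) * g i) = (\<Sum>i<N. (2 * (int N + 2 - int (perm_Dn N i)) - 1) * e (perm_Dn N i))"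
  proof (intro sum.cong refl)
    fix i assume "i \<in> {..<N}"
    hence i: "i < N" by simp
    have "s * x * (s * y) = x * y" if "s * s = 1" for s x y :: int
      using that by algebra
    moreover have "sign_Dn N i * sign_Dn N i = 1" by (simp add: sign_Dn_def)
    ultimately show "(4 * int i + 3 - 2 * int N) * g i = (2 * (int N + 2 - int (perm_Dn N i)) - 1) * e (perm_Dn N i)"
      unfolding perm_Dn(4)[OF i, symmetric] g_def by blast
  qed
  hence lin: "(\<Sum>i<N. (4 * int i + 3 - 2 * int N) * g i) = (\<Sum>l=2..n - 1. (2 * (int n - int l) - 1) * e l)"
    using sum_perm_Dn[of "\<lambda>l. (2 * (int N + 2 - int l) - 1) * e l" N] int_n by (simp only: N(3))
  have lin': "(\<Sum>i<N. (4 * int i + 3 - 2 * int N) * g i) = 4 * (\<Sum>i<N. int i * g i) + (3 - 2 * int N) * j"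
    by (simp add: j_def sum_distrib_left sum.distrib[symmetric] algebra_simps)
  define X where "X = (\<Sum>i<N. (real_of_int (g i))\<^sup>2)"
  define Y where "Y = (\<Sum>i<N. real i * real_of_int (g i))"
  have X: "real_of_int (\<Sum>l=1..n. (e l)\<^sup>2) = X + (of_int a)\<^sup>2 + (of_int b)\<^sup>2"
    unfolding sum_atLeast1_split_last_two(2)[OF n] sq[symmetric] X_def a_def b_def by simp
  have Y: "real_of_int (\<Sum>l=2..n - 1. (2 * (int n - int l) - 1) * e l) = 4 * Y + (3 - 2 * real N) * of_int j"
    unfolding lin[symmetric] lin' Y_def by simp
  have core: "core_exponent N (\<lambda>i\<in>{..<N}. g i) = real N / 2 * X + Y"
    by (simp add: core_exponent_def X_def Y_def)
  have "star_exponent (4 * real N) 2 N 2 (star_coord_Dn n e) =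
      2 * real N * ((of_int (j - f1))\<^sup>2 + (of_int f1)\<^sup>2 + of_int f1) + 4 * (real N / 2 * X + Y) +
      2 * real N * ((of_int (j - f1 + b))\<^sup>2 + (of_int (f1 - b))\<^sup>2 + of_int (f1 - b))
      - 2 * real N * (of_int j)\<^sup>2 + (3 - 4 * real N) * of_int j"
    using N(4) by (simp add: star star_exponent_def core core_exponent_tuple_of sum_lessThan_numerals)
  \<comment> \<open>The linear terms of the short branches give 2N (a + j). Together with (3 - 4N) j
    this leaves 2N a + (3 - 2N) j, whose second part completes 4 Y to the progression 4 i + 3 -
    2N.\<close>
  also have "\<dots> = 2 * real N * (X + (of_int a)\<^sup>2 + (of_int b)\<^sup>2) +
      (2 * real N * of_int a + (4 * Y + (3 - 2 * real N) * of_int j))"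
  proof -
    have a: "real_of_int a = 2 * of_int f1 - of_int j - of_int b"
      using arg_cong[OF f1, of real_of_int] by simp
    show ?thesis
      unfolding a of_int_add of_int_diff by (simp add: power2_eq_square algebra_simps)
  qed
  finally show ?thesis
    unfolding N(1) of_int_add[of "(2 * int n - 4) * e 1"] X Y by (simp add: N(2) a_def)
qed

lemma theta_Dn:
  assumes n: "n \<ge> 4" and \<tau>: "Im \<tau> > 0"
  shows "theta (Dn n) \<tau> =
    dedekind_eta (2 * \<tau>) ^ 2 * dedekind_eta (4 * of_nat (n - 2) * \<tau>) ^ (ade_rank (Dn n) + 2) /
      (dedekind_eta \<tau> * dedekind_eta (2 * of_nat (n - 2) * \<tau>) *
       dedekind_eta (2 * of_nat 2 * \<tau>) * dedekind_eta (2 * of_nat (n - 2) * \<tau>))"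
proof (rule theta_of_star[OF \<tau>])
  show "bij_betw (star_coord_Dn n \<circ> coord_Dn n) (root_lattice (Dn n)) (star_set 2 (n - 2) 2)"
    by (rule bij_betw_trans[OF bij_coord_Dn[OF n] bij_star_coord_Dn[OF n]])
  fix m assume m: "m \<in> root_lattice (Dn n)"
  have e: "coord_Dn n m \<in> even_lattice n"
    using bij_coord_Dn[OF n] m by (auto simp: bij_betw_def)
  have "real (n - 2) = real n - 2" using n by (simp add: of_nat_diff)
  thus "of_rat (theta_exponent (Dn n) m) =
      star_exponent (4 * real (n - 2)) 2 (n - 2) 2 ((star_coord_Dn n \<circ> coord_Dn n) m) +
      (4 * real (n - 2) * (real (ade_rank (Dn n)) + 1) - 1) / 24"
    unfolding theta_exponent_Dn[OF n] o_apply star_exponent_Dn[OF n e] norm_coord_Dn[OF n m]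
      linear_coord_Dn[OF n m]
    by (simp add: of_rat_add of_rat_mult of_rat_divide of_rat_diff del: of_int_sum of_int_add of_int_mult)
       (simp add: algebra_simps)
qed (use n in auto)

theorem theorem1p4:
  fixes \<Delta> :: ade and \<tau> :: complex
  assumes "is_ade \<Delta>" and "Im \<tau> > 0"
  shows "(\<forall>n. \<Delta> = An n \<longrightarrow>
            theta \<Delta> \<tau> = dedekind_eta (of_nat (n + 1) * \<tau>) ^ (n + 1) / dedekind_eta \<tau>) \<and>
         (\<forall>E F V :: nat.
            (\<exists>n. \<Delta> = Dn n \<and> (E, F, V) = (n - 2, 2, n - 2)) \<or>
            \<Delta> = E6 \<and> (E, F, V) = (6, 4, 4) \<or>
            \<Delta> = E7 \<and> (E, F, V) = (12, 8, 6) \<or>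
            \<Delta> = E8 \<and> (E, F, V) = (30, 20, 12) \<longrightarrow>
            theta \<Delta> \<tau> =
              dedekind_eta (2 * \<tau>) ^ 2 * dedekind_eta (4 * of_nat E * \<tau>) ^ (ade_rank \<Delta> + 2) /
              (dedekind_eta \<tau> * dedekind_eta (2 * of_nat E * \<tau>) *
               dedekind_eta (2 * of_nat F * \<tau>) * dedekind_eta (2 * of_nat V * \<tau>)))"
proof (intro conjI allI impI)
  fix n assume "\<Delta> = An n"
  thus "theta \<Delta> \<tau> = dedekind_eta (of_nat (n + 1) * \<tau>) ^ (n + 1) / dedekind_eta \<tau>"
    using assms theta_An by simp
next
  fix E F V :: nat
  assume "(\<exists>n. \<Delta> = Dn n \<and> (E, F, V) = (n - 2, 2, n - 2)) \<or>
          \<Delta> = E6 \<and> (E, F, V) = (6, 4, 4) \<or>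
          \<Delta> = E7 \<and> (E, F, V) = (12, 8, 6) \<or>
          \<Delta> = E8 \<and> (E, F, V) = (30, 20, 12)"
  then consider n where "\<Delta> = Dn n" "E = n - 2" "F = 2" "V = n - 2"
    | "\<Delta> = E6" "E = 6" "F = 4" "V = 4"
    | "\<Delta> = E7" "E = 12" "F = 8" "V = 6"
    | "\<Delta> = E8" "E = 30" "F = 20" "V = 12"
    by blast
  thus "theta \<Delta> \<tau> =
      dedekind_eta (2 * \<tau>) ^ 2 * dedekind_eta (4 * of_nat E * \<tau>) ^ (ade_rank \<Delta> + 2) /
      (dedekind_eta \<tau> * dedekind_eta (2 * of_nat E * \<tau>) *
       dedekind_eta (2 * of_nat F * \<tau>) * dedekind_eta (2 * of_nat V * \<tau>))"
  proof cases
    case 1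
    with assms(1) have "n \<ge> 4" by simp
    from theta_Dn[OF this assms(2)] show ?thesis unfolding 1 .
  next
    case 2
    show ?thesis unfolding 2 by (rule theta_E6[OF assms(2)])
  next
    case 3
    show ?thesis unfolding 3 by (rule theta_E7[OF assms(2)])
  next
    case 4
    show ?thesis unfolding 4 by (rule theta_E8[OF assms(2)])
  qed
qed

end
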